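(* Let $1\le k\le d$, let $\Phi:\mathbb R^d\times\mathbb R^d\to\mathbb R^k$ be a $C^\infty$ function such that $\operatorname{rank}(D_x\Phi)=k$ and $\operatorname{rank}(D_y\Phi)=k$ everywhere, and let $E,F\subset\mathbb R^d$ be compact sets. Suppose that the generalized Radon transforms $\mathcal R_{\vec t}$ associated with $\Phi$ satisfy, for some $\alpha_\Phi$ with $0\le\alpha_\Phi\le (d-k)/2$, the following: for every $s\in\mathbb R$ there is a constant $C_s<\infty$ with $$\|\mathcal R_{\vec t}\|_{L^2_s(\mathbb R^d)\to L^2_{s+\alpha_\Phi}(\mathbb R^d)}\le C_s\quad\text{for all }\vec t\in W.$$ Put $\beta_\Phi=\frac{d-k}{2}-\alpha_\Phi$. If $$\dim_{\mathcal H}(E)+\dim_{\mathcal H}(F)>2d-2\alpha_\Phi=d+k+2\beta_\Phi,$$ then $\Delta_\Phi(E,F)=\{\Phi(x,y):x\in E,\ y\in F\}\subset\mathbb R^k$ has nonempty interior.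
   Context: $\dim_{\mathcal H}$ denotes Hausdorff dimension and $L^2_s(\mathbb R^d)$ the $L^2$-based Sobolev space of order $s\in\mathbb R$. $W\subset\mathbb R^k$ is a bounded open set of parameters containing $\Delta_\Phi(E,F)$. For $\vec t\in W$ let $Z_{\vec t}=\{(x,y)\in\mathbb R^d\times\mathbb R^d:\Phi(x,y)=\vec t\}$, a smooth surface of codimension $k$, and $Z_{\vec t}^x=\{y:(x,y)\in Z_{\vec t}\}$. The Leray density $d\lambda_{\vec t}$ on $Z_{\vec t}$ induced by $\Phi$ is the smooth density with $\iint g(\Phi(x,y))h(x,y)\,dx\,dy=\int g(\vec t)\big(\int_{Z_{\vec t}}h\,d\lambda_{\vec t}\big)d\vec t$ for continuous, compactly supported $g$ and $h$. Let $d\rho_{\vec t}=b\,d\lambda_{\vec t}$, where $b\in C_0^\infty(\mathbb R^d\times\mathbb R^d)$ is nonvanishing on a neighborhood of $E\times F$. The generalized Radon transform is $\mathcal R_{\vec t}f(x)=\int_{Z_{\vec t}^x}f(y)$, the integral being taken with respect to this density; that is, $\mathcal R_{\vec t}$ is the operator with Schwartz kernel $d\rho_{\vec t}(x,y)=b(x,y)\,\delta_k(\Phi(x,y)-\vec t)$, so $\langle\mathcal R_{\vec t}f,h\rangle=\int_{Z_{\vec t}}f(y)h(x)\,d\rho_{\vec t}(x,y)$. *)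

theory Defs
  imports "HOL-Analysis.Analysis"
begin

subsection \<open>Hausdorff dimension\<close>

text \<open>
  The exponent \<open>0\<close> is treated separately because \<open>0 powr 0 = 0\<close>; the boundedness condition on the
  covering sets is needed because \<^const>\<open>diameter\<close> is unspecified on unbounded sets.
\<close>

definition hausdorff_gauge :: "real \<Rightarrow> 'a::metric_space set \<Rightarrow> ennreal" where
  "hausdorff_gauge s U =
     (if U = {} then 0 else if s = 0 then 1 else ennreal (diameter U powr s))"

definition hausdorff_content :: "real \<Rightarrow> real \<Rightarrow> 'a::metric_space set \<Rightarrow> ennreal" where
  "hausdorff_content \<delta> s A =
     (INF U\<in>{U :: nat \<Rightarrow> 'a set. A \<subseteq> (\<Union>i. U i) \<and> (\<forall>i. bounded (U i) \<and> diameter (U i) \<le> \<delta>)}.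
        \<Sum>i. hausdorff_gauge s (U i))"

definition hausdorff_outer_measure :: "real \<Rightarrow> 'a::metric_space set \<Rightarrow> ennreal" where
  "hausdorff_outer_measure s A = (SUP \<delta>\<in>{0<..}. hausdorff_content \<delta> s A)"

definition hausdorff_dim :: "'a::metric_space set \<Rightarrow> ereal" where
  "hausdorff_dim A = Inf (ereal ` {s. 0 \<le> s \<and> hausdorff_outer_measure s A = 0})"

definition hausdorff_measure_on :: "real \<Rightarrow> 'a::metric_space set \<Rightarrow> 'a measure" where
  "hausdorff_measure_on s Z =
     measure_of UNIV (sets borel) (\<lambda>A. hausdorff_outer_measure s (A \<inter> Z))"


subsection \<open>Smooth functions, test functions, Schwartz functions\<close>

primrec iter_deriv ::
  "'a list \<Rightarrow> ('a::real_normed_vector \<Rightarrow> 'b::real_normed_vector) \<Rightarrow> 'a \<Rightarrow> 'b" where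
  "iter_deriv [] f = f"
| "iter_deriv (v # vs) f = iter_deriv vs (\<lambda>x. frechet_derivative f (at x) v)"

text \<open>
  \<open>C\<^sup>\<infinity>\<close> on a finite-dimensional space: every iterated directional derivative exists and is again
  differentiable, hence continuous.
\<close>

definition smooth :: "('a::euclidean_space \<Rightarrow> 'b::real_normed_vector) \<Rightarrow> bool" where
  "smooth f \<longleftrightarrow> (\<forall>vs x. iter_deriv vs f differentiable (at x))"

definition compactly_supported :: "('a::topological_space \<Rightarrow> 'b::zero) \<Rightarrow> bool" where
  "compactly_supported f \<longleftrightarrow> compact (closure {x. f x \<noteq> 0})"

definition test_functions :: "('a::euclidean_space \<Rightarrow> complex) set" where
  "test_functions = {f. smooth f \<and> compactly_supported f}"

definition schwartz :: "('a::euclidean_space \<Rightarrow> complex) set" where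
  "schwartz =
     {f. smooth f \<and> (\<forall>vs (N::nat). bounded (range (\<lambda>x. (1 + norm x) ^ N *\<^sub>R iter_deriv vs f x)))}"

definition fourier :: "('a::euclidean_space \<Rightarrow> complex) \<Rightarrow> 'a \<Rightarrow> complex" where
  "fourier f \<xi> = (\<integral>x. cis (- (2 * pi * (x \<bullet> \<xi>))) * f x \<partial>lborel)"


subsection \<open>Sobolev spaces and operators between them\<close>

text \<open>
  A tempered distribution is represented by its values on Schwartz functions, extended by \<open>0\<close> to all
  other functions, so that equality of distributions is equality of HOL functions.
\<close>

type_synonym 'a distrib = "('a \<Rightarrow> complex) \<Rightarrow> complex"

definition distrib_of :: "('a::euclidean_space \<Rightarrow> complex) \<Rightarrow> 'a distrib" where
  "distrib_of f = (\<lambda>\<phi>. if \<phi> \<in> schwartz then \<integral>x. f x * \<phi> x \<partial>lborel else 0)"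

text \<open>
  The Fourier transform of the distribution \<open>u\<close> is the function \<open>g\<close>. Since the Fourier transform is a
  bijection of the Schwartz space, \<open>g\<close> determines \<open>u\<close>, and \<open>u\<close> determines \<open>g\<close> almost everywhere.
\<close>

definition has_fourier :: "'a::euclidean_space distrib \<Rightarrow> ('a \<Rightarrow> complex) \<Rightarrow> bool" where
  "has_fourier u g \<longleftrightarrow>
     g \<in> borel_measurable lborel \<and>
     (\<forall>\<phi>. \<phi> \<notin> schwartz \<longrightarrow> u \<phi> = 0) \<and>
     (\<forall>\<phi>\<in>schwartz. integrable lborel (\<lambda>\<xi>. g \<xi> * \<phi> \<xi>) \<and>
                   u (fourier \<phi>) = (\<integral>\<xi>. g \<xi> * \<phi> \<xi> \<partial>lborel))"

definition sobolev_weight :: "real \<Rightarrow> ('a::euclidean_space \<Rightarrow> complex) \<Rightarrow> 'a \<Rightarrow> real" where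
  "sobolev_weight s g \<xi> = (1 + (norm \<xi>)\<^sup>2) powr s * (cmod (g \<xi>))\<^sup>2"

definition sobolev_space :: "real \<Rightarrow> 'a::euclidean_space distrib set" where
  "sobolev_space s = {u. \<exists>g. has_fourier u g \<and> integrable lborel (sobolev_weight s g)}"

definition sobolev_norm :: "real \<Rightarrow> 'a::euclidean_space distrib \<Rightarrow> real" where
  "sobolev_norm s u =
     (let g = (SOME g. has_fourier u g) in sqrt (\<integral>\<xi>. sobolev_weight s g \<xi> \<partial>lborel))"

text \<open>
  \<open>T\<close> is an operator given on test functions. It has operator norm at most \<open>C\<close> from the Sobolev space
  of order \<open>s\<close> to that of order \<open>r\<close> if it extends to a linear operator on the whole of the former
  space satisfying this bound. Test functions being dense, the extension is unique.
\<close>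

definition sobolev_bounded ::
  "real \<Rightarrow> real \<Rightarrow> real \<Rightarrow> (('a::euclidean_space \<Rightarrow> complex) \<Rightarrow> 'a distrib) \<Rightarrow> bool" where
  "sobolev_bounded s r C T \<longleftrightarrow>
     (\<exists>S. (\<forall>f\<in>test_functions. S (distrib_of f) = T f) \<and>
          (\<forall>u\<in>sobolev_space s. \<forall>v\<in>sobolev_space s. \<forall>a b.
             S (\<lambda>\<phi>. a * u \<phi> + b * v \<phi>) = (\<lambda>\<phi>. a * S u \<phi> + b * S v \<phi>)) \<and>
          (\<forall>u\<in>sobolev_space s. S u \<in> sobolev_space r \<and> sobolev_norm r (S u) \<le> C * sobolev_norm s u))"


subsection \<open>Leray densities and generalized Radon transforms\<close>

definition level_set :: "('a \<times> 'a \<Rightarrow> 'b) \<Rightarrow> 'b \<Rightarrow> ('a \<times> 'a) set" where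
  "level_set \<Phi> t = {z. \<Phi> z = t}"

text \<open>
  On an \<open>m\<close>-dimensional submanifold \<open>Z\<close> the \<open>m\<close>-dimensional Hausdorff measure is a constant multiple
  of surface measure, so the smooth densities are the smooth multiples of it. A smooth function on
  a closed submanifold is the restriction of a smooth function on the ambient space.
\<close>

definition smooth_density_on :: "real \<Rightarrow> 'a::euclidean_space set \<Rightarrow> 'a measure \<Rightarrow> bool" where
  "smooth_density_on m Z \<mu> \<longleftrightarrow>
     (\<exists>w :: 'a \<Rightarrow> real. smooth w \<and> (\<forall>z\<in>Z. 0 \<le> w z) \<and>
        \<mu> = density (hausdorff_measure_on m Z) (\<lambda>z. ennreal (w z)))"

text \<open>
  The disintegration identity alone determines the measures only for almost every \<open>t\<close>. The Leray
  densities are the ones depending continuously on \<open>t\<close>, and this determines them for every \<open>t\<close>.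
\<close>

definition leray_density ::
  "((real^'d) \<times> (real^'d) \<Rightarrow> real^'k) \<Rightarrow> (real^'k \<Rightarrow> ((real^'d) \<times> (real^'d)) measure) \<Rightarrow> bool" where
  "leray_density \<Phi> \<Lambda> \<longleftrightarrow>
     (\<forall>t. smooth_density_on (2 * real CARD('d) - real CARD('k)) (level_set \<Phi> t) (\<Lambda> t)) \<and>
     (\<forall>t K. compact K \<longrightarrow> emeasure (\<Lambda> t) K < \<infinity>) \<and>
     (\<forall>h :: (real^'d) \<times> (real^'d) \<Rightarrow> complex.
        continuous_on UNIV h \<and> compactly_supported h \<longrightarrow>
          continuous_on UNIV (\<lambda>t. \<integral>z. h z \<partial>\<Lambda> t) \<and>
          (\<forall>g :: real^'k \<Rightarrow> complex. continuous_on UNIV g \<and> compactly_supported g \<longrightarrow>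
             (\<integral>z. g (\<Phi> z) * h z \<partial>lborel) = (\<integral>t. g t * (\<integral>z. h z \<partial>\<Lambda> t) \<partial>lborel)))"

text \<open>
  The operator with Schwartz kernel \<open>b d\<mu>\<close>: the pairing of its value at \<open>f\<close> with \<open>h\<close> is
  \<open>\<integral> f(y) h(x) b(x,y) d\<mu>(x,y)\<close>. For a Leray density \<open>\<mu>\<close> this is the generalized Radon transform.
\<close>

definition radon_transform ::
  "('a::euclidean_space \<times> 'a \<Rightarrow> complex) \<Rightarrow> ('a \<times> 'a) measure \<Rightarrow> ('a \<Rightarrow> complex) \<Rightarrow> 'a distrib" where
  "radon_transform b \<mu> f =
     (\<lambda>h. if h \<in> schwartz then \<integral>z. f (snd z) * h (fst z) * b z \<partial>\<mu> else 0)"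

end

theory Submission
  imports Defs "HOL-Probability.Probability" "HOL-Complex_Analysis.Great_Picard"
begin

text \<open>
  Let \<open>\<mu>\<close> and \<open>\<nu>\<close> be Frostman measures on small pieces of \<open>E\<close> and \<open>F\<close>, with exponents \<open>s\<^sub>E\<close> and \<open>s\<^sub>F\<close> such that
  \<open>s\<^sub>E + s\<^sub>F > 2d - 2\<alpha>\<close>. They lie in the Sobolev spaces of orders \<open>-\<sigma>\<^sub>E\<close> and \<open>-\<sigma>\<^sub>F\<close> whenever
  \<open>\<sigma> > (d - s)/2\<close>, and \<open>\<sigma>\<^sub>E + \<sigma>\<^sub>F = \<alpha>\<close> is possible. Hence the pairing of \<open>\<mu>\<close> with the Radon transform of \<open>\<nu>\<close>
  at level \<open>t\<close> is controlled uniformly in \<open>t \<in> W\<close>, and it is a uniform limit of the corresponding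
  pairings of smooth approximations, which are continuous in \<open>t\<close>. The limit is the density of the image of
  \<open>b (\<mu> \<times> \<nu>)\<close> under \<open>\<Phi>\<close>: it is continuous, vanishes off \<open>\<Phi>(E \<times> F)\<close>, and is not identically zero because
  \<open>b\<close> has almost constant phase on small pieces. So \<open>\<Phi>(E \<times> F)\<close> contains a nonempty open set.

  No limit measure is constructed. The measures are discrete, adapted to scale \<open>r\<close>, and smoothed at
  scale \<open>r\<close>: \<open>\<nu>\<close> by a compactly supported bump, since the transforms are given on test functions only, and
  \<open>\<mu>\<close> by a Gaussian, so that the smoothed measure is visibly a Fourier transform. Along a subsequence the
  Fourier transforms converge pointwise, and with the uniform energy bounds this gives convergence in
  the Sobolev norms. All energies are computed from Gaussian integrals.
\<close>

section \<open>Smooth and Schwartz functions\<close>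

text \<open>The estimate is a duality, used at a single order: the transform sends order -\<sigma>F
  to order -\<sigma>F + \<alpha> = \<sigma>E, the dual of the space that contains \<mu>. So (d -
  sE)/2 + (d - sF)/2 has to lie strictly below \<alpha>, which is the dimension condition. Its slack
  is spent twice: the exponents are lowered below the dimensions so that Frostman weights exist, and
  orders \<sigma>' < \<sigma> stay available, so that bounds at order -\<sigma>' give smallness of
  high frequencies at order -\<sigma>.

  Smoothing by a Gaussian has a price: the smoothed \<mu> charges points far from E. Off the image
  this leaves tails of size r^(-2d) exp (-pi \<delta>^2 / r^2), which tend to 0; in the lower bound
  the Gaussian is replaced by a multiple of the indicator of a ball below it. As b is complex
  valued, cancellation could destroy the density; where \<open>Re (cnj b0 * b z)\<close> is bounded
  below by a positive constant it cannot.\<close>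

abbreviation dir_deriv ::
  "('a::real_normed_vector \<Rightarrow> 'b::real_normed_vector) \<Rightarrow> 'a \<Rightarrow> 'a \<Rightarrow> 'b" where
  "dir_deriv f v \<equiv> (\<lambda>x. frechet_derivative f (at x) v)"

text \<open>Recursion on the order, with the directions quantified inside, in place of lists of
  directions: the product rule then closes an induction on \<open>n\<close> over arbitrary
  functions, with no Leibniz expansion to organise.\<close>

primrec hered ::
  "(('a::real_normed_vector \<Rightarrow> 'b::real_normed_vector) \<Rightarrow> bool) \<Rightarrow> nat \<Rightarrow> ('a \<Rightarrow> 'b) \<Rightarrow> bool" where
  "hered P 0 f = P f"
| "hered P (Suc n) f = (P f \<and> (\<forall>v. hered P n (dir_deriv f v)))"

definition diffable :: "('a::real_normed_vector \<Rightarrow> 'b::real_normed_vector) \<Rightarrow> bool" where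
  "diffable f \<longleftrightarrow> (\<forall>x. f differentiable (at x))"

definition rapid :: "('a::real_normed_vector \<Rightarrow> 'b::real_normed_vector) \<Rightarrow> bool" where
  "rapid f \<longleftrightarrow> diffable f \<and> (\<forall>N::nat. \<exists>C. \<forall>x. (1 + norm x) ^ N * norm (f x) \<le> C)"

text \<open>Combined with \<open>hered\<close>, the multipliers of the Schwartz space; the growth
  exponent may change with each derivative.\<close>

definition tempered :: "('a::real_normed_vector \<Rightarrow> 'b::real_normed_vector) \<Rightarrow> bool" where
  "tempered f \<longleftrightarrow> diffable f \<and> (\<exists>(N::nat) C. \<forall>x. norm (f x) \<le> C * (1 + norm x) ^ N)"

lemma hered_iff_iter_deriv: "(\<forall>n. hered P n f) \<longleftrightarrow> (\<forall>vs. P (iter_deriv vs f))"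
proof
  have "hered P (length vs) f \<Longrightarrow> P (iter_deriv vs f)" for vs
    by (induction vs arbitrary: f) auto
  then show "\<forall>n. hered P n f \<Longrightarrow> \<forall>vs. P (iter_deriv vs f)" by blast
next
  have "(\<forall>vs. P (iter_deriv vs f)) \<Longrightarrow> hered P n f" for n
  proof (induction n arbitrary: f)
    case 0
    then have "P (iter_deriv [] f)" by (rule spec)
    then show ?case by simp
  next
    case (Suc n)
    have "P (iter_deriv vs (dir_deriv f v))" for v vs
      using Suc.prems[THEN spec, of "v # vs"] by simp
    moreover have "P f" using Suc.prems[THEN spec, of "[]"] by simp
    ultimately show ?case using Suc.IH by simp
  qed
  then show "\<forall>vs. P (iter_deriv vs f) \<Longrightarrow> \<forall>n. hered P n f" by blast
qed

section \<open>Closure properties of hereditary predicates\<close>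

lemma hered_Suc_mono: "hered P (Suc n) f \<Longrightarrow> hered P n f"
proof (induction n arbitrary: f)
  case (Suc n)
  have "hered P n (dir_deriv f v)" for v
    using Suc.prems by (intro Suc.IH) (metis hered.simps(2))
  moreover have "P f" using Suc.prems by simp
  ultimately show ?case by simp
qed auto

lemma hered_weaken: "hered P n f \<Longrightarrow> (\<And>f. P f \<Longrightarrow> Q f) \<Longrightarrow> hered Q n f"
  by (induction n arbitrary: f) auto

text \<open>For explicit families, such as characters or transforms of Schwartz functions, it is
  easier to name a set closed under directional derivatives than to induct on the order.\<close>

lemma hered_coinduct:
  assumes "f \<in> S" "\<And>f. f \<in> S \<Longrightarrow> P f" "\<And>f v. f \<in> S \<Longrightarrow> dir_deriv f v \<in> S"
  shows "hered P n f"
  using assms(1) by (induction n arbitrary: f) (auto intro: assms)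

lemma diffable_has_derivative:
  "diffable f \<Longrightarrow> (f has_derivative frechet_derivative f (at x)) (at x)"
  by (simp add: diffable_def frechet_derivative_works)

lemma dir_deriv_eqI:
  "(\<And>x. (f has_derivative f' x) (at x)) \<Longrightarrow> dir_deriv f v = (\<lambda>x. f' x v)"
  by (intro ext) (metis frechet_derivative_at)

lemma hered_add:
  assumes add: "\<And>f g. P f \<Longrightarrow> P g \<Longrightarrow> P (\<lambda>x. f x + g x)"
    and diff: "\<And>f. P f \<Longrightarrow> diffable f"
  shows "hered P n f \<Longrightarrow> hered P n g \<Longrightarrow> hered P n (\<lambda>x. f x + g x)"
proof (induction n arbitrary: f g)
  case (Suc n)
  have "dir_deriv (\<lambda>x. f x + g x) v = (\<lambda>x. dir_deriv f v x + dir_deriv g v x)" for v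
    using Suc.prems
    by (intro dir_deriv_eqI has_derivative_add diffable_has_derivative diff) auto
  with Suc show ?case by (auto intro: add)
qed (auto intro: add)

lemma hered_linear:
  assumes L: "bounded_linear L" and PQ: "\<And>f. P f \<Longrightarrow> Q (\<lambda>x. L (f x))"
    and diff: "\<And>f. P f \<Longrightarrow> diffable f"
  shows "hered P n f \<Longrightarrow> hered Q n (\<lambda>x. L (f x))"
proof (induction n arbitrary: f)
  case (Suc n)
  have "dir_deriv (\<lambda>x. L (f x)) v = (\<lambda>x. L (dir_deriv f v x))" for v
    using Suc.prems
    by (intro dir_deriv_eqI bounded_linear.has_derivative[OF L] diffable_has_derivative diff) auto
  with Suc show ?case by (auto intro: PQ)
qed (auto intro: PQ)

text \<open>Three predicates, since a product may live in another class than its factors: tempered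
  times rapid is rapid. Each term of the product rule differentiates one factor only, and
  \<open>hered_Suc_mono\<close> lowers the order of the other.\<close>

lemma hered_bilinear:
  assumes B: "bounded_bilinear B"
    and mult: "\<And>f g. P f \<Longrightarrow> Q g \<Longrightarrow> R (\<lambda>x. B (f x) (g x))"
    and add: "\<And>f g. R f \<Longrightarrow> R g \<Longrightarrow> R (\<lambda>x. f x + g x)"
    and P: "\<And>f. P f \<Longrightarrow> diffable f" and Q: "\<And>f. Q f \<Longrightarrow> diffable f"
    and R: "\<And>f. R f \<Longrightarrow> diffable f"
  shows "hered P n f \<Longrightarrow> hered Q n g \<Longrightarrow> hered R n (\<lambda>x. B (f x) (g x))"
proof (induction n arbitrary: f g)
  case (Suc n)
  have eq: "dir_deriv (\<lambda>x. B (f x) (g x)) v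
      = (\<lambda>x. B (f x) (dir_deriv g v x) + B (dir_deriv f v x) (g x))" for v
    using Suc.prems
    by (intro dir_deriv_eqI bounded_bilinear.FDERIV[OF B] diffable_has_derivative)
      (auto intro: P Q)
  have "hered R n (\<lambda>x. B (f x) (dir_deriv g v x) + B (dir_deriv f v x) (g x))" for v
  proof (rule hered_add[where P=R])
    show "hered R n (\<lambda>x. B (f x) (dir_deriv g v x))"
      using Suc.prems by (intro Suc.IH) (blast intro: hered_Suc_mono, simp)
    show "hered R n (\<lambda>x. B (dir_deriv f v x) (g x))"
      using Suc.prems by (intro Suc.IH) (simp, blast intro: hered_Suc_mono)
  qed (fact add R)+
  with Suc.prems show ?case by (auto simp: eq intro: mult)
qed (auto intro: mult)

lemma smooth_iff_hered: "smooth f \<longleftrightarrow> (\<forall>n. hered diffable n f)"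
  by (auto simp: smooth_def hered_iff_iter_deriv diffable_def)

lemma diffable_add: "diffable f \<Longrightarrow> diffable g \<Longrightarrow> diffable (\<lambda>x. f x + g x)"
  by (auto simp: diffable_def)

lemma diffable_bilinear:
  "bounded_bilinear B \<Longrightarrow> diffable f \<Longrightarrow> diffable g \<Longrightarrow> diffable (\<lambda>x. B (f x) (g x))"
  unfolding diffable_def differentiable_def by (blast dest: bounded_bilinear.FDERIV)

lemma hered_diffable_mult:
  fixes f g :: "'a::real_normed_vector \<Rightarrow> 'b::real_normed_algebra"
  assumes "hered diffable n f" "hered diffable n g"
  shows "hered diffable n (\<lambda>x. f x * g x)"
  using assms
  by (rule hered_bilinear[OF bounded_bilinear_mult, where P=diffable and Q=diffable and R=diffable, rotated -2])
    (auto intro: diffable_add diffable_bilinear[OF bounded_bilinear_mult])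

text \<open>The derivative of the composite is another member of \<open>G\<close> composed with
  \<open>u\<close>, times a derivative of \<open>u\<close>. Closure of \<open>G\<close> under
  differentiation lets the induction run over all of \<open>G\<close> at once; the case of interest
  is \<open>range bump_fun\<close>.\<close>

lemma hered_compose:
  fixes u :: "'a::real_normed_vector \<Rightarrow> 'c::real_normed_field"
  assumes G: "\<And>h. h \<in> G \<Longrightarrow> \<exists>h'\<in>G. \<forall>z. (h has_field_derivative h' z) (at z)"
  shows "h \<in> G \<Longrightarrow> hered diffable n u \<Longrightarrow> hered diffable n (\<lambda>x. h (u x))"
proof -
  have der: "((\<lambda>x. h (u x)) has_derivative (\<lambda>w. h' (u x) * frechet_derivative u (at x) w)) (at x)"
    if "diffable u" "\<And>z. (h has_field_derivative h' z) (at z)" for h h' x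
    using has_derivative_compose[OF diffable_has_derivative[OF that(1)]
        that(2)[unfolded has_field_derivative_def]] by simp
  have diff: "diffable (\<lambda>x. h (u x))" if "h \<in> G" "diffable u" for h
  proof -
    from G[OF that(1)] obtain h' where "\<And>z. (h has_field_derivative h' z) (at z)" by blast
    from der[OF that(2) this] show ?thesis unfolding diffable_def differentiable_def by blast
  qed
  show "h \<in> G \<Longrightarrow> hered diffable n u \<Longrightarrow> hered diffable n (\<lambda>x. h (u x))"
  proof (induction n arbitrary: h)
    case 0
    then show ?case using diff by simp
  next
    case (Suc n)
    from G[OF \<open>h \<in> G\<close>] obtain h' where h': "h' \<in> G" "\<And>z. (h has_field_derivative h' z) (at z)"
      by blast
    have du: "diffable u" using Suc.prems by simp
    have "hered diffable n (\<lambda>x. h' (u x) * dir_deriv u v x)" for v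
      using Suc.prems
      by (auto intro!: hered_diffable_mult Suc.IH[OF h'(1)] hered_Suc_mono[of _ n u])
    with diff[OF Suc.prems(1) du] show ?case
      by (simp add: dir_deriv_eqI[OF der[OF du h'(2)]])
  qed
qed

lemma smooth_add: "smooth f \<Longrightarrow> smooth g \<Longrightarrow> smooth (\<lambda>x. f x + g x)"
  unfolding smooth_iff_hered by (intro allI hered_add[where P=diffable] diffable_add) auto

lemma smooth_mult:
  fixes f g :: "'a::euclidean_space \<Rightarrow> 'b::real_normed_algebra"
  shows "smooth f \<Longrightarrow> smooth g \<Longrightarrow> smooth (\<lambda>x. f x * g x)"
  unfolding smooth_iff_hered
  by (blast intro: hered_diffable_mult)

lemma diffable_linear:
  assumes "bounded_linear L" "diffable f"
  shows "diffable (\<lambda>x. L (f x))"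
  using bounded_linear.has_derivative[OF assms(1) diffable_has_derivative[OF assms(2)]]
  unfolding diffable_def differentiable_def by blast

lemma smooth_linear:
  assumes "bounded_linear L" "smooth f"
  shows "smooth (\<lambda>x. L (f x))"
  unfolding smooth_iff_hered
proof
  fix n
  from assms(2) have "hered diffable n f" by (simp add: smooth_iff_hered)
  then show "hered diffable n (\<lambda>x. L (f x))"
    by (rule hered_linear[OF assms(1), where P=diffable, rotated -1]) (simp_all add: diffable_linear[OF assms(1)])
qed

lemma smooth_const: "smooth (\<lambda>x. c)"
proof -
  have "hered diffable n f" if "f \<in> range (\<lambda>c x. c)" for n f
    using that by (rule hered_coinduct) (auto simp: diffable_def frechet_derivative_const)
  then show ?thesis unfolding smooth_iff_hered by auto
qed

lemma smooth_prod:
  fixes f :: "'i \<Rightarrow> 'a::euclidean_space \<Rightarrow> 'b::real_normed_field"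
  shows "(\<And>i. i \<in> I \<Longrightarrow> smooth (f i)) \<Longrightarrow> smooth (\<lambda>x. \<Prod>i\<in>I. f i x)"
  by (induction I rule: infinite_finite_induct) (auto intro: smooth_const smooth_mult)

lemma smooth_sum: "(\<And>i. i \<in> I \<Longrightarrow> smooth (f i)) \<Longrightarrow> smooth (\<lambda>x. \<Sum>i\<in>I. f i x)"
  by (induction I rule: infinite_finite_induct) (auto intro: smooth_const smooth_add)

lemma smooth_differentiable: "smooth f \<Longrightarrow> f differentiable (at x)"
  unfolding smooth_def by (metis iter_deriv.simps(1))

lemma smooth_continuous_on: "smooth f \<Longrightarrow> continuous_on S f"
  by (meson differentiable_imp_continuous_on differentiable_on_def differentiable_at_withinI
      smooth_differentiable)

section \<open>Affine functions and characters as multipliers\<close>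

lemma hered_tempered_affine: "hered tempered n (\<lambda>x::'a::real_inner. c * complex_of_real (x \<bullet> v) + d)"
proof -
  have der: "((\<lambda>x::'a. c * complex_of_real (x \<bullet> v) + d) has_derivative
      (\<lambda>w. c * complex_of_real (w \<bullet> v))) (at x)" for c v d x
    by (auto intro!: derivative_eq_intros)
  have "tempered (\<lambda>x::'a. c * complex_of_real (x \<bullet> v) + d)" for c v d
    unfolding tempered_def
  proof (intro conjI exI[of _ "1::nat"] exI[of _ "cmod c * norm v + cmod d"] allI)
    show "diffable (\<lambda>x::'a. c * complex_of_real (x \<bullet> v) + d)"
      using der unfolding diffable_def differentiable_def by blast
    fix x :: 'a
    have "cmod (c * complex_of_real (x \<bullet> v) + d) \<le> cmod c * \<bar>x \<bullet> v\<bar> + cmod d"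
      by (metis norm_triangle_ineq norm_mult norm_of_real)
    also have "\<dots> \<le> cmod c * (norm x * norm v) + cmod d"
      by (intro add_mono mult_left_mono Cauchy_Schwarz_ineq2) auto
    also have "\<dots> \<le> (cmod c * norm v + cmod d) * (1 + norm x) ^ 1"
      by (simp add: algebra_simps)
    finally show "cmod (c * complex_of_real (x \<bullet> v) + d) \<le> (cmod c * norm v + cmod d) * (1 + norm x) ^ 1" .
  qed
  \<comment> \<open>The derivative is constant; written with coefficient 0 and vector 0 it stays
    within the same family.\<close>
  moreover have "dir_deriv (\<lambda>x::'a. c * complex_of_real (x \<bullet> v) + d) w
      = (\<lambda>x. 0 * complex_of_real (x \<bullet> 0) + c * complex_of_real (w \<bullet> v))" for c v d w
    by (simp add: dir_deriv_eqI[OF der])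
  ultimately show ?thesis
    by (intro hered_coinduct[where S="{f. \<exists>c v d. f = (\<lambda>x::'a. c * complex_of_real (x \<bullet> v) + d)}"]) blast+
qed

lemma has_derivative_character:
  "((\<lambda>x::'a::real_inner. c * cis (x \<bullet> v)) has_derivative (\<lambda>w. (c * \<i> * (w \<bullet> v)) * cis (x \<bullet> v))) (at x)"
proof -
  have "((\<lambda>x::'a. \<i> * complex_of_real (x \<bullet> v)) has_derivative (\<lambda>w. \<i> * complex_of_real (w \<bullet> v))) (at x)"
    by (auto intro!: derivative_eq_intros)
  from has_derivative_compose[OF this DERIV_exp[unfolded has_field_derivative_def]]
  have "((\<lambda>x::'a. c * cis (x \<bullet> v)) has_derivative (\<lambda>w. c * (cis (x \<bullet> v) * (\<i> * (w \<bullet> v))))) (at x)"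
    unfolding cis_conv_exp by (rule has_derivative_mult_right)
  then show ?thesis by (simp add: algebra_simps)
qed

lemma hered_tempered_character: "hered tempered n (\<lambda>x::'a::real_inner. c * cis (x \<bullet> v))"
proof (rule hered_coinduct[where S="range (\<lambda>c. (\<lambda>x::'a. c * cis (x \<bullet> v)))"])
  fix f :: "'a \<Rightarrow> complex" assume "f \<in> range (\<lambda>c. (\<lambda>x::'a. c * cis (x \<bullet> v)))"
  then obtain c where f: "f = (\<lambda>x::'a. c * cis (x \<bullet> v))" by blast
  show "tempered f"
    unfolding tempered_def diffable_def differentiable_def f
    by (auto intro: has_derivative_character intro!: exI[of _ "0::nat"] exI[of _ "cmod c"] simp: norm_mult)
  show "dir_deriv f w \<in> range (\<lambda>c. (\<lambda>x::'a. c * cis (x \<bullet> v)))" for w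
    unfolding f dir_deriv_eqI[OF has_derivative_character] by blast
qed auto

subsection \<open>A bump function\<close>

text \<open>The polynomial parameter makes the family closed under differentiation: with y = 1/x,
  the derivative replaces p by y^2 (p - p').\<close>

definition bump_fun :: "real poly \<Rightarrow> real \<Rightarrow> real" where
  "bump_fun p x = (if x > 0 then poly p (inverse x) * exp (- inverse x) else 0)"

lemma bump_fun_has_derivative:
  "(bump_fun p has_field_derivative bump_fun ([:0, 0, 1:] * (p - pderiv p)) x) (at x)"
proof -
  consider "x > 0" | "x < 0" | "x = 0" by linarith
  then show ?thesis
  proof cases
    case 1
    have "((\<lambda>x. poly p (inverse x) * exp (- inverse x)) has_field_derivative
        bump_fun ([:0, 0, 1:] * (p - pderiv p)) x) (at x)"
      unfolding bump_fun_def using 1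
      by (auto intro!: derivative_eq_intros DERIV_chain'[where g="poly p", OF _ poly_DERIV]
          simp: algebra_simps power2_eq_square)
    then show ?thesis
      by (rule has_field_derivative_transform_within_open[where S="{0<..}"])
        (use 1 in \<open>auto simp: bump_fun_def\<close>)
  next
    case 2
    have "((\<lambda>x. 0) has_field_derivative bump_fun ([:0, 0, 1:] * (p - pderiv p)) x) (at x)"
      using 2 by (simp add: bump_fun_def)
    then show ?thesis
      by (rule has_field_derivative_transform_within_open[where S="{..<0}"])
        (use 2 in \<open>auto simp: bump_fun_def\<close>)
  next
    case 3
    have poly_div_exp: "((\<lambda>y. poly q y / exp y) \<longlongrightarrow> 0) at_top" for q :: "real poly"
    proof -
      have "((\<lambda>y. \<Sum>i\<le>degree q. coeff q i * (y ^ i / exp y)) \<longlongrightarrow> (\<Sum>i\<le>degree q. coeff q i * 0)) at_top"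
        by (intro tendsto_intros tendsto_power_div_exp_0)
      then show ?thesis by (simp add: poly_altdef sum_divide_distrib)
    qed
    \<comment> \<open>At the origin the quotient from the right is y p(y) / exp y with y = 1/x,
      where \<open>pCons 0 p\<close> stands for y p(y); from the left it is 0.\<close>
    from poly_div_exp[of "pCons 0 p"] have "((\<lambda>x. poly (pCons 0 p) (inverse x) / exp (inverse x)) \<longlongrightarrow> 0) (at_right (0::real))"
      by (rule filterlim_compose[OF _ filterlim_inverse_at_top_right])
    then have "((\<lambda>x. (bump_fun p x - bump_fun p 0) / (x - 0)) \<longlongrightarrow> 0) (at_right 0)"
      by (rule Lim_transform_eventually)
        (auto simp: eventually_at_right_less bump_fun_def exp_minus field_simps
          intro!: eventually_at_rightI[of 0 1])
    moreover have "((\<lambda>x. (bump_fun p x - bump_fun p 0) / (x - 0)) \<longlongrightarrow> 0) (at_left 0)"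
      by (rule Lim_transform_eventually[OF tendsto_const])
        (auto simp: bump_fun_def intro!: eventually_at_leftI[of "-1" 0])
    ultimately have "((\<lambda>x. (bump_fun p x - bump_fun p 0) / (x - 0)) \<longlongrightarrow> 0) (at 0)"
      by (simp add: filterlim_split_at)
    then show ?thesis
      using 3 by (simp add: has_field_derivative_iff bump_fun_def)
  qed
qed

abbreviation "bump1 \<equiv> bump_fun 1"

lemma bump1_eq: "bump1 x = (if x > 0 then exp (- inverse x) else 0)"
  by (simp add: bump_fun_def)

lemma smooth_bump1: "smooth u \<Longrightarrow> smooth (\<lambda>x. bump1 (u x))"
  unfolding smooth_iff_hered
  by (metis (no_types, lifting) hered_compose[of "range bump_fun" bump1 _ u] bump_fun_has_derivative rangeE rangeI)

lemma smooth_of_real: "smooth u \<Longrightarrow> smooth (\<lambda>x. complex_of_real (u x))"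
  by (rule smooth_linear[OF bounded_linear_of_real])

lemma smooth_inner_affine: "smooth (\<lambda>x::'a::euclidean_space. c * (x \<bullet> v) + d)"
proof -
  have "smooth (\<lambda>x::'a. complex_of_real c * complex_of_real (x \<bullet> v) + complex_of_real d)"
    unfolding smooth_iff_hered
    by (intro allI hered_weaken[OF hered_tempered_affine]) (simp add: tempered_def)
  from smooth_linear[OF bounded_linear_Re this] show ?thesis by simp
qed

lemma smooth_norm_sq: "smooth (\<lambda>x::'a::euclidean_space. (norm (x - a))\<^sup>2)"
proof -
  have "smooth (\<lambda>x::'a. \<Sum>b\<in>Basis. (1 * (x \<bullet> b) + (- (a \<bullet> b))) * (1 * (x \<bullet> b) + (- (a \<bullet> b))))"
    by (intro smooth_sum smooth_mult smooth_inner_affine)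
  moreover have "(\<Sum>b\<in>Basis. (1 * (x \<bullet> b) + (- (a \<bullet> b))) * (1 * (x \<bullet> b) + (- (a \<bullet> b)))) = (norm (x - a))\<^sup>2" for x
    by (subst power2_norm_eq_inner, subst euclidean_inner) (simp add: inner_diff_left)
  ultimately show ?thesis by simp
qed

subsection \<open>The Schwartz space\<close>

lemma schwartz_iff_hered: "f \<in> schwartz \<longleftrightarrow> (\<forall>n. hered rapid n f)"
proof -
  have "bounded (range (\<lambda>x. (1 + norm x) ^ N *\<^sub>R g x)) \<longleftrightarrow>
      (\<exists>C. \<forall>x. (1 + norm x) ^ N * norm (g x) \<le> C)" for N and g :: "'a \<Rightarrow> complex"
    by (auto simp: bounded_iff abs_of_nonneg)
  then show ?thesis
    unfolding hered_iff_iter_deriv schwartz_def rapid_def smooth_def diffable_def by auto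
qed

lemma rapid_bound: "rapid f \<Longrightarrow> \<exists>C. \<forall>x. (1 + norm x) ^ N * norm (f x) \<le> C"
  by (simp add: rapid_def)

lemma rapid_add:
  assumes "rapid f" "rapid g"
  shows "rapid (\<lambda>x. f x + g x)"
  unfolding rapid_def
proof (intro conjI allI)
  show "diffable (\<lambda>x. f x + g x)" using assms by (simp add: rapid_def diffable_add)
  fix N
  obtain C D where "\<And>x. (1 + norm x) ^ N * norm (f x) \<le> C" "\<And>x. (1 + norm x) ^ N * norm (g x) \<le> D"
    using rapid_bound[OF assms(1)] rapid_bound[OF assms(2)] by metis
  then have "(1 + norm x) ^ N * norm (f x + g x) \<le> C + D" for x
    by (smt (verit, best) distrib_left mult_left_mono norm_ge_zero norm_triangle_ineq zero_le_power)
  then show "\<exists>C. \<forall>x. (1 + norm x) ^ N * norm (f x + g x) \<le> C" by blast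
qed

text \<open>The growth exponent M of f is paid for by decay of order N + M of g.\<close>

lemma rapid_tempered_mult:
  fixes f :: "'a::real_normed_vector \<Rightarrow> 'b::real_normed_algebra"
  assumes "tempered f" "rapid g"
  shows "rapid (\<lambda>x. f x * g x)"
  unfolding rapid_def
proof (intro conjI allI)
  show "diffable (\<lambda>x. f x * g x)"
    using assms by (simp add: rapid_def tempered_def diffable_bilinear[OF bounded_bilinear_mult])
  fix N
  obtain M C where C: "\<And>x. norm (f x) \<le> C * (1 + norm x) ^ M"
    using assms(1) unfolding tempered_def by auto
  have "0 \<le> C" using order_trans[OF norm_ge_zero C[of 0]] by simp
  obtain D where D: "\<And>x. (1 + norm x) ^ (N + M) * norm (g x) \<le> D"
    using rapid_bound[OF assms(2)] by metis
  have "(1 + norm x) ^ N * norm (f x * g x) \<le> C * D" for x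
  proof -
    have "(1 + norm x) ^ N * norm (f x * g x) \<le> (1 + norm x) ^ N * ((C * (1 + norm x) ^ M) * norm (g x))"
      by (intro mult_left_mono order_trans[OF norm_mult_ineq] mult_right_mono C) auto
    also have "\<dots> = C * ((1 + norm x) ^ (N + M) * norm (g x))"
      by (simp add: power_add)
    also have "\<dots> \<le> C * D" using \<open>0 \<le> C\<close> D by (rule mult_left_mono[rotated])
    finally show ?thesis .
  qed
  then show "\<exists>C. \<forall>x. (1 + norm x) ^ N * norm (f x * g x) \<le> C" by blast
qed

lemma rapid_diffable: "rapid f \<Longrightarrow> diffable f"
  by (simp add: rapid_def)

lemma tempered_diffable: "tempered f \<Longrightarrow> diffable f"
  by (simp add: tempered_def)

lemma hered_rapid_tempered_mult:
  fixes f :: "'a::real_normed_vector \<Rightarrow> 'b::real_normed_algebra"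
  assumes "hered tempered n f" "hered rapid n g"
  shows "hered rapid n (\<lambda>x. f x * g x)"
  using assms
  by (rule hered_bilinear[OF bounded_bilinear_mult, where P=tempered and Q=rapid and R=rapid, rotated -2])
    (simp_all add: tempered_diffable rapid_diffable rapid_tempered_mult rapid_add)

lemma schwartz_add: "f \<in> schwartz \<Longrightarrow> g \<in> schwartz \<Longrightarrow> (\<lambda>x. f x + g x) \<in> schwartz"
  unfolding schwartz_iff_hered by (simp add: hered_add[of rapid, OF rapid_add rapid_diffable])

lemma schwartz_tempered_mult:
  "(\<And>n. hered tempered n p) \<Longrightarrow> f \<in> schwartz \<Longrightarrow> (\<lambda>x. p x * f x) \<in> schwartz"
  unfolding schwartz_iff_hered by (simp add: hered_rapid_tempered_mult)

lemma schwartz_cmult: "f \<in> schwartz \<Longrightarrow> (\<lambda>x. c * f x) \<in> schwartz"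
  using schwartz_tempered_mult[OF hered_tempered_affine[of _ 0 0 c]] by simp

lemma schwartz_diff: "f \<in> schwartz \<Longrightarrow> g \<in> schwartz \<Longrightarrow> (\<lambda>x. f x - g x) \<in> schwartz"
  using schwartz_add[of f "\<lambda>x. (-1) * g x"] schwartz_cmult[of g "-1"] by simp

lemma schwartz_dir_deriv: "f \<in> schwartz \<Longrightarrow> dir_deriv f v \<in> schwartz"
  unfolding schwartz_iff_hered by (metis hered.simps(2))

lemma schwartz_rapid: "f \<in> schwartz \<Longrightarrow> rapid f"
  unfolding schwartz_iff_hered by (metis hered.simps(1))

lemma schwartz_bound: "f \<in> schwartz \<Longrightarrow> \<exists>C. \<forall>x. (1 + norm x) ^ N * cmod (f x) \<le> C"
  by (intro rapid_bound schwartz_rapid)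

lemma schwartz_continuous: "f \<in> schwartz \<Longrightarrow> continuous_on S f"
  by (simp add: schwartz_def smooth_continuous_on)

lemma schwartz_measurable: "f \<in> schwartz \<Longrightarrow> f \<in> borel_measurable borel"
  by (simp add: borel_measurable_continuous_onI schwartz_continuous)

lemma schwartz_zero: "(\<lambda>x. 0) \<in> schwartz"
  unfolding schwartz_iff_hered
  by (auto intro!: hered_coinduct[where S="{\<lambda>x. 0}"] simp: rapid_def diffable_def frechet_derivative_const)

lemma schwartz_sum: "(\<And>i. i \<in> I \<Longrightarrow> f i \<in> schwartz) \<Longrightarrow> (\<lambda>x. \<Sum>i\<in>I. f i x) \<in> schwartz"
  by (induction I rule: infinite_finite_induct) (auto intro: schwartz_zero schwartz_add)

text \<open>Differentiation does not enlarge the closed support, so \<open>test_functions\<close> is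
  closed under directional derivatives, and rapid decay of a member is boundedness of a continuous
  function on a compact set.\<close>

lemma test_functions_subset_schwartz: "test_functions \<subseteq> schwartz"
proof
  fix f :: "'a \<Rightarrow> complex" assume "f \<in> test_functions"
  have "hered rapid n f" for n
  proof (rule hered_coinduct[where S=test_functions])
    fix f :: "'a \<Rightarrow> complex" and v assume f: "f \<in> test_functions"
    then have sm: "smooth f" and K: "compact (closure {x. f x \<noteq> 0})" (is "compact ?K")
      by (auto simp: test_functions_def compactly_supported_def)
    show "rapid f"
      unfolding rapid_def
    proof (intro conjI allI)
      show "diffable f" using sm smooth_differentiable unfolding diffable_def by blast
      fix N
      have "continuous_on ?K (\<lambda>x. (1 + norm x) ^ N * norm (f x))"
        by (intro continuous_intros smooth_continuous_on sm)
      from compact_imp_bounded[OF compact_continuous_image[OF this K]]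
      obtain C where C: "\<And>x. x \<in> ?K \<Longrightarrow> (1 + norm x) ^ N * norm (f x) \<le> C"
        unfolding bounded_iff by force
      have "(1 + norm x) ^ N * norm (f x) \<le> max C 0" for x
      proof (cases "f x = 0")
        case False
        then have "x \<in> ?K" by (auto intro: subsetD[OF closure_subset])
        with C[OF this] show ?thesis by simp
      qed simp
      then show "\<exists>C. \<forall>x. (1 + norm x) ^ N * norm (f x) \<le> C" by blast
    qed
    have "frechet_derivative f (at x) v = 0" if "x \<notin> ?K" for x
    proof -
      have "(f has_derivative (\<lambda>_. 0)) (at x)"
        by (rule has_derivative_transform_within_open[of "\<lambda>_. 0" _ _ _ "- ?K"])
          (use that in \<open>auto intro: closure_subset[THEN subsetD]\<close>)
      then show ?thesis by (simp add: frechet_derivative_at[symmetric])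
    qed
    then have "closure {x. dir_deriv f v x \<noteq> 0} \<subseteq> ?K"
      by (intro closure_minimal) auto
    then have "compact (closure {x. dir_deriv f v x \<noteq> 0})"
      using K compact_Int_closed[OF K closed_closure] by (metis inf.absorb_iff2)
    moreover have "smooth (dir_deriv f v)"
      using sm unfolding smooth_iff_hered by (metis hered.simps(2))
    ultimately show "dir_deriv f v \<in> test_functions"
      by (simp add: test_functions_def compactly_supported_def)
  qed fact
  then show "f \<in> schwartz" by (simp add: schwartz_iff_hered)
qed

text \<open>From 1 + y \<le> exp y the left side is at most exp (N y - \<tau> y^2), and completing
  the square gives the constant.\<close>

lemma gaussian_rapid_real:
  fixes \<tau> y :: real
  assumes "\<tau> > 0" "y \<ge> 0"
  shows "(1 + y) ^ N * exp (- \<tau> * y\<^sup>2) \<le> exp ((real N)\<^sup>2 / (4 * \<tau>))"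
proof -
  have "(1 + y) ^ N \<le> exp y ^ N"
    using assms by (intro power_mono exp_ge_add_one_self) auto
  then have "(1 + y) ^ N * exp (- \<tau> * y\<^sup>2) \<le> exp y ^ N * exp (- \<tau> * y\<^sup>2)"
    by (rule mult_right_mono) simp
  also have "\<dots> = exp (N * y - \<tau> * y\<^sup>2)"
    by (simp add: exp_of_nat_mult[symmetric] exp_add[symmetric] mult.commute)
  also have "N * y - \<tau> * y\<^sup>2 \<le> (real N)\<^sup>2 / (4 * \<tau>)"
  proof -
    have "0 \<le> (2 * \<tau> * y - N)\<^sup>2" by simp
    then have "(N * y - \<tau> * y\<^sup>2) * (4 * \<tau>) \<le> (real N)\<^sup>2"
      by (simp add: power2_eq_square algebra_simps)
    then show ?thesis using assms by (simp add: pos_le_divide_eq)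
  qed
  finally show ?thesis by simp
qed

lemma has_derivative_gaussian:
  "((\<lambda>x::'a::real_inner. complex_of_real (exp (- \<tau> * (norm x)\<^sup>2))) has_derivative
    (\<lambda>w. (complex_of_real (- 2 * \<tau>) * complex_of_real (x \<bullet> w) + 0) * complex_of_real (exp (- \<tau> * (norm x)\<^sup>2)))) (at x)"
proof -
  have "((\<lambda>x::'a. - \<tau> * (x \<bullet> x)) has_derivative (\<lambda>w. - \<tau> * (x \<bullet> w + w \<bullet> x))) (at x)"
    by (rule has_derivative_mult_right has_derivative_inner has_derivative_ident)+
  from has_derivative_compose[OF this DERIV_exp[unfolded has_field_derivative_def]]
  have "((\<lambda>x::'a. exp (- \<tau> * (x \<bullet> x))) has_derivative
      (\<lambda>w. exp (- \<tau> * (x \<bullet> x)) * (- \<tau> * (x \<bullet> w + w \<bullet> x)))) (at x)" .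
  from bounded_linear.has_derivative[OF bounded_linear_of_real[where 'a=complex] this]
  show ?thesis
    unfolding power2_norm_eq_inner by (simp add: inner_commute mult_ac)
qed

text \<open>A directional derivative of the Gaussian is an affine function times the same Gaussian,
  so order n + 1 follows from order n for the function itself.\<close>

lemma gaussian_schwartz:
  assumes "\<tau> > 0"
  shows "(\<lambda>x::'a::euclidean_space. complex_of_real (exp (- \<tau> * (norm x)\<^sup>2))) \<in> schwartz"
proof -
  let ?G = "\<lambda>x::'a. complex_of_real (exp (- \<tau> * (norm x)\<^sup>2))"
  have r: "rapid ?G"
    unfolding rapid_def
  proof (intro conjI allI exI)
    show "diffable ?G"
      unfolding diffable_def differentiable_def using has_derivative_gaussian by blast
    show "(1 + norm x) ^ N * norm (?G x) \<le> exp ((real N)\<^sup>2 / (4 * \<tau>))" for N and x :: 'a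
      using gaussian_rapid_real[OF assms norm_ge_zero, of x N] by (simp del: of_real_exp)
  qed
  have "hered rapid n ?G" for n
  proof (induction n)
    case (Suc n)
    have "hered rapid n (dir_deriv ?G v)" for v
      unfolding dir_deriv_eqI[OF has_derivative_gaussian]
      by (intro hered_rapid_tempered_mult Suc hered_tempered_affine)
    then show ?case using r by simp
  qed (use r in simp)
  then show ?thesis by (simp add: schwartz_iff_hered)
qed

subsection \<open>Integrals of products\<close>

text \<open>\<open>lborel\<close> is the image of a product measure under the basis expansion, so
  one-dimensional integrals multiply. Needed for the decay majorant and for Gaussians.\<close>

lemma
  fixes f :: "'a::euclidean_space \<Rightarrow> real \<Rightarrow> 'c::{real_normed_field,banach,second_countable_topology}"
  assumes "\<And>b. b \<in> Basis \<Longrightarrow> integrable lborel (f b)"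
  shows integrable_lborel_prod_Basis: "integrable lborel (\<lambda>x. \<Prod>b\<in>Basis. f b (x \<bullet> b))"
    and integral_lborel_prod_Basis:
      "(\<integral>x. (\<Prod>b\<in>Basis. f b (x \<bullet> b)) \<partial>lborel) = (\<Prod>b\<in>Basis. \<integral>x. f b x \<partial>lborel)"
proof -
  interpret product_sigma_finite "\<lambda>_::'a. lborel :: real measure" ..
  have [measurable]: "f b \<in> borel_measurable borel" if "b \<in> Basis" for b
    using borel_measurable_integrable[OF assms[OF that]] by simp
  have m: "(\<lambda>f. \<Sum>b\<in>Basis. f b *\<^sub>R b) \<in> measurable (\<Pi>\<^sub>M b\<in>Basis. lborel) (borel :: 'a measure)"
    by measurable
  have m2: "(\<lambda>x. \<Prod>b\<in>Basis. f b (x \<bullet> b)) \<in> borel_measurable borel"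
    by measurable
  have eq: "(\<Prod>b\<in>Basis. f b ((\<Sum>b\<in>Basis. x b *\<^sub>R b) \<bullet> b)) = (\<Prod>b\<in>Basis. f b (x b))" for x
    by (intro prod.cong refl) (simp add: inner_sum_left_Basis)
  show "integrable lborel (\<lambda>x. \<Prod>b\<in>Basis. f b (x \<bullet> b))"
    by (subst lborel_eq, subst integrable_distr_eq[OF m m2], unfold eq)
      (intro product_integrable_prod assms, auto)
  show "(\<integral>x. (\<Prod>b\<in>Basis. f b (x \<bullet> b)) \<partial>lborel) = (\<Prod>b\<in>Basis. \<integral>x. f b x \<partial>lborel)"
    by (subst lborel_eq, subst integral_distr[OF m m2], unfold eq)
      (intro product_integral_prod assms, auto)
qed

text \<open>One factor (1 + |x|)^2 is spent on each coordinate, which compares the function with a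
  product of the one-dimensional functions 1/(1 + t^2); hence the exponent
  \<open>2 * DIM('a)\<close>.\<close>

lemma integrable_decay: "integrable lborel (\<lambda>x::'a::euclidean_space. 1 / (1 + norm x) ^ (2 * DIM('a)))"
proof (rule Bochner_Integration.integrable_bound)
  have "integrable lborel (\<lambda>x::real. inverse (1 + x\<^sup>2))"
    using integrable_inverse_1_plus_square by (simp add: set_integrable_def)
  then show "integrable lborel (\<lambda>x::'a. \<Prod>b\<in>Basis. inverse (1 + (x \<bullet> b)\<^sup>2))"
    by (rule integrable_lborel_prod_Basis)
  have "1 / (1 + norm x) ^ (2 * DIM('a)) \<le> (\<Prod>b\<in>Basis. inverse (1 + (x \<bullet> b)\<^sup>2))" for x :: 'a
  proof -
    have "(\<Prod>b\<in>(Basis::'a set). inverse ((1 + norm x)\<^sup>2)) \<le> (\<Prod>b\<in>Basis. inverse (1 + (x \<bullet> b)\<^sup>2))"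
    proof (intro prod_mono conjI le_imp_inverse_le)
      fix b :: 'a assume "b \<in> Basis"
      then have "\<bar>x \<bullet> b\<bar>\<^sup>2 \<le> (norm x)\<^sup>2" by (intro power_mono Basis_le_norm) auto
      then show "1 + (x \<bullet> b)\<^sup>2 \<le> (1 + norm x)\<^sup>2" by (simp add: power2_sum add_increasing2)
    qed (auto intro: add_pos_nonneg)
    then show ?thesis by (simp add: power_mult divide_inverse power_inverse)
  qed
  then show "AE x::'a in lborel. norm (1 / (1 + norm x) ^ (2 * DIM('a))) \<le> norm (\<Prod>b\<in>Basis. inverse (1 + (x \<bullet> b)\<^sup>2))"
    by (intro AE_I2) (smt (verit) abs_ge_self divide_nonneg_nonneg norm_ge_zero real_norm_def zero_le_power)
qed measurable

lemma schwartz_integrable: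
  fixes f :: "'a::euclidean_space \<Rightarrow> complex"
  assumes "f \<in> schwartz"
  shows "integrable lborel f"
proof -
  obtain C where C: "\<And>x. (1 + norm x) ^ (2 * DIM('a)) * cmod (f x) \<le> C"
    using schwartz_bound[OF assms] by blast
  show ?thesis
  proof (rule Bochner_Integration.integrable_bound)
    show "integrable lborel (\<lambda>x::'a. C * (1 / (1 + norm x) ^ (2 * DIM('a))))"
      by (rule integrable_mult_right[OF integrable_decay])
    have "cmod (f x) \<le> C * (1 / (1 + norm x) ^ (2 * DIM('a)))" for x
      using C[of x] by (simp add: pos_le_divide_eq add_pos_nonneg mult.commute)
    then show "AE x in lborel. norm (f x) \<le> norm (C * (1 / (1 + norm x) ^ (2 * DIM('a))))"
      by (intro AE_I2) (smt (verit) real_norm_def)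
  qed (use schwartz_measurable[OF assms] in simp)
qed

lemma schwartz_moment_integrable:
  fixes f :: "'a::euclidean_space \<Rightarrow> complex"
  assumes "f \<in> schwartz"
  shows "integrable lborel (\<lambda>x. norm x ^ N * cmod (f x))"
proof -
  obtain C where C: "\<And>x. (1 + norm x) ^ (N + 2 * DIM('a)) * cmod (f x) \<le> C"
    using schwartz_bound[OF assms] by blast
  show ?thesis
  proof (rule Bochner_Integration.integrable_bound)
    show "integrable lborel (\<lambda>x::'a. C * (1 / (1 + norm x) ^ (2 * DIM('a))))"
      by (rule integrable_mult_right[OF integrable_decay])
    have "norm x ^ N * cmod (f x) \<le> C * (1 / (1 + norm x) ^ (2 * DIM('a)))" for x
    proof -
      have "norm x ^ N * cmod (f x) \<le> (1 + norm x) ^ N * cmod (f x)"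
        by (intro mult_right_mono power_mono) auto
      also have "\<dots> \<le> C * (1 / (1 + norm x) ^ (2 * DIM('a)))"
        using C[of x] by (simp add: pos_le_divide_eq add_pos_nonneg power_add mult_ac)
      finally show ?thesis .
    qed
    then show "AE x in lborel. norm (norm x ^ N * cmod (f x)) \<le> norm (C * (1 / (1 + norm x) ^ (2 * DIM('a))))"
      by (intro AE_I2) (smt (verit) mult_nonneg_nonneg norm_ge_zero real_norm_def zero_le_power)
  qed (use schwartz_measurable[OF assms] in measurable)
qed

subsection \<open>The Fourier transform on the Schwartz space\<close>

lemma borel_measurable_cis [measurable]: "cis \<in> borel_measurable borel"
  by (intro borel_measurable_continuous_onI continuous_intros)

lemma fourier_integrand_integrable:
  assumes "integrable lborel f"
  shows "integrable lborel (\<lambda>x. cis (- (2 * pi * (x \<bullet> \<xi>))) * f x)"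
proof (rule Bochner_Integration.integrable_bound[OF assms])
  have [measurable]: "f \<in> borel_measurable borel"
    using borel_measurable_integrable[OF assms] by simp
  show "(\<lambda>x. cis (- (2 * pi * (x \<bullet> \<xi>))) * f x) \<in> borel_measurable lborel"
    by measurable
qed (simp add: norm_mult)

lemma fourier_bound: "integrable lborel f \<Longrightarrow> cmod (fourier f \<xi>) \<le> (\<integral>x. cmod (f x) \<partial>lborel)"
  unfolding fourier_def
  by (rule order_trans[OF integral_norm_bound]) (simp add: norm_mult)

lemma fourier_add:
  "integrable lborel f \<Longrightarrow> integrable lborel g \<Longrightarrow> fourier (\<lambda>x. f x + g x) \<xi> = fourier f \<xi> + fourier g \<xi>"
  unfolding fourier_def
  by (simp add: distrib_left fourier_integrand_integrable)

lemma fourier_diff: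
  "integrable lborel f \<Longrightarrow> integrable lborel g \<Longrightarrow> fourier (\<lambda>x. f x - g x) \<xi> = fourier f \<xi> - fourier g \<xi>"
  unfolding fourier_def
  by (simp add: right_diff_distrib fourier_integrand_integrable)

lemma fourier_cmult: "fourier (\<lambda>x. c * f x) \<xi> = c * fourier f \<xi>"
proof -
  have "(\<integral>x. cis (- (2 * pi * (x \<bullet> \<xi>))) * (c * f x) \<partial>lborel)
      = (\<integral>x. c * (cis (- (2 * pi * (x \<bullet> \<xi>))) * f x) \<partial>lborel)"
    by (intro Bochner_Integration.integral_cong) (auto simp: mult_ac)
  then show ?thesis unfolding fourier_def by simp
qed

lemma fourier_sum:
  "(\<And>i. i \<in> I \<Longrightarrow> integrable lborel (f i)) \<Longrightarrow> fourier (\<lambda>x. \<Sum>i\<in>I. f i x) \<xi> = (\<Sum>i\<in>I. fourier (f i) \<xi>)"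
  unfolding fourier_def
  by (simp add: sum_distrib_left fourier_integrand_integrable)

lemma schwartz_moment_schwartz:
  assumes "f \<in> schwartz"
  shows "(\<lambda>x. (c * complex_of_real (x \<bullet> v)) * f x) \<in> schwartz"
  using schwartz_tempered_mult[OF hered_tempered_affine[of _ c v 0] assms] by simp

text \<open>Differentiation under the integral with an explicit error: the second-order remainder of
  the character is at most u^2 / 2, so the error is |y - \<xi>|^2 times a second moment of
  f.\<close>

lemma has_derivative_fourier:
  fixes f :: "'a::euclidean_space \<Rightarrow> complex"
  assumes f: "f \<in> schwartz"
  shows "(fourier f has_derivative (\<lambda>w. fourier (\<lambda>x. (- (2 * pi * \<i>) * complex_of_real (x \<bullet> w)) * f x) \<xi>)) (at \<xi>)"
    (is "(_ has_derivative ?L) _")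
proof (rule has_derivativeI_sandwich)
  have int1: "integrable lborel (\<lambda>x. (- (2 * pi * \<i>) * complex_of_real (x \<bullet> w)) * f x)" for w
    by (intro schwartz_integrable schwartz_moment_schwartz f)
  show "bounded_linear ?L"
  proof (rule bounded_linear_intro)
    show "?L (v + w) = ?L v + ?L w" for v w
      by (subst fourier_add[symmetric, OF int1 int1]) (simp add: inner_add_right algebra_simps)
    show "?L (r *\<^sub>R v) = r *\<^sub>R ?L v" for r v
      unfolding scaleR_conv_of_real
      by (subst fourier_cmult[symmetric]) (simp add: mult_ac)
    show "norm (?L w) \<le> norm w * (\<integral>x. 2 * pi * (norm x ^ 1 * cmod (f x)) \<partial>lborel)" for w
    proof -
      have "norm (?L w) \<le> (\<integral>x. cmod ((- (2 * pi * \<i>) * complex_of_real (x \<bullet> w)) * f x) \<partial>lborel)"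
        by (rule fourier_bound[OF int1])
      also have "\<dots> \<le> (\<integral>x. norm w * (2 * pi * (norm x ^ 1 * cmod (f x))) \<partial>lborel)"
      proof (rule integral_mono)
        show "integrable lborel (\<lambda>x. norm w * (2 * pi * (norm x ^ 1 * cmod (f x))))"
          by (intro integrable_mult_right schwartz_moment_integrable f)
        show "cmod ((- (2 * pi * \<i>) * complex_of_real (x \<bullet> w)) * f x) \<le> norm w * (2 * pi * (norm x ^ 1 * cmod (f x)))" for x
        proof -
          have "2 * pi * \<bar>x \<bullet> w\<bar> * cmod (f x) \<le> 2 * pi * (norm x * norm w) * cmod (f x)"
            by (intro mult_right_mono mult_left_mono Cauchy_Schwarz_ineq2) auto
          then show ?thesis by (simp add: norm_mult mult_ac)
        qed
      qed (intro integrable_norm int1)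
      finally show ?thesis by simp
    qed
  qed
  define K where "K = (\<integral>x. 2 * pi\<^sup>2 * (norm x ^ 2 * cmod (f x)) \<partial>lborel)"
  fix y assume "y \<noteq> \<xi>"
  have int: "integrable lborel f" by (rule schwartz_integrable[OF f])
  define R where "R x = cis (- (2 * pi * (x \<bullet> y))) * f x - cis (- (2 * pi * (x \<bullet> \<xi>))) * f x
        - cis (- (2 * pi * (x \<bullet> \<xi>))) * ((- (2 * pi * \<i>) * complex_of_real (x \<bullet> (y - \<xi>))) * f x)" for x
  have intR: "integrable lborel R"
    unfolding R_def by (intro Bochner_Integration.integrable_diff fourier_integrand_integrable int int1)
  have R: "cmod (R x) \<le> (norm (y - \<xi>))\<^sup>2 * (2 * pi\<^sup>2 * (norm x ^ 2 * cmod (f x)))" for x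
  proof -
    define u where "u = - (2 * pi * (x \<bullet> (y - \<xi>)))"
    have cis: "cis (- (2 * pi * (x \<bullet> y))) = cis (- (2 * pi * (x \<bullet> \<xi>))) * cis u"
      by (simp add: u_def cis_mult inner_diff_right algebra_simps)
    have "cmod (iexp u - (\<Sum>k\<le>1. (\<i> * u)^k / fact k)) \<le> \<bar>u\<bar>^(Suc 1) / fact (Suc 1)"
      by (rule iexp_approx1)
    then have "cmod (cis u - 1 - \<i> * u) \<le> u\<^sup>2 / 2"
      by (simp add: cis_conv_exp power2_eq_square abs_mult[symmetric] diff_diff_eq add.commute)
    also have "u\<^sup>2 = 4 * pi\<^sup>2 * \<bar>x \<bullet> (y - \<xi>)\<bar>\<^sup>2"
      by (simp add: u_def power_mult_distrib)
    also have "\<dots> / 2 \<le> 4 * pi\<^sup>2 * (norm x * norm (y - \<xi>))\<^sup>2 / 2"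
      by (intro divide_right_mono mult_left_mono power_mono Cauchy_Schwarz_ineq2) auto
    finally have le: "cmod (cis u - 1 - \<i> * u) \<le> 2 * pi\<^sup>2 * (norm x * norm (y - \<xi>))\<^sup>2" by simp
    have "R x = cis (- (2 * pi * (x \<bullet> \<xi>))) * (cis u - 1 - \<i> * u) * f x"
      unfolding R_def cis by (simp add: u_def algebra_simps)
    also have "norm \<dots> = cmod (cis u - 1 - \<i> * u) * cmod (f x)"
      by (simp add: norm_mult)
    also have "\<dots> \<le> (2 * pi\<^sup>2 * (norm x * norm (y - \<xi>))\<^sup>2) * cmod (f x)"
      by (intro mult_right_mono le) auto
    finally show ?thesis by (simp add: power_mult_distrib mult_ac)
  qed
  have "fourier f y - fourier f \<xi> - ?L (y - \<xi>) = (\<integral>x. R x \<partial>lborel)"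
    unfolding fourier_def R_def
    by (subst Bochner_Integration.integral_diff,
        (intro Bochner_Integration.integrable_diff fourier_integrand_integrable int int1)+)
      (subst Bochner_Integration.integral_diff, (intro fourier_integrand_integrable int)+, rule refl)
  then have "norm (fourier f y - fourier f \<xi> - ?L (y - \<xi>)) \<le> (\<integral>x. cmod (R x) \<partial>lborel)"
    using integral_norm_bound[of lborel R] by (simp only:)
  also have "\<dots> \<le> (\<integral>x. (norm (y - \<xi>))\<^sup>2 * (2 * pi\<^sup>2 * (norm x ^ 2 * cmod (f x))) \<partial>lborel)"
    by (intro integral_mono integrable_norm intR R integrable_mult_right schwartz_moment_integrable f)
  finally have "norm (fourier f y - fourier f \<xi> - ?L (y - \<xi>)) \<le> (norm (y - \<xi>))\<^sup>2 * K"
    by (simp add: K_def)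
  then show "norm (fourier f y - fourier f \<xi> - ?L (y - \<xi>)) / norm (y - \<xi>) \<le> norm (y - \<xi>) * K"
    using \<open>y \<noteq> \<xi>\<close> by (simp add: pos_divide_le_eq power2_eq_square mult_ac)
next
  show "((\<lambda>y. norm (y - \<xi>) * (\<integral>x. 2 * pi\<^sup>2 * (norm x ^ 2 * cmod (f x)) \<partial>lborel)) \<longlongrightarrow> 0) (at \<xi>)"
    by (auto intro!: tendsto_eq_intros)
qed (rule zero_less_one)

lemma dir_deriv_fourier:
  assumes "f \<in> schwartz"
  shows "dir_deriv (fourier f) v = fourier (\<lambda>x. (- (2 * pi * \<i>) * complex_of_real (x \<bullet> v)) * f x)"
  by (rule dir_deriv_eqI[OF has_derivative_fourier[OF assms]])

text \<open>The integral of each difference quotient is 0 by translation invariance, and dominated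
  convergence passes to the derivative.\<close>

lemma integral_dir_deriv_schwartz:
  fixes f :: "'a::euclidean_space \<Rightarrow> complex"
  assumes f: "f \<in> schwartz"
  shows "(\<integral>x. dir_deriv f v x \<partial>lborel) = 0"
proof -
  define h where "h n = inverse (real (Suc n))" for n
  have h: "0 < h n" "h n \<le> 1" for n by (auto simp: h_def field_simps)
  have h0: "h \<longlonglongrightarrow> 0" unfolding h_def by (rule LIMSEQ_inverse_real_of_nat)
  define q where "q n x = (f (x + h n *\<^sub>R v) - f x) / h n" for n x
  have int: "integrable lborel f" by (rule schwartz_integrable[OF f])
  have [measurable]: "f \<in> borel_measurable borel" by (rule schwartz_measurable[OF f])
  have [measurable]: "dir_deriv f v \<in> borel_measurable borel"
    by (intro schwartz_measurable schwartz_dir_deriv f)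
  have trans: "integrable lborel (\<lambda>x. f (x + c))" "(\<integral>x. f (x + c) \<partial>lborel) = (\<integral>x. f x \<partial>lborel)" for c
  proof -
    have eq: "(\<lambda>x. f (x + c)) = (\<lambda>x. f (c + x))" by (simp add: add.commute)
    show "integrable lborel (\<lambda>x. f (x + c))" unfolding eq
      using int by (subst integrable_distr_eq[symmetric, of "(+) c" lborel borel f]) (simp_all add: lborel_distr_plus)
    show "(\<integral>x. f (x + c) \<partial>lborel) = (\<integral>x. f x \<partial>lborel)" unfolding eq
      by (subst integral_distr[symmetric, of "(+) c" lborel borel f]) (simp_all add: lborel_distr_plus)
  qed
  have q0: "(\<integral>x. q n x \<partial>lborel) = 0" for n
    unfolding q_def using trans int by simp
  obtain C where C: "\<And>x. (1 + norm x) ^ (2 * DIM('a)) * cmod (dir_deriv f v x) \<le> C"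
    using schwartz_bound[OF schwartz_dir_deriv[OF f]] by blast
  \<comment> \<open>\<open>D\<close> absorbs the shift along the segment: as \<open>h n\<close> is
    at most 1, the weight 1 + |x| is at most (1 + |x + t v|) (1 + |v|).\<close>
  define D where "D = (1 + norm v) ^ (2 * DIM('a)) * C"
  have der: "((\<lambda>t. f (x + t *\<^sub>R v)) has_vector_derivative dir_deriv f v (x + t *\<^sub>R v)) (at t within S)" for x t S
  proof -
    have 1: "((\<lambda>t. x + t *\<^sub>R v) has_derivative (\<lambda>t. t *\<^sub>R v)) (at t within S)"
      by (auto intro!: derivative_eq_intros)
    have "(f has_derivative frechet_derivative f (at (x + t *\<^sub>R v))) (at (x + t *\<^sub>R v))"
      by (intro diffable_has_derivative rapid_diffable schwartz_rapid f)
    from has_derivative_compose[OF 1 this] linear_scale[OF linear_frechet_derivative[OF differentiableI[OF this]]]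
    show ?thesis
      unfolding has_vector_derivative_def by simp
  qed
  have bound: "cmod (q n x) \<le> D * (1 / (1 + norm x) ^ (2 * DIM('a)))" for n x
  proof -
    define B where "B = D * (1 / (1 + norm x) ^ (2 * DIM('a)))"
    have B: "cmod (dir_deriv f v (x + t *\<^sub>R v)) \<le> B" if "t \<in> {0..h n}" for t
    proof -
      let ?y = "x + t *\<^sub>R v"
      have "norm x \<le> norm ?y + norm (t *\<^sub>R v)" by (metis add_diff_cancel_right' norm_triangle_ineq4)
      also have "norm (t *\<^sub>R v) \<le> 1 * norm v" using that h(2)[of n] by (auto intro!: mult_left_le_one_le)
      finally have "1 + norm x \<le> (1 + norm ?y) * (1 + norm v)"
        using mult_nonneg_nonneg[OF norm_ge_zero norm_ge_zero, of ?y v] unfolding distrib_left distrib_right by linarith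
      then have "(1 + norm x) ^ (2 * DIM('a)) \<le> ((1 + norm ?y) * (1 + norm v)) ^ (2 * DIM('a))"
        by (intro power_mono) auto
      then have "(1 + norm x) ^ (2 * DIM('a)) * cmod (dir_deriv f v ?y)
          \<le> ((1 + norm ?y) * (1 + norm v)) ^ (2 * DIM('a)) * cmod (dir_deriv f v ?y)"
        by (rule mult_right_mono) simp
      also have "\<dots> = (1 + norm v) ^ (2 * DIM('a)) * ((1 + norm ?y) ^ (2 * DIM('a)) * cmod (dir_deriv f v ?y))"
        by (simp add: power_mult_distrib)
      also have "\<dots> \<le> D" unfolding D_def by (intro mult_left_mono C) auto
      finally show ?thesis
        by (simp add: B_def pos_le_divide_eq add_pos_nonneg mult.commute)
    qed
    have "norm (f (x + h n *\<^sub>R v) - f (x + 0 *\<^sub>R v)) \<le> B * norm (h n - 0)"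
    proof (rule differentiable_bound[where S="{0..h n}"])
      show "((\<lambda>t. f (x + t *\<^sub>R v)) has_derivative (\<lambda>s. s *\<^sub>R dir_deriv f v (x + t *\<^sub>R v))) (at t within {0..h n})" for t
        using der unfolding has_vector_derivative_def by blast
      show "onorm (\<lambda>s. s *\<^sub>R dir_deriv f v (x + t *\<^sub>R v)) \<le> B" if "t \<in> {0..h n}" for t
        using B[OF that] by (intro onorm_le) (simp add: mult.commute[of B] mult_left_mono)
    qed (use h(1)[of n] in auto)
    then show ?thesis
      unfolding q_def B_def[symmetric] using h(1)[of n] by (simp add: norm_divide pos_divide_le_eq)
  qed
  have lim: "(\<lambda>n. q n x) \<longlonglongrightarrow> dir_deriv f v x" for x
  proof -
    have "((\<lambda>t. norm (f (x + t *\<^sub>R v) - f x - t *\<^sub>R dir_deriv f v x) / norm t) \<longlongrightarrow> 0) (at 0)"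
      using der[of x 0 UNIV] by (simp add: has_vector_derivative_def has_derivative_at)
    moreover have "filterlim h (at 0) sequentially"
      unfolding filterlim_at using h0 h(1) by (auto simp: less_imp_neq[symmetric])
    ultimately have "(\<lambda>n. norm (f (x + h n *\<^sub>R v) - f x - h n *\<^sub>R dir_deriv f v x) / norm (h n)) \<longlonglongrightarrow> 0"
      by (rule filterlim_compose)
    moreover have "norm (f (x + h n *\<^sub>R v) - f x - h n *\<^sub>R dir_deriv f v x) / norm (h n) = norm (q n x - dir_deriv f v x)" for n
    proof -
      have "q n x - dir_deriv f v x = (f (x + h n *\<^sub>R v) - f x - h n *\<^sub>R dir_deriv f v x) / h n"
        using h(1)[of n] by (simp add: q_def diff_divide_distrib scaleR_conv_of_real)
      then show ?thesis by (simp add: norm_divide)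
    qed
    ultimately have "(\<lambda>n. norm (q n x - dir_deriv f v x)) \<longlonglongrightarrow> 0" by simp
    then show ?thesis by (metis LIM_zero_cancel tendsto_norm_zero_cancel)
  qed
  have "(\<lambda>n. \<integral>x. q n x \<partial>lborel) \<longlonglongrightarrow> (\<integral>x. dir_deriv f v x \<partial>lborel)"
  proof (rule integral_dominated_convergence)
    show "integrable lborel (\<lambda>x::'a. D * (1 / (1 + norm x) ^ (2 * DIM('a))))"
      by (rule integrable_mult_right[OF integrable_decay])
    show "q n \<in> borel_measurable lborel" for n unfolding q_def by measurable
  qed (use lim bound in auto)
  then show ?thesis by (simp add: q0 LIMSEQ_const_iff)
qed

text \<open>Integration by parts: the derivative of the character times f has integral 0, and the
  product rule splits it into the two sides.\<close>

lemma fourier_dir_deriv: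
  fixes f :: "'a::euclidean_space \<Rightarrow> complex"
  assumes f: "f \<in> schwartz"
  shows "fourier (dir_deriv f v) \<xi> = 2 * pi * \<i> * (\<xi> \<bullet> v) * fourier f \<xi>"
proof -
  define ch where "ch = (\<lambda>x. cis (- (2 * pi * (x \<bullet> \<xi>))))"
  have ch: "ch = (\<lambda>x. 1 * cis (x \<bullet> (- (2 * pi) *\<^sub>R \<xi>)))" by (simp add: ch_def)
  have "(\<lambda>x. ch x * f x) \<in> schwartz"
    unfolding ch by (rule schwartz_tempered_mult[OF hered_tempered_character f])
  then have "(\<integral>x. dir_deriv (\<lambda>x. ch x * f x) v x \<partial>lborel) = 0"
    by (rule integral_dir_deriv_schwartz)
  also have "dir_deriv (\<lambda>x. ch x * f x) v
      = (\<lambda>x. ch x * dir_deriv f v x - 2 * pi * \<i> * (\<xi> \<bullet> v) * (ch x * f x))"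
  proof -
    have dch: "(ch has_derivative (\<lambda>w. (1 * \<i> * (w \<bullet> (- (2 * pi) *\<^sub>R \<xi>))) * cis (x \<bullet> (- (2 * pi) *\<^sub>R \<xi>)))) (at x)" for x
      unfolding ch by (rule has_derivative_character)
    have "((\<lambda>x. ch x * f x) has_derivative (\<lambda>w. ch x * frechet_derivative f (at x) w
        + (1 * \<i> * (w \<bullet> (- (2 * pi) *\<^sub>R \<xi>))) * cis (x \<bullet> (- (2 * pi) *\<^sub>R \<xi>)) * f x)) (at x)" for x
      by (rule has_derivative_mult[OF dch diffable_has_derivative[OF rapid_diffable[OF schwartz_rapid[OF f]]]])
    then show ?thesis
      by (subst dir_deriv_eqI) (auto simp: ch_def inner_commute algebra_simps)
  qed
  also have "(\<integral>x. ch x * dir_deriv f v x - 2 * pi * \<i> * (\<xi> \<bullet> v) * (ch x * f x) \<partial>lborel)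
      = fourier (dir_deriv f v) \<xi> - 2 * pi * \<i> * (\<xi> \<bullet> v) * fourier f \<xi>"
    unfolding fourier_def ch_def
    using fourier_integrand_integrable[OF schwartz_integrable[OF f], of \<xi>]
      fourier_integrand_integrable[OF schwartz_integrable[OF schwartz_dir_deriv[OF f, of v]], of \<xi>]
    by (subst Bochner_Integration.integral_diff) simp_all
  finally show ?thesis by simp
qed

text \<open>Decay is an induction on the power, over all Schwartz functions: a further factor 1 +
  |\<xi>| is dominated through the coordinates of \<xi>, and multiplication by a coordinate
  corresponds to a derivative of f. Derivatives of the transform are transforms of Schwartz
  functions again, so decay of all transforms suffices.\<close>

lemma fourier_schwartz:
  fixes f :: "'a::euclidean_space \<Rightarrow> complex"
  assumes "f \<in> schwartz"
  shows "fourier f \<in> schwartz"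
proof -
  have decay: "\<exists>C. \<forall>\<xi>. (1 + norm \<xi>) ^ N * cmod (fourier f \<xi>) \<le> C" if "f \<in> schwartz" for N and f :: "'a \<Rightarrow> complex"
    using that
  proof (induction N arbitrary: f)
    case 0
    then show ?case using fourier_bound[OF schwartz_integrable] by auto
  next
    case (Suc N)
    obtain C0 where C0: "\<And>\<xi>. (1 + norm \<xi>) ^ N * cmod (fourier f \<xi>) \<le> C0"
      using Suc by blast
    have "\<exists>C. \<forall>\<xi>. (1 + norm \<xi>) ^ N * cmod (fourier (dir_deriv f b) \<xi>) \<le> C" for b
      by (intro Suc.IH schwartz_dir_deriv Suc.prems)
    then obtain C where C: "\<And>b \<xi>. (1 + norm \<xi>) ^ N * cmod (fourier (dir_deriv f b) \<xi>) \<le> C b"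
      by metis
    have "(1 + norm \<xi>) ^ Suc N * cmod (fourier f \<xi>) \<le> C0 + (\<Sum>b\<in>Basis. C b)" for \<xi>
    proof -
      let ?A = "(1 + norm \<xi>) ^ N"
      have each: "?A * (\<bar>\<xi> \<bullet> b\<bar> * cmod (fourier f \<xi>)) \<le> C b" for b
      proof -
        have "1 * (\<bar>\<xi> \<bullet> b\<bar> * cmod (fourier f \<xi>)) \<le> (2 * pi) * (\<bar>\<xi> \<bullet> b\<bar> * cmod (fourier f \<xi>))"
          using pi_ge_two by (intro mult_right_mono) auto
        then have "?A * (\<bar>\<xi> \<bullet> b\<bar> * cmod (fourier f \<xi>)) \<le> ?A * cmod (fourier (dir_deriv f b) \<xi>)"
          unfolding fourier_dir_deriv[OF Suc.prems]
          by (intro mult_left_mono) (auto simp: norm_mult mult_ac)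
        also have "\<dots> \<le> C b" by (rule C)
        finally show ?thesis .
      qed
      have "(1 + norm \<xi>) ^ Suc N * cmod (fourier f \<xi>)
          = ?A * cmod (fourier f \<xi>) + norm \<xi> * (?A * cmod (fourier f \<xi>))"
        by (simp add: algebra_simps)
      also have "\<dots> \<le> ?A * cmod (fourier f \<xi>) + (\<Sum>b\<in>Basis. \<bar>\<xi> \<bullet> b\<bar>) * (?A * cmod (fourier f \<xi>))"
        by (intro add_left_mono mult_right_mono norm_le_l1) auto
      also have "\<dots> = ?A * cmod (fourier f \<xi>) + (\<Sum>b\<in>Basis. ?A * (\<bar>\<xi> \<bullet> b\<bar> * cmod (fourier f \<xi>)))"
        by (subst sum_distrib_right) (simp add: mult_ac)
      also have "\<dots> \<le> C0 + (\<Sum>b\<in>Basis. C b)"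
        by (intro add_mono sum_mono C0 each)
      finally show ?thesis .
    qed
    then show ?case by blast
  qed
  have "hered rapid n (fourier f)" for n
  proof (rule hered_coinduct[where S="fourier ` (schwartz :: ('a \<Rightarrow> complex) set)"])
    fix g :: "'a \<Rightarrow> complex" and v assume "g \<in> fourier ` schwartz"
    then obtain h where h: "h \<in> schwartz" "g = fourier h" by blast
    show "rapid g"
      unfolding rapid_def diffable_def differentiable_def h(2)
      using decay[OF h(1)] has_derivative_fourier[OF h(1)] by blast
    show "dir_deriv g v \<in> fourier ` schwartz"
      unfolding h(2) dir_deriv_fourier[OF h(1)] by (intro imageI schwartz_moment_schwartz h)
  qed (use assms in blast)
  then show ?thesis by (simp add: schwartz_iff_hered)
qed

section \<open>Multiplication formula, Gaussian transforms, modulation and scaling\<close>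

lemma fourier_multiplication:
  fixes f g :: "'a::euclidean_space \<Rightarrow> complex"
  assumes f: "integrable lborel f" and g: "integrable lborel g"
  shows "(\<integral>x. fourier f x * g x \<partial>lborel) = (\<integral>x. f x * fourier g x \<partial>lborel)"
proof -
  have [measurable]: "f \<in> borel_measurable borel" "g \<in> borel_measurable borel"
    using borel_measurable_integrable[OF f] borel_measurable_integrable[OF g] by simp_all
  have "integrable (lborel \<Otimes>\<^sub>M lborel) (\<lambda>(x, y). cis (- (2 * pi * (x \<bullet> y))) * f x * g y)"
  proof (rule lborel_pair.Fubini_integrable)
    show "(\<lambda>(x, y). cis (- (2 * pi * (x \<bullet> y))) * f x * g y) \<in> borel_measurable (lborel \<Otimes>\<^sub>M lborel)"
      by measurable
    show "integrable lborel (\<lambda>x. \<integral>y. norm (case (x, y) of (x, y) \<Rightarrow> cis (- (2 * pi * (x \<bullet> y))) * f x * g y) \<partial>lborel)"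
      using f by (simp add: norm_mult)
    have "integrable lborel (\<lambda>y. cis (- (2 * pi * (x \<bullet> y))) * f x * g y)" for x
      using integrable_mult_right[OF fourier_integrand_integrable[OF g, of x], of "f x"]
      by (simp add: mult_ac inner_commute)
    then show "AE x in lborel. integrable lborel (\<lambda>y. case (x, y) of (x, y) \<Rightarrow> cis (- (2 * pi * (x \<bullet> y))) * f x * g y)"
      by simp
  qed
  from lborel_pair.Fubini_integral[OF this]
  have "(\<integral>y. \<integral>x. cis (- (2 * pi * (x \<bullet> y))) * f x * g y \<partial>lborel \<partial>lborel)
      = (\<integral>x. \<integral>y. cis (- (2 * pi * (x \<bullet> y))) * f x * g y \<partial>lborel \<partial>lborel)" .
  moreover have "(\<integral>x. cis (- (2 * pi * (x \<bullet> y))) * f x * g y \<partial>lborel) = fourier f y * g y" for y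
    unfolding fourier_def by simp
  moreover have "(\<integral>y. cis (- (2 * pi * (x \<bullet> y))) * f x * g y \<partial>lborel) = f x * fourier g x" for x
  proof -
    have "(\<integral>y. cis (- (2 * pi * (x \<bullet> y))) * f x * g y \<partial>lborel)
        = (\<integral>y. f x * (cis (- (2 * pi * (y \<bullet> x))) * g y) \<partial>lborel)"
      by (intro Bochner_Integration.integral_cong) (auto simp: inner_commute mult_ac)
    then show ?thesis unfolding fourier_def by simp
  qed
  ultimately show ?thesis by (simp only:)
qed

lemma fourier_gaussian_1d:
  fixes x \<tau> :: real
  assumes "\<tau> > 0"
  shows "integrable lborel (\<lambda>\<xi>. cis (- (2 * pi * (\<xi> * x))) * complex_of_real (exp (- \<tau> * \<xi>\<^sup>2)))" (is ?th1)
    and "(\<integral>\<xi>. cis (- (2 * pi * (\<xi> * x))) * complex_of_real (exp (- \<tau> * \<xi>\<^sup>2)) \<partial>lborel)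
      = complex_of_real (sqrt (pi / \<tau>) * exp (- (pi\<^sup>2 * x\<^sup>2 / \<tau>)))" (is ?th2)
proof -
  have "integrable lborel (\<lambda>\<xi>::real. complex_of_real (exp (- \<tau> * (norm \<xi>)\<^sup>2)))"
    by (intro schwartz_integrable gaussian_schwartz assms)
  from fourier_integrand_integrable[OF this, of x] show ?th1 by simp
  \<comment> \<open>Chosen so that the substitution y = sqrt (2 \<tau>) \<xi> turns the
    characteristic function of the standard normal law at \<open>t\<close> into the transform at
    \<open>x\<close>.\<close>
  define t where "t = - (2 * pi * x) / sqrt (2 * \<tau>)"
  have ts: "t * sqrt (2 * \<tau>) = - (2 * pi * x)" using assms by (simp add: t_def)
  have "complex_of_real (exp (- (t^2) / 2)) = (\<integral>y. iexp (t * y) \<partial>std_normal_distribution)"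
    using fun_cong[OF char_std_normal_distribution, of t] by (simp add: char_def)
  also have "\<dots> = (\<integral>y. std_normal_density y *\<^sub>R iexp (t * y) \<partial>lborel)"
    by (subst integral_density) auto
  also have "\<dots> = \<bar>sqrt (2 * \<tau>)\<bar> *\<^sub>R (\<integral>\<xi>. std_normal_density (0 + sqrt (2 * \<tau>) * \<xi>) *\<^sub>R iexp (t * (0 + sqrt (2 * \<tau>) * \<xi>)) \<partial>lborel)"
    using assms by (intro lborel_integral_real_affine) auto
  also have "(\<integral>\<xi>. std_normal_density (0 + sqrt (2 * \<tau>) * \<xi>) *\<^sub>R iexp (t * (0 + sqrt (2 * \<tau>) * \<xi>)) \<partial>lborel)
      = (\<integral>\<xi>. complex_of_real (1 / sqrt (2 * pi)) * (cis (- (2 * pi * (\<xi> * x))) * complex_of_real (exp (- \<tau> * \<xi>\<^sup>2))) \<partial>lborel)"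
  proof (intro Bochner_Integration.integral_cong refl)
    fix \<xi> :: real
    have "t * (0 + sqrt (2 * \<tau>) * \<xi>) = - (2 * pi * (\<xi> * x))"
      using arg_cong[OF ts, of "\<lambda>z. z * \<xi>"] by (simp add: mult_ac)
    moreover have "std_normal_density (0 + sqrt (2 * \<tau>) * \<xi>) = 1 / sqrt (2 * pi) * exp (- \<tau> * \<xi>\<^sup>2)"
      using assms by (simp add: std_normal_density_def power_mult_distrib)
    ultimately show "std_normal_density (0 + sqrt (2 * \<tau>) * \<xi>) *\<^sub>R iexp (t * (0 + sqrt (2 * \<tau>) * \<xi>))
        = complex_of_real (1 / sqrt (2 * pi)) * (cis (- (2 * pi * (\<xi> * x))) * complex_of_real (exp (- \<tau> * \<xi>\<^sup>2)))"
      by (simp add: scaleR_conv_of_real cis_conv_exp)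
  qed
  finally have "complex_of_real (exp (- (t^2) / 2)) = complex_of_real (sqrt (2 * \<tau>) / sqrt (2 * pi))
      * (\<integral>\<xi>. cis (- (2 * pi * (\<xi> * x))) * complex_of_real (exp (- \<tau> * \<xi>\<^sup>2)) \<partial>lborel)" (is "_ = _ * ?I")
    using assms by (simp add: scaleR_conv_of_real)
  moreover have "sqrt (2 * \<tau>) / sqrt (2 * pi) = inverse (sqrt (pi / \<tau>))"
    using assms by (simp add: real_sqrt_divide real_sqrt_mult)
  moreover have "t\<^sup>2 / 2 = pi\<^sup>2 * x\<^sup>2 / \<tau>"
    using assms by (simp add: t_def power_divide power_mult_distrib)
  moreover have "sqrt (pi / \<tau>) \<noteq> 0" using assms by simp
  ultimately show ?th2 by (simp add: field_simps)
qed

lemma norm_sq_sum_Basis: "(norm x)\<^sup>2 = (\<Sum>b\<in>Basis. (x \<bullet> b)\<^sup>2)" for x :: "'a::euclidean_space"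
  by (subst power2_norm_eq_inner, subst euclidean_inner) (simp add: power2_eq_square)

lemma fourier_gaussian:
  fixes x :: "'a::euclidean_space"
  assumes "\<tau> > 0"
  shows "fourier (\<lambda>\<xi>. complex_of_real (exp (- \<tau> * (norm \<xi>)\<^sup>2))) x
    = complex_of_real (sqrt (pi / \<tau>) ^ DIM('a) * exp (- (pi\<^sup>2 * (norm x)\<^sup>2 / \<tau>)))"
proof -
  have eq: "cis (- (2 * pi * (\<xi> \<bullet> x))) * complex_of_real (exp (- \<tau> * (norm \<xi>)\<^sup>2))
      = (\<Prod>b\<in>Basis. cis (- (2 * pi * ((\<xi> \<bullet> b) * (x \<bullet> b)))) * complex_of_real (exp (- \<tau> * (\<xi> \<bullet> b)\<^sup>2)))" for \<xi> :: 'a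
  proof -
    have "cis (- (2 * pi * (\<xi> \<bullet> x))) = (\<Prod>b\<in>Basis. cis (- (2 * pi * ((\<xi> \<bullet> b) * (x \<bullet> b)))))"
      unfolding cis_conv_exp
      by (subst euclidean_inner) (simp add: exp_sum[symmetric] sum_negf sum_distrib_left)
    moreover have "exp (- \<tau> * (norm \<xi>)\<^sup>2) = (\<Prod>b\<in>Basis. exp (- \<tau> * (\<xi> \<bullet> b)\<^sup>2))"
      by (simp add: exp_sum[symmetric] norm_sq_sum_Basis sum_negf sum_distrib_left)
    ultimately show ?thesis by (simp add: prod.distrib)
  qed
  have "fourier (\<lambda>\<xi>. complex_of_real (exp (- \<tau> * (norm \<xi>)\<^sup>2))) x
      = (\<Prod>b\<in>Basis. complex_of_real (sqrt (pi / \<tau>) * exp (- (pi\<^sup>2 * (x \<bullet> b)\<^sup>2 / \<tau>))))"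
    unfolding fourier_def eq
    by (subst integral_lborel_prod_Basis)
      (intro fourier_gaussian_1d assms, simp only: fourier_gaussian_1d[OF assms])
  also have "\<dots> = complex_of_real (sqrt (pi / \<tau>) ^ DIM('a) * (\<Prod>b\<in>Basis. exp (- (pi\<^sup>2 * (x \<bullet> b)\<^sup>2 / \<tau>))))"
    by (simp add: prod.distrib)
  also have "(\<Prod>b\<in>Basis. exp (- (pi\<^sup>2 * (x \<bullet> b)\<^sup>2 / \<tau>))) = exp (- (pi\<^sup>2 * (norm x)\<^sup>2 / \<tau>))"
    by (simp add: exp_sum[symmetric] norm_sq_sum_Basis sum_negf sum_distrib_left sum_divide_distrib)
  finally show ?thesis .
qed

lemma fourier_modulate: "fourier (\<lambda>x. cis (2 * pi * (x \<bullet> a)) * f x) \<xi> = fourier f (\<xi> - a)"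
proof -
  have "cis (- (2 * pi * (x \<bullet> \<xi>))) * (cis (2 * pi * (x \<bullet> a)) * f x) = cis (- (2 * pi * (x \<bullet> (\<xi> - a)))) * f x" for x
  proof -
    have "- (2 * pi * (x \<bullet> \<xi>)) + 2 * pi * (x \<bullet> a) = - (2 * pi * (x \<bullet> (\<xi> - a)))"
      by (simp add: algebra_simps)
    then show ?thesis by (simp only: mult.assoc[symmetric] cis_mult)
  qed
  then show ?thesis unfolding fourier_def by (simp only:)
qed

lemma fourier_rescale:
  fixes f :: "'a::euclidean_space \<Rightarrow> complex"
  assumes "f \<in> borel_measurable borel" "r > 0"
  shows "fourier (\<lambda>x. f ((x - a) /\<^sub>R r)) \<xi> = r ^ DIM('a) * (cis (- (2 * pi * (a \<bullet> \<xi>))) * fourier f (r *\<^sub>R \<xi>))"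
proof -
  note [measurable] = assms(1)
  have "fourier (\<lambda>x. f ((x - a) /\<^sub>R r)) \<xi>
      = (\<integral>x. r ^ DIM('a) *\<^sub>R (cis (- (2 * pi * ((a + r *\<^sub>R x) \<bullet> \<xi>))) * f ((a + r *\<^sub>R x - a) /\<^sub>R r)) \<partial>lborel)"
    unfolding fourier_def
    using assms(2)
    by (subst lborel_affine[of r a], simp, subst integral_density, measurable, simp, subst integral_distr) auto
  also have "\<dots> = (\<integral>x. r ^ DIM('a) * (cis (- (2 * pi * (a \<bullet> \<xi>))) * (cis (- (2 * pi * (x \<bullet> (r *\<^sub>R \<xi>)))) * f x)) \<partial>lborel)"
  proof (intro Bochner_Integration.integral_cong refl)
    fix x
    have "cis (- (2 * pi * ((a + r *\<^sub>R x) \<bullet> \<xi>))) = cis (- (2 * pi * (a \<bullet> \<xi>))) * cis (- (2 * pi * (x \<bullet> (r *\<^sub>R \<xi>))))"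
      by (simp add: cis_mult inner_add_left algebra_simps)
    then show "r ^ DIM('a) *\<^sub>R (cis (- (2 * pi * ((a + r *\<^sub>R x) \<bullet> \<xi>))) * f ((a + r *\<^sub>R x - a) /\<^sub>R r))
        = r ^ DIM('a) * (cis (- (2 * pi * (a \<bullet> \<xi>))) * (cis (- (2 * pi * (x \<bullet> (r *\<^sub>R \<xi>)))) * f x))"
      using assms(2) by (simp add: scaleR_conv_of_real)
  qed
  also have "\<dots> = r ^ DIM('a) * (cis (- (2 * pi * (a \<bullet> \<xi>))) * fourier f (r *\<^sub>R \<xi>))"
    unfolding fourier_def by simp
  finally show ?thesis by simp
qed

section \<open>A discrete Frostman lemma\<close>

text \<open>
  Coordinates are raised one at a time until some constraint through the current point becomes tight.
\<close>

lemma saturated_weights: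
  fixes A :: "'j \<Rightarrow> 'x set" and c :: "'j \<Rightarrow> real"
  assumes J: "finite J" and X: "finite X" and c: "\<And>j. j \<in> J \<Longrightarrow> 0 \<le> c j"
    and cov: "\<And>x. x \<in> X \<Longrightarrow> \<exists>j\<in>J. x \<in> A j"
  obtains m :: "'x \<Rightarrow> real" where "\<And>x. 0 \<le> m x"
    "\<And>j. j \<in> J \<Longrightarrow> sum m (X \<inter> A j) \<le> c j"
    "\<And>x. x \<in> X \<Longrightarrow> \<exists>j\<in>J. x \<in> A j \<and> sum m (X \<inter> A j) = c j"
proof -
  have "\<exists>m. (\<forall>x. 0 \<le> m x) \<and> (\<forall>j\<in>J. sum m (Y \<inter> A j) \<le> c j) \<and>
      (\<forall>x\<in>Y. \<exists>j\<in>J. x \<in> A j \<and> sum m (Y \<inter> A j) = c j)" if "finite Y" "Y \<subseteq> X" for Y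
    using that
  proof (induction Y rule: finite_induct)
    case empty
    then show ?case using c by (intro exI[of _ "\<lambda>_. 0"]) auto
  next
    case (insert y Y)
    then obtain m where "(\<forall>x. 0 \<le> m x) \<and> (\<forall>j\<in>J. sum m (Y \<inter> A j) \<le> c j) \<and>
        (\<forall>x\<in>Y. \<exists>j\<in>J. x \<in> A j \<and> sum m (Y \<inter> A j) = c j)" by blast
    then have m0: "\<And>x. 0 \<le> m x" and le: "\<And>j. j \<in> J \<Longrightarrow> sum m (Y \<inter> A j) \<le> c j"
      and tight: "\<And>x. x \<in> Y \<Longrightarrow> \<exists>j\<in>J. x \<in> A j \<and> sum m (Y \<inter> A j) = c j"
      by blast+
    define K where "K = {j\<in>J. y \<in> A j}"
    define \<delta> where "\<delta> = Min ((\<lambda>j. c j - sum m (Y \<inter> A j)) ` K)"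
    have K: "finite K" "K \<noteq> {}" using J cov[of y] insert.prems by (auto simp: K_def)
    have \<delta>_le: "\<delta> \<le> c j - sum m (Y \<inter> A j)" if "j \<in> K" for j
      unfolding \<delta>_def using K that by (intro Min_le) auto
    have "\<delta> \<in> (\<lambda>j. c j - sum m (Y \<inter> A j)) ` K"
      unfolding \<delta>_def using K by (intro Min_in) auto
    then obtain j0 where j0: "j0 \<in> K" "\<delta> = c j0 - sum m (Y \<inter> A j0)" by blast
    have \<delta>0: "0 \<le> \<delta>" using j0 le by (auto simp: K_def)
    define m' where "m' = m(y := \<delta>)"
    have same: "sum m' (Y \<inter> A j) = sum m (Y \<inter> A j)" for j
      using insert.hyps by (intro sum.cong) (auto simp: m'_def)
    have sum': "sum m' (insert y Y \<inter> A j) = (if y \<in> A j then \<delta> else 0) + sum m (Y \<inter> A j)" for j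
      using insert.hyps same[of j] by (simp add: Int_insert_left) (simp add: m'_def)
    have "sum m' (insert y Y \<inter> A j) \<le> c j" if "j \<in> J" for j
      unfolding sum' using le[OF that] \<delta>_le[of j] that by (auto simp: K_def)
    moreover have "\<exists>j\<in>J. x \<in> A j \<and> sum m' (insert y Y \<inter> A j) = c j" if x: "x \<in> insert y Y" for x
    proof (cases "x = y")
      case True
      then show ?thesis unfolding sum' using j0 by (intro bexI[of _ j0]) (auto simp: K_def)
    next
      case False
      then obtain j where j: "j \<in> J" "x \<in> A j" "sum m (Y \<inter> A j) = c j" using tight x by blast
      \<comment> \<open>A tight constraint that contains \<open>y\<close> has slack 0, which forces
        \<delta> = 0 and keeps it tight; one that misses \<open>y\<close> is not affected by the
        change.\<close>
      then have "y \<in> A j \<Longrightarrow> \<delta> = 0" using \<delta>_le[of j] \<delta>0 by (auto simp: K_def)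
      with j show ?thesis unfolding sum' by (intro bexI[of _ j]) auto
    qed
    moreover have "0 \<le> m' x" for x using m0 \<delta>0 by (auto simp: m'_def)
    ultimately show ?case by blast
  qed
  from this[OF X subset_refl] that show ?thesis by blast
qed

text \<open>Finite covers, because the covers produced later come from finite nets; no upper bound
  on the radii, because for s > 0 a small sum of powers already makes every ball small.\<close>

definition null_cover :: "real \<Rightarrow> 'a::metric_space set \<Rightarrow> bool" where
  "null_cover s A \<longleftrightarrow> (\<forall>\<epsilon>>0. \<exists>G. finite G \<and> (\<forall>(x, \<rho>)\<in>G. \<rho> > 0) \<and>
     A \<subseteq> (\<Union>(x, \<rho>)\<in>G. cball x \<rho>) \<and> (\<Sum>(x, \<rho>)\<in>G. \<rho> powr s) < \<epsilon>)"

lemma null_cover_Un: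
  assumes "null_cover s A" "null_cover s B"
  shows "null_cover s (A \<union> B)"
  unfolding null_cover_def
proof (intro allI impI)
  fix \<epsilon> :: real assume "\<epsilon> > 0"
  then have "\<epsilon> / 2 > 0" by simp
  from assms[unfolded null_cover_def, rule_format, OF this]
  obtain G H where
    G: "finite G" "\<forall>(x, \<rho>)\<in>G. \<rho> > 0" "A \<subseteq> (\<Union>(x, \<rho>)\<in>G. cball x \<rho>)" "(\<Sum>(x, \<rho>)\<in>G. \<rho> powr s) < \<epsilon> / 2" and
    H: "finite H" "\<forall>(x, \<rho>)\<in>H. \<rho> > 0" "B \<subseteq> (\<Union>(x, \<rho>)\<in>H. cball x \<rho>)" "(\<Sum>(x, \<rho>)\<in>H. \<rho> powr s) < \<epsilon> / 2"
    by blast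
  have "(\<Sum>(x, \<rho>)\<in>G \<union> H. \<rho> powr s) \<le> (\<Sum>(x, \<rho>)\<in>G. \<rho> powr s) + (\<Sum>(x, \<rho>)\<in>H. \<rho> powr s)"
    using sum.union_inter[OF G(1) H(1), of "\<lambda>(x, \<rho>). \<rho> powr s"] sum_nonneg[of "G \<inter> H" "\<lambda>(x, \<rho>). \<rho> powr s"]
    by (auto simp: split_beta)
  with G H show "\<exists>G. finite G \<and> (\<forall>(x, \<rho>)\<in>G. \<rho> > 0) \<and>
     A \<union> B \<subseteq> (\<Union>(x, \<rho>)\<in>G. cball x \<rho>) \<and> (\<Sum>(x, \<rho>)\<in>G. \<rho> powr s) < \<epsilon>"
    by (intro exI[of _ "G \<union> H"] conjI) (blast, blast, blast, linarith)
qed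

lemma null_cover_empty: "null_cover s {}"
  unfolding null_cover_def by (intro allI impI exI[of _ "{}"]) auto

lemma null_cover_UN:
  "finite I \<Longrightarrow> (\<And>i. i \<in> I \<Longrightarrow> null_cover s (A i)) \<Longrightarrow> null_cover s (\<Union>i\<in>I. A i)"
  by (induction I rule: finite_induct) (auto intro: null_cover_empty null_cover_Un)

lemma hausdorff_content_le_cover:
  assumes "finite G" "\<forall>(x, \<rho>)\<in>G. 0 < \<rho> \<and> \<rho> \<le> \<delta> / 2" "A \<subseteq> (\<Union>(x, \<rho>)\<in>G. cball x \<rho>)" "s > 0" "\<delta> \<ge> 0"
  shows "hausdorff_content \<delta> s A \<le> ennreal (2 powr s * (\<Sum>(x, \<rho>)\<in>G. \<rho> powr s))"
proof -
  obtain l where l: "set l = G" "distinct l" using finite_distinct_list[OF assms(1)] by blast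
  \<comment> \<open>Beyond the list the cover is filled up with empty sets, to which
    \<open>hausdorff_gauge\<close> assigns 0. The factor \<open>2 powr s\<close> passes from radii
    to diameters.\<close>
  define U where "U i = (if i < length l then (case l ! i of (x, \<rho>) \<Rightarrow> cball x \<rho>) else {})" for i
  have diam: "diameter (cball x \<rho>) \<le> 2 * \<rho>" if "0 \<le> \<rho>" for x :: 'a and \<rho>
    unfolding diameter_def
  proof (split if_split, intro conjI impI cSUP_least)
    show "0 \<le> 2 * \<rho>" using that by simp
    show "cball x \<rho> \<times> cball x \<rho> \<noteq> {}" using that by auto
    fix p assume "p \<in> cball x \<rho> \<times> cball x \<rho>"
    then have "dist x (fst p) \<le> \<rho>" "dist x (snd p) \<le> \<rho>" by auto
    then show "(case p of (y, z) \<Rightarrow> dist y z) \<le> 2 * \<rho>"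
      using dist_triangle2[of "fst p" "snd p" x] by (simp add: dist_commute split_beta)
  qed
  have cover: "A \<subseteq> (\<Union>i. U i)"
  proof
    fix a assume "a \<in> A"
    then obtain x \<rho> where "(x, \<rho>) \<in> G" "a \<in> cball x \<rho>" using assms(3) by blast
    then obtain i where "i < length l" "l ! i = (x, \<rho>)" using l by (metis in_set_conv_nth)
    with \<open>a \<in> cball x \<rho>\<close> show "a \<in> (\<Union>i. U i)" by (auto simp: U_def intro!: exI[of _ i])
  qed
  have U: "bounded (U i) \<and> diameter (U i) \<le> \<delta> \<and>
      hausdorff_gauge s (U i) \<le> (if i < length l then ennreal (case l ! i of (x, \<rho>) \<Rightarrow> (2 * \<rho>) powr s) else 0)" for i
  proof (cases "i < length l")
    case True
    obtain x \<rho> where x: "l ! i = (x, \<rho>)" by force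
    with True l have "(x, \<rho>) \<in> G" by (metis nth_mem)
    with assms(2) have \<rho>: "0 < \<rho>" "2 * \<rho> \<le> \<delta>" by auto
    from diam[of \<rho> x] \<rho> have d: "diameter (cball x \<rho>) \<le> 2 * \<rho>" by simp
    have "diameter (cball x \<rho>) powr s \<le> (2 * \<rho>) powr s"
      using d assms(4) by (intro powr_mono2) (auto intro: diameter_ge_0)
    then show ?thesis using True x d \<rho> assms(4)
      by (auto simp: U_def hausdorff_gauge_def ennreal_leI)
  next
    case False
    then show ?thesis using \<open>\<delta> \<ge> 0\<close> by (simp add: U_def hausdorff_gauge_def)
  qed
  have "hausdorff_content \<delta> s A \<le> (\<Sum>i. hausdorff_gauge s (U i))"
    unfolding hausdorff_content_def using cover U by (intro INF_lower) auto
  also have "\<dots> \<le> (\<Sum>i. if i < length l then ennreal (case l ! i of (x, \<rho>) \<Rightarrow> (2 * \<rho>) powr s) else 0)"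
    using U by (intro suminf_le) auto
  also have "\<dots> = (\<Sum>i<length l. ennreal (case l ! i of (x, \<rho>) \<Rightarrow> (2 * \<rho>) powr s))"
    by (subst suminf_finite[of "{..<length l}"]) auto
  also have "\<dots> = ennreal (\<Sum>i<length l. (case l ! i of (x, \<rho>) \<Rightarrow> (2 * \<rho>) powr s))"
    by (intro sum_ennreal) (auto split: prod.splits)
  also have "(\<Sum>i<length l. (case l ! i of (x, \<rho>) \<Rightarrow> (2 * \<rho>) powr s)) = (\<Sum>(x, \<rho>)\<in>G. (2 * \<rho>) powr s)"
    by (rule sum.reindex_bij_betw[OF bij_betw_nth[OF l(2) refl l(1)[symmetric]]])
  also have "\<dots> = 2 powr s * (\<Sum>(x, \<rho>)\<in>G. \<rho> powr s)"
    unfolding sum_distrib_left using assms(2) by (intro sum.cong refl) (auto simp: powr_mult)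
  finally show ?thesis .
qed

lemma not_null_cover:
  assumes s: "0 < s" and dim: "ereal s < hausdorff_dim A"
  shows "\<not> null_cover s A"
proof
  assume null: "null_cover s A"
  have "hausdorff_content \<delta> s A = 0" if \<delta>: "\<delta> > 0" for \<delta>
  proof -
    have "hausdorff_content \<delta> s A \<le> 0 + ennreal e" if e: "e > 0" for e
    proof -
      \<comment> \<open>The first bound controls the sum; the second forces every radius below
        \<delta> / 2, as one larger ball would contribute more than the whole sum.\<close>
      define \<epsilon> where "\<epsilon> = min (e / 2 powr s) ((\<delta> / 2) powr s)"
      have "\<epsilon> > 0" using e \<delta> by (simp add: \<epsilon>_def)
      from null[unfolded null_cover_def, rule_format, OF this]
      obtain G where G: "finite G" "\<forall>(x, \<rho>)\<in>G. \<rho> > 0"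
        "A \<subseteq> (\<Union>(x, \<rho>)\<in>G. cball x \<rho>)" "(\<Sum>(x, \<rho>)\<in>G. \<rho> powr s) < \<epsilon>"
        by blast
      have small: "\<rho> \<le> \<delta> / 2" if "(x, \<rho>) \<in> G" for x \<rho>
      proof (rule ccontr)
        assume "\<not> \<rho> \<le> \<delta> / 2"
        then have "(\<delta> / 2) powr s \<le> \<rho> powr s" using \<delta> s by (intro powr_mono2) auto
        also have "\<dots> \<le> (\<Sum>(x, \<rho>)\<in>G. \<rho> powr s)"
          using member_le_sum[OF that, of "\<lambda>(x, \<rho>). \<rho> powr s"] G(1) by auto
        also have "\<dots> < (\<delta> / 2) powr s" using G(4) by (simp add: \<epsilon>_def)
        finally show False by simp
      qed
      have "hausdorff_content \<delta> s A \<le> ennreal (2 powr s * (\<Sum>(x, \<rho>)\<in>G. \<rho> powr s))"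
        using G small s \<delta> by (intro hausdorff_content_le_cover) auto
      also have "\<dots> \<le> ennreal e"
        using G(4) by (intro ennreal_leI) (auto simp: \<epsilon>_def pos_less_divide_eq mult.commute)
      finally show ?thesis by simp
    qed
    then show ?thesis
      by (metis ennreal_le_epsilon le_zero_eq)
  qed
  then have "hausdorff_outer_measure s A = 0"
    unfolding hausdorff_outer_measure_def by (simp add: SUP_eq_const)
  then have "hausdorff_dim A \<le> ereal s"
    unfolding hausdorff_dim_def using s by (intro Inf_lower) auto
  with dim show False by simp
qed

text \<open>
  Stands in for a Frostman measure: only the scales \<open>\<rho> \<ge> r\<close> are controlled, with \<open>C\<close> independent of \<open>r\<close>.
\<close>

definition frostman_at :: "real \<Rightarrow> real \<Rightarrow> real \<Rightarrow> 'a::metric_space set \<Rightarrow> 'a set \<Rightarrow> ('a \<Rightarrow> real) \<Rightarrow> bool" where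
  "frostman_at C s r E X m \<longleftrightarrow> finite X \<and> X \<subseteq> E \<and> (\<forall>x. 0 \<le> m x) \<and> sum m X = 1 \<and>
     (\<forall>x\<in>X. \<forall>\<rho>\<ge>r. sum m (X \<inter> cball x \<rho>) \<le> C * \<rho> powr s)"

text \<open>On an r-net of E the point masses are raised until every point lies in a dyadic ball, of
  radius 2^-k \<ge> r and with centre in the net, that is filled to its capacity 2^(-k s). Vitali
  selects disjoint filled balls whose sixfold enlargements cover E. They carry exactly their
  capacities, so the total mass is at least c / 6^s at every scale, and normalising it costs a
  constant independent of r.\<close>

lemma frostman:
  fixes E :: "'a::euclidean_space set"
  assumes E: "compact E" and s: "0 < s" and nn: "\<not> null_cover s E"
  shows "\<exists>C>0. \<forall>n. \<exists>X m. frostman_at C s ((1/2) ^ n) E X m"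
proof -
  from nn obtain c where c: "c > 0" and
    no: "\<nexists>G. finite G \<and> (\<forall>(x, \<rho>)\<in>G. \<rho> > 0) \<and> E \<subseteq> (\<Union>(x, \<rho>)\<in>G. cball x \<rho>) \<and> (\<Sum>(x, \<rho>)\<in>G. \<rho> powr s) < c"
    unfolding null_cover_def not_all not_imp by (elim exE conjE)
  have cov: "c \<le> (\<Sum>(x, \<rho>)\<in>G. \<rho> powr s)"
    if "finite G" "\<And>x \<rho>. (x, \<rho>) \<in> G \<Longrightarrow> \<rho> > 0" "E \<subseteq> (\<Union>(x, \<rho>)\<in>G. cball x \<rho>)" for G
  proof (rule ccontr)
    assume "\<not> c \<le> (\<Sum>(x, \<rho>)\<in>G. \<rho> powr s)"
    then have "(\<Sum>(x, \<rho>)\<in>G. \<rho> powr s) < c" by simp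
    with that have "finite G \<and> (\<forall>(x, \<rho>)\<in>G. \<rho> > 0) \<and> E \<subseteq> (\<Union>(x, \<rho>)\<in>G. cball x \<rho>) \<and> (\<Sum>(x, \<rho>)\<in>G. \<rho> powr s) < c"
      by (intro conjI) auto
    with no show False by blast
  qed
  define c1 where "c1 = c / 6 powr s"
  have c1: "c1 > 0" using c by (simp add: c1_def)
  \<comment> \<open>\<open>2 powr s\<close> rounds a radius up to a dyadic one; the maximum with 1
    covers radii above 1, where the total mass 1 is a sufficient bound.\<close>
  define C where "C = max 1 (1 / c1) * 2 powr s"
  have C: "C > 0" by (simp add: C_def)
  have "\<exists>X m. frostman_at C s ((1/2) ^ n) E X m" for n
  proof -
    define r :: real where "r = (1/2) ^ n"
    have r: "r > 0" by (simp add: r_def)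
    obtain X where X: "finite X" "X \<subseteq> E" "E \<subseteq> (\<Union>x\<in>X. ball x r)"
      using compactE_image[OF E, of E "\<lambda>x. ball x r"] r by (metis UN_I centre_in_ball open_ball subsetI)
    define J where "J = X \<times> {..n}"
    define A where "A = (\<lambda>(x::'a, k::nat). cball x ((1/2) ^ k))"
    define cap where "cap = (\<lambda>(x::'a, k::nat). ((1/2::real) ^ k) powr s)"
    obtain m where m0: "\<And>x. 0 \<le> m x" and le: "\<And>j. j \<in> J \<Longrightarrow> sum m (X \<inter> A j) \<le> cap j"
      and tight: "\<And>x. x \<in> X \<Longrightarrow> \<exists>j\<in>J. x \<in> A j \<and> sum m (X \<inter> A j) = cap j"
    proof (rule saturated_weights[of J X cap A])
      show "\<exists>j\<in>J. x \<in> A j" if "x \<in> X" for x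
        using that by (intro bexI[of _ "(x, 0)"]) (auto simp: J_def A_def)
    qed (use X in \<open>auto simp: J_def cap_def\<close>)
    define K where "K = {j\<in>J. sum m (X \<inter> A j) = cap j}"
    have rK: "\<And>j. j \<in> K \<Longrightarrow> 0 < (1/2::real) ^ snd j \<and> (1/2::real) ^ snd j \<le> 1"
      by (auto intro: power_le_one)
    have XK: "X \<subseteq> (\<Union>j\<in>K. cball (fst j) ((1/2) ^ snd j))"
    proof
      fix x assume "x \<in> X"
      then obtain j where "j \<in> J" "x \<in> A j" "sum m (X \<inter> A j) = cap j" using tight by blast
      then have "j \<in> K" "x \<in> cball (fst j) ((1/2) ^ snd j)" by (simp_all add: K_def A_def split_beta)
      then show "x \<in> (\<Union>j\<in>K. cball (fst j) ((1/2) ^ snd j))" by blast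
    qed
    obtain D where D: "D \<subseteq> K"
      "pairwise (\<lambda>i j. disjnt (cball (fst i) ((1/2) ^ snd i)) (cball (fst j) ((1/2) ^ snd j))) D"
      "X \<subseteq> (\<Union>j\<in>D. cball (fst j) (5 * (1/2) ^ snd j))"
      by (rule Vitali_covering_lemma_cballs[OF XK rK]) (assumption, rule that)
    have fD: "finite D"
      using D(1) X(1) by (auto simp: K_def J_def intro: finite_subset)
    have Acb: "A j = cball (fst j) ((1/2) ^ snd j)" and capj: "cap j = ((1/2) ^ snd j) powr s" for j
      by (simp_all add: A_def cap_def split_beta)
    \<comment> \<open>6 = 5 + 1: five from Vitali, one more because every point of E is within
      \<open>r\<close> of the net and \<open>r\<close> is at most each of the radii.\<close>
    have "c \<le> (\<Sum>(x, \<rho>)\<in>(\<lambda>j. (fst j, 6 * (1/2) ^ snd j)) ` D. \<rho> powr s)"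
    proof (rule cov)
      show "E \<subseteq> (\<Union>(x, \<rho>)\<in>(\<lambda>j. (fst j, 6 * (1/2) ^ snd j)) ` D. cball x \<rho>)"
      proof
        fix e assume "e \<in> E"
        then obtain x where x: "x \<in> X" "dist x e < r" using X(3) by auto
        then obtain j where j: "j \<in> D" "dist (fst j) x \<le> 5 * (1/2) ^ snd j" using D(3) by auto
        have "snd j \<le> n" using j D(1) by (auto simp: K_def J_def)
        then have "r \<le> (1/2) ^ snd j" unfolding r_def by (intro power_decreasing) auto
        then have "dist (fst j) e \<le> 6 * (1/2) ^ snd j"
          using x j dist_triangle[of "fst j" e x] by simp
        with j show "e \<in> (\<Union>(x, \<rho>)\<in>(\<lambda>j. (fst j, 6 * (1/2) ^ snd j)) ` D. cball x \<rho>)" by force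
      qed
    qed (use fD in auto)
    also have "\<dots> = (\<Sum>j\<in>D. (6 * (1/2) ^ snd j) powr s)"
      by (subst sum.reindex) (auto simp: inj_on_def prod_eq_iff power_inject_exp')
    also have "\<dots> = (\<Sum>j\<in>D. 6 powr s * sum m (X \<inter> A j))"
      using D(1) by (intro sum.cong refl) (auto simp: K_def powr_mult capj)
    also have "\<dots> = 6 powr s * (\<Sum>j\<in>D. sum m (X \<inter> A j))"
      by (rule sum_distrib_left[symmetric])
    also have "(\<Sum>j\<in>D. sum m (X \<inter> A j)) = sum m (\<Union>j\<in>D. X \<inter> A j)"
    proof (rule sum.UNION_disjoint[symmetric])
      have "A i \<inter> A j = {}" if "i \<in> D" "j \<in> D" "i \<noteq> j" for i j
        using pairwiseD[OF D(2) that] unfolding Acb disjnt_def .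
      then show "\<forall>i\<in>D. \<forall>j\<in>D. i \<noteq> j \<longrightarrow> (X \<inter> A i) \<inter> (X \<inter> A j) = {}" by blast
    qed (use X(1) fD in auto)
    also have "\<dots> \<le> sum m X"
      using X(1) m0 by (intro sum_mono2) auto
    finally have M: "c1 \<le> sum m X" by (simp add: c1_def pos_divide_le_eq mult.commute)
    define M where "M = sum m X"
    have M0: "M > 0" "c1 \<le> M" using M c1 by (auto simp: M_def)
    define m' where "m' = (\<lambda>x. m x / M)"
    have sum': "sum m' S = sum m S / M" for S by (simp add: m'_def sum_divide_distrib)
    have "sum m' (X \<inter> cball x \<rho>) \<le> C * \<rho> powr s" if x: "x \<in> X" and \<rho>: "r \<le> \<rho>" for x \<rho>
    proof (cases "\<rho> > 1")
      case True
      have "sum m' (X \<inter> cball x \<rho>) \<le> sum m' X"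
        using X(1) m0 M0 by (intro sum_mono2) (auto simp: m'_def)
      also have "\<dots> = 1" using M0 by (simp add: sum' M_def)
      also have "\<dots> \<le> C * \<rho> powr s"
      proof -
        have "1 \<le> \<rho> powr s" "1 \<le> (2::real) powr s" using True s by (auto intro: ge_one_powr_ge_zero)
        then have "1 * 1 * 1 \<le> max 1 (1 / c1) * 2 powr s * \<rho> powr s" by (intro mult_mono) auto
        then show ?thesis by (simp add: C_def)
      qed
      finally show ?thesis .
    next
      case False
      have "\<exists>k\<le>n. \<rho> \<le> (1/2) ^ k \<and> (1/2) ^ k \<le> 2 * \<rho>"
      proof -
        \<comment> \<open>The finest level whose radius still reaches \<rho>; at k = n the
          assumption r \<le> \<rho> takes the place of maximality.\<close>
        define k where "k = (GREATEST k. k \<le> n \<and> \<rho> \<le> (1/2::real) ^ k)"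
        have k: "k \<le> n \<and> \<rho> \<le> (1/2::real) ^ k"
          unfolding k_def by (rule GreatestI_nat[of _ 0 n]) (use False in auto)
        have "(1/2) ^ k \<le> 2 * \<rho>"
        proof (cases "k = n")
          case True
          then have "(1/2) ^ k = r" by (simp add: r_def)
          with \<rho> r show ?thesis by linarith
        next
          case f: False
          have "\<not> (Suc k \<le> n \<and> \<rho> \<le> (1/2::real) ^ Suc k)"
            using Greatest_le_nat[of "\<lambda>k. k \<le> n \<and> \<rho> \<le> (1/2::real) ^ k" "Suc k" n] unfolding k_def[symmetric] by auto
          with k f show ?thesis by simp
        qed
        with k show ?thesis by blast
      qed
      then obtain k where k: "k \<le> n" "\<rho> \<le> (1/2) ^ k" "(1/2) ^ k \<le> 2 * \<rho>" by blast
      have "sum m (X \<inter> cball x \<rho>) \<le> sum m (X \<inter> A (x, k))"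
        using X(1) m0 k by (intro sum_mono2) (auto simp: A_def)
      also have "\<dots> \<le> cap (x, k)" using x k by (intro le) (auto simp: J_def)
      also have "\<dots> \<le> (2 * \<rho>) powr s"
        unfolding cap_def using k s by (auto intro: powr_mono2)
      also have "\<dots> = 2 powr s * \<rho> powr s" using r \<rho> by (simp add: powr_mult)
      finally have "sum m' (X \<inter> cball x \<rho>) \<le> (2 powr s * \<rho> powr s) / M"
        unfolding sum' using M0 by (intro divide_right_mono) auto
      also have "\<dots> = (1 / M) * (2 powr s * \<rho> powr s)" by simp
      also have "\<dots> \<le> max 1 (1 / c1) * (2 powr s * \<rho> powr s)"
        using M0 c1 by (intro mult_right_mono) (auto simp: le_max_iff_disj intro: divide_left_mono)
      finally show ?thesis by (simp add: C_def)
    qed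
    moreover have "sum m' X = 1" using M0 by (simp add: sum' M_def)
    ultimately show ?thesis
      using X m0 M0 by (intro exI[of _ X] exI[of _ m']) (auto simp: frostman_at_def m'_def r_def)
  qed
  with C show ?thesis by blast
qed

section \<open>Energy estimates\<close>

text \<open>The phase has a positive sign, so that a further \<open>fourier\<close>, after damping,
  returns bumps centred on \<open>X\<close> and not on its reflection. The transform of
  \<open>mollified\<close> shows the conjugate instead.\<close>

definition char_sum :: "'a::euclidean_space set \<Rightarrow> ('a \<Rightarrow> real) \<Rightarrow> 'a \<Rightarrow> complex" where
  "char_sum X m \<xi> = (\<Sum>x\<in>X. complex_of_real (m x) * cis (2 * pi * (\<xi> \<bullet> x)))"

lemma char_sum_measurable [measurable]: "char_sum X m \<in> borel_measurable borel"
  unfolding char_sum_def by measurable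

lemma char_sum_norm_le:
  assumes "\<And>x. 0 \<le> m x" "sum m X = 1"
  shows "cmod (char_sum X m \<xi>) \<le> 1"
proof -
  have "cmod (char_sum X m \<xi>) \<le> (\<Sum>x\<in>X. cmod (complex_of_real (m x) * cis (2 * pi * (\<xi> \<bullet> x))))"
    unfolding char_sum_def by (rule norm_sum)
  also have "\<dots> = sum m X" using assms by (simp add: norm_mult)
  finally show ?thesis using assms by simp
qed

lemma char_sum_norm_sq:
  "complex_of_real ((cmod (char_sum X m \<xi>))\<^sup>2)
    = (\<Sum>x\<in>X. \<Sum>y\<in>X. complex_of_real (m x * m y) * cis (2 * pi * (\<xi> \<bullet> (x - y))))"
proof -
  have "complex_of_real ((cmod (char_sum X m \<xi>))\<^sup>2) = char_sum X m \<xi> * cnj (char_sum X m \<xi>)"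
    by (simp only: complex_norm_square)
  also have "\<dots> = (\<Sum>x\<in>X. \<Sum>y\<in>X. complex_of_real (m x * m y) * cis (2 * pi * (\<xi> \<bullet> (x - y))))"
    unfolding char_sum_def cnj_sum sum_product
  proof (intro sum.cong refl)
    fix x y
    have "cis (2 * pi * (\<xi> \<bullet> x)) * cnj (cis (2 * pi * (\<xi> \<bullet> y))) = cis (2 * pi * (\<xi> \<bullet> (x - y)))"
      by (simp add: cis_cnj cis_mult inner_diff_right right_diff_distrib)
    then show "complex_of_real (m x) * cis (2 * pi * (\<xi> \<bullet> x)) * cnj (complex_of_real (m y) * cis (2 * pi * (\<xi> \<bullet> y)))
        = complex_of_real (m x * m y) * cis (2 * pi * (\<xi> \<bullet> (x - y)))"
      by (simp add: mult_ac)
  qed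
  finally show ?thesis .
qed

text \<open>Expanding the square leaves one character for each pair of points, and a character
  integrates against the Gaussian to a Gaussian of the difference. Frequency energies thus become
  pair sums in space.\<close>

lemma char_sum_energy:
  fixes X :: "'a::euclidean_space set"
  assumes X: "finite X" and \<tau>: "\<tau> > 0"
  shows "integrable lborel (\<lambda>\<xi>. exp (- \<tau> * (norm \<xi>)\<^sup>2) * (cmod (char_sum X m \<xi>))\<^sup>2)"
    and "(\<integral>\<xi>. exp (- \<tau> * (norm \<xi>)\<^sup>2) * (cmod (char_sum X m \<xi>))\<^sup>2 \<partial>lborel)
      = (\<Sum>x\<in>X. \<Sum>y\<in>X. m x * m y * (sqrt (pi / \<tau>) ^ DIM('a) * exp (- (pi\<^sup>2 * (norm (x - y))\<^sup>2 / \<tau>))))"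
proof -
  let ?G = "\<lambda>\<xi>::'a. complex_of_real (exp (- \<tau> * (norm \<xi>)\<^sup>2))"
  let ?e = "\<lambda>\<xi>. exp (- \<tau> * (norm \<xi>)\<^sup>2) * (cmod (char_sum X m \<xi>))\<^sup>2"
  have G: "integrable lborel ?G" by (intro schwartz_integrable gaussian_schwartz \<tau>)
  have eq: "complex_of_real (?e \<xi>)
      = (\<Sum>x\<in>X. \<Sum>y\<in>X. complex_of_real (m x * m y) * (cis (- (2 * pi * (\<xi> \<bullet> (y - x)))) * ?G \<xi>))" for \<xi>
  proof -
    have "complex_of_real (?e \<xi>) = complex_of_real ((cmod (char_sum X m \<xi>))\<^sup>2) * ?G \<xi>"
      by (simp add: mult.commute)
    also have "\<dots> = (\<Sum>x\<in>X. \<Sum>y\<in>X. complex_of_real (m x * m y) * (cis (- (2 * pi * (\<xi> \<bullet> (y - x)))) * ?G \<xi>))"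
      unfolding char_sum_norm_sq sum_distrib_right
      by (intro sum.cong refl) (simp add: inner_diff_right algebra_simps)
    finally show ?thesis .
  qed
  have int: "integrable lborel (\<lambda>\<xi>. complex_of_real (?e \<xi>))"
    unfolding eq by (intro Bochner_Integration.integrable_sum integrable_mult_right fourier_integrand_integrable G)
  then show "integrable lborel ?e" by (simp only: complex_of_real_integrable_eq)
  have "complex_of_real (\<integral>\<xi>. ?e \<xi> \<partial>lborel) = (\<integral>\<xi>. complex_of_real (?e \<xi>) \<partial>lborel)"
    by (rule integral_complex_of_real[symmetric])
  also have "\<dots> = (\<Sum>x\<in>X. \<Sum>y\<in>X. complex_of_real (m x * m y) * fourier ?G (y - x))"
    unfolding eq fourier_def
    by (simp only: Bochner_Integration.integral_sum integral_mult_right_zero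
        Bochner_Integration.integrable_sum integrable_mult_right fourier_integrand_integrable[OF G])
  also have "\<dots> = complex_of_real (\<Sum>x\<in>X. \<Sum>y\<in>X. m x * m y * (sqrt (pi / \<tau>) ^ DIM('a) * exp (- (pi\<^sup>2 * (norm (x - y))\<^sup>2 / \<tau>))))"
    by (simp only: fourier_gaussian[OF \<tau>] of_real_sum of_real_mult norm_minus_commute)
  finally show "(\<integral>\<xi>. ?e \<xi> \<partial>lborel)
      = (\<Sum>x\<in>X. \<Sum>y\<in>X. m x * m y * (sqrt (pi / \<tau>) ^ DIM('a) * exp (- (pi\<^sup>2 * (norm (x - y))\<^sup>2 / \<tau>))))"
    by (simp only: of_real_eq_iff)
qed

text \<open>Cutting the Gaussian into dyadic shells turns the ball condition into a bound on potentials.\<close>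

lemma gaussian_potential_bound:
  assumes s: "0 \<le> s"
  shows "\<exists>K>0. \<forall>C r \<rho> E X m (x::'a::metric_space). frostman_at C s r E X m \<and> 0 \<le> C \<and> 0 < \<rho> \<and> r \<le> \<rho> \<and> x \<in> X \<longrightarrow>
    (\<Sum>y\<in>X. m y * exp (- (dist x y / \<rho>)\<^sup>2)) \<le> C * K * \<rho> powr s"
proof -
  \<comment> \<open>One power more than s: the growth 2^(k s) of the ball condition against the
    decay 2^(-k N) leaves a factor of at most 2^-k per shell.\<close>
  define N where "N = nat \<lceil>s\<rceil> + 1"
  have N: "s + 1 \<le> real N" using s by (simp add: N_def)
  define K0 where "K0 = exp ((real N)\<^sup>2 / 4) * 2 ^ N"
  have K0: "K0 > 0" by (simp add: K0_def)
  have shell: "exp (- u\<^sup>2) \<le> K0 * (1/2) ^ (l * N)" if u: "0 \<le> u" and l: "2 ^ l \<le> 2 * (1 + u)" for u :: real and l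
  proof -
    have "(2 ^ l) ^ N \<le> (2 * (1 + u)) ^ N" using l by (intro power_mono) auto
    then have "(2 ^ l) ^ N * exp (- u\<^sup>2) \<le> (2 * (1 + u)) ^ N * exp (- u\<^sup>2)"
      by (rule mult_right_mono) simp
    then have "(2 ^ l) ^ N * exp (- u\<^sup>2) \<le> 2 ^ N * ((1 + u) ^ N * exp (- u\<^sup>2))"
      unfolding power_mult_distrib by (simp only: mult.assoc)
    also have "\<dots> \<le> 2 ^ N * exp ((real N)\<^sup>2 / 4)"
      using gaussian_rapid_real[of 1 u N] u by (intro mult_left_mono) auto
    finally have le: "(2 ^ l) ^ N * exp (- u\<^sup>2) \<le> 2 ^ N * exp ((real N)\<^sup>2 / 4)" .
    have e: "(1/2::real) ^ (l * N) = 1 / (2 ^ l) ^ N" by (simp add: power_one_over power_mult)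
    from le show ?thesis
      unfolding e K0_def by (simp add: pos_le_divide_eq mult_ac)
  qed
  show ?thesis
  proof (intro exI[of _ "2 * K0"] conjI allI impI)
    show "0 < 2 * K0" using K0 by simp
    fix C r \<rho> E X m and x :: 'a
    assume *: "frostman_at C s r E X m \<and> 0 \<le> C \<and> 0 < \<rho> \<and> r \<le> \<rho> \<and> x \<in> X"
    then have X: "finite X" and m: "\<And>x. 0 \<le> m x" and \<rho>: "0 < \<rho>" and C: "0 \<le> C"
      and ball: "\<And>\<rho>'. r \<le> \<rho>' \<Longrightarrow> sum m (X \<inter> cball x \<rho>') \<le> C * \<rho>' powr s"
      by (auto simp: frostman_at_def)
    \<comment> \<open>The least dyadic radius that reaches \<open>y\<close>: minimality gives the
      second bound, and the summand 1 covers l = 0.\<close>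
    have "\<exists>l. dist x y / \<rho> \<le> 2 ^ l \<and> 2 ^ l \<le> 2 * (1 + dist x y / \<rho>)" for y
    proof -
      let ?u = "dist x y / \<rho>"
      have u: "0 \<le> ?u" using \<rho> by simp
      obtain l0 where l0: "?u \<le> 2 ^ l0" using real_arch_pow[of 2 ?u] by (auto intro: less_imp_le)
      define l where "l = (LEAST l. ?u \<le> 2 ^ l)"
      have 1: "?u \<le> 2 ^ l" unfolding l_def by (rule LeastI[of _ l0]) (rule l0)
      have "2 ^ l \<le> 2 * (1 + ?u)"
      proof (cases l)
        case 0
        then show ?thesis using u by simp
      next
        case (Suc k)
        have "\<not> ?u \<le> 2 ^ k" using not_less_Least[of k "\<lambda>l. ?u \<le> 2 ^ l"] Suc by (simp add: l_def)
        then show ?thesis using Suc by simp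
      qed
      with 1 show ?thesis by blast
    qed
    then obtain l where l: "\<And>y. dist x y / \<rho> \<le> 2 ^ l y" "\<And>y. 2 ^ l y \<le> 2 * (1 + dist x y / \<rho>)"
      by metis
    define L where "L = Max (l ` X)"
    have L: "l y \<le> L" if "y \<in> X" for y unfolding L_def using X that by auto
    have "(\<Sum>y\<in>X. m y * exp (- (dist x y / \<rho>)\<^sup>2)) \<le> (\<Sum>y\<in>X. \<Sum>k\<le>L. K0 * (1/2) ^ (k * N) * (m y * indicat_real (cball x (2 ^ k * \<rho>)) y))"
    proof (rule sum_mono)
      fix y assume y: "y \<in> X"
      have "y \<in> cball x (2 ^ l y * \<rho>)" using l(1)[of y] \<rho> by (simp add: pos_divide_le_eq)
      then have "m y * exp (- (dist x y / \<rho>)\<^sup>2) \<le> K0 * (1/2) ^ (l y * N) * (m y * indicat_real (cball x (2 ^ l y * \<rho>)) y)"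
        using mult_left_mono[OF shell[OF _ l(2)[of y]] m[of y]] \<rho> by (simp add: mult_ac)
      also have "\<dots> \<le> (\<Sum>k\<le>L. K0 * (1/2) ^ (k * N) * (m y * indicat_real (cball x (2 ^ k * \<rho>)) y))"
        using L[OF y] K0 m by (intro member_le_sum) (auto intro!: mult_nonneg_nonneg)
      finally show "m y * exp (- (dist x y / \<rho>)\<^sup>2) \<le> \<dots>" .
    qed
    also have "\<dots> = (\<Sum>k\<le>L. K0 * (1/2) ^ (k * N) * sum m (X \<inter> cball x (2 ^ k * \<rho>)))"
      by (subst sum.swap) (simp only: sum_distrib_left[symmetric], simp add: X sum.inter_restrict indicator_def if_distrib cong: if_cong)
    also have "\<dots> \<le> (\<Sum>k\<le>L. K0 * C * \<rho> powr s * (1/2) ^ k)"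
    proof (rule sum_mono)
      fix k
      have "1 * \<rho> \<le> 2 ^ k * \<rho>" using \<rho> by (intro mult_right_mono) auto
      with * have "r \<le> 2 ^ k * \<rho>" by linarith
      then have "K0 * (1/2) ^ (k * N) * sum m (X \<inter> cball x (2 ^ k * \<rho>)) \<le> K0 * (1/2) ^ (k * N) * (C * (2 ^ k * \<rho>) powr s)"
        using K0 by (intro mult_left_mono ball) auto
      also have "(2 ^ k * \<rho>) powr s = 2 powr (k * s) * \<rho> powr s"
      proof -
        have "(2::real) ^ k = 2 powr k" by (simp add: powr_realpow)
        then show ?thesis using \<rho> by (simp only: powr_mult powr_powr)
      qed
      also have half: "(1/2::real) ^ (k * N) = 2 powr (- real k * N)"
      proof -
        have "2 powr (- real k * N) = inverse (2 powr real (k * N))" by (simp add: powr_minus)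
        also have "\<dots> = inverse (2 ^ (k * N))" by (subst powr_realpow) auto
        finally show ?thesis by (simp add: power_one_over inverse_eq_divide)
      qed
      also have "K0 * 2 powr (- real k * N) * (C * (2 powr (k * s) * \<rho> powr s)) = K0 * C * \<rho> powr s * 2 powr (k * (s - N))"
        by (simp add: powr_add[symmetric] algebra_simps)
      also have "\<dots> \<le> K0 * C * \<rho> powr s * 2 powr (- real k)"
      proof (intro mult_left_mono powr_mono)
        have "real k * (s - real N) \<le> real k * (-1)" using N by (intro mult_left_mono) auto
        then show "real k * (s - real N) \<le> - real k" by simp
      qed (use K0 C in auto)
      also have "2 powr (- real k) = (1/2) ^ k"
        by (simp add: powr_minus powr_realpow power_one_over inverse_eq_divide)
      finally show "K0 * (1/2) ^ (k * N) * sum m (X \<inter> cball x (2 ^ k * \<rho>)) \<le> K0 * C * \<rho> powr s * (1/2) ^ k"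
        unfolding half .
    qed
    also have "\<dots> = K0 * C * \<rho> powr s * (\<Sum>k\<le>L. (1/2) ^ k)"
      by (rule sum_distrib_left[symmetric])
    also have "\<dots> \<le> K0 * C * \<rho> powr s * 2"
    proof (rule mult_left_mono)
      have "(\<Sum>k\<le>L. (1/2::real) ^ k) \<le> (\<Sum>k. (1/2) ^ k)"
        by (intro sum_le_suminf) (auto intro: summable_geometric)
      then show "(\<Sum>k\<le>L. (1/2::real) ^ k) \<le> 2" by (simp add: suminf_geometric)
    qed (use K0 C in auto)
    finally show "(\<Sum>y\<in>X. m y * exp (- (dist x y / \<rho>)\<^sup>2)) \<le> C * (2 * K0) * \<rho> powr s"
      by (simp add: mult_ac)
  qed
qed

text \<open>The spatial width sqrt \<tau> may be finer than the Frostman scale r. The Gaussian is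
  then enlarged to a width \<rho> \<ge> r, where the ball condition is available, while the
  prefactor keeps the original \<tau>.\<close>

lemma frostman_energy:
  assumes s: "0 \<le> s"
  shows "\<exists>K>0. \<forall>C r \<rho> \<tau> E X m. frostman_at C s r E X (m :: 'a::euclidean_space \<Rightarrow> real) \<and> 0 \<le> C \<and> 0 < \<rho> \<and> r \<le> \<rho> \<and> 0 < \<tau> \<and> \<tau> \<le> \<rho>\<^sup>2 \<longrightarrow>
    (\<integral>\<xi>. exp (- \<tau> * (norm \<xi>)\<^sup>2) * (cmod (char_sum X m \<xi>))\<^sup>2 \<partial>lborel) \<le> sqrt (pi / \<tau>) ^ DIM('a) * (C * K * \<rho> powr s)"
proof -
  from gaussian_potential_bound[OF s, where 'a='a] obtain K where K: "K > 0" and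
    pot: "\<And>C r \<rho> E X m (x::'a). frostman_at C s r E X m \<Longrightarrow> 0 \<le> C \<Longrightarrow> 0 < \<rho> \<Longrightarrow> r \<le> \<rho> \<Longrightarrow> x \<in> X \<Longrightarrow>
      (\<Sum>y\<in>X. m y * exp (- (dist x y / \<rho>)\<^sup>2)) \<le> C * K * \<rho> powr s" by blast
  show ?thesis
  proof (intro exI[of _ K] conjI allI impI K)
    fix C r \<rho> \<tau> E X and m :: "'a \<Rightarrow> real"
    assume *: "frostman_at C s r E X m \<and> 0 \<le> C \<and> 0 < \<rho> \<and> r \<le> \<rho> \<and> 0 < \<tau> \<and> \<tau> \<le> \<rho>\<^sup>2"
    then have X: "finite X" and m: "\<And>x. 0 \<le> m x" "sum m X = 1" and \<tau>: "0 < \<tau>" "\<tau> \<le> \<rho>\<^sup>2" and \<rho>: "0 < \<rho>"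
      by (auto simp: frostman_at_def)
    let ?q = "sqrt (pi / \<tau>) ^ DIM('a)"
    have q: "0 \<le> ?q" using \<tau> by simp
    have "(\<integral>\<xi>. exp (- \<tau> * (norm \<xi>)\<^sup>2) * (cmod (char_sum X m \<xi>))\<^sup>2 \<partial>lborel)
        = (\<Sum>x\<in>X. \<Sum>y\<in>X. m x * m y * (?q * exp (- (pi\<^sup>2 * (norm (x - y))\<^sup>2 / \<tau>))))"
      by (rule char_sum_energy[OF X \<tau>(1)])
    also have "\<dots> \<le> (\<Sum>x\<in>X. \<Sum>y\<in>X. m x * m y * (?q * exp (- (dist x y / \<rho>)\<^sup>2)))"
    proof (intro sum_mono mult_left_mono)
      fix x y :: 'a
      have "(dist x y)\<^sup>2 / \<rho>\<^sup>2 \<le> (dist x y)\<^sup>2 / \<tau>"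
        using \<tau> \<rho> by (intro divide_left_mono) auto
      also have "\<dots> = 1 * (dist x y)\<^sup>2 / \<tau>" by simp
      also have "\<dots> \<le> pi\<^sup>2 * (dist x y)\<^sup>2 / \<tau>"
        using \<tau> pi_ge_two by (intro divide_right_mono mult_right_mono one_le_power) auto
      finally show "exp (- (pi\<^sup>2 * (norm (x - y))\<^sup>2 / \<tau>)) \<le> exp (- (dist x y / \<rho>)\<^sup>2)"
        by (simp add: dist_norm power_divide)
    qed (use m q in auto)
    also have "\<dots> = ?q * (\<Sum>x\<in>X. m x * (\<Sum>y\<in>X. m y * exp (- (dist x y / \<rho>)\<^sup>2)))"
      unfolding sum_distrib_left by (intro sum.cong refl) (simp add: mult_ac)
    also have "\<dots> \<le> ?q * (\<Sum>x\<in>X. m x * (C * K * \<rho> powr s))"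
      using * m q by (intro mult_left_mono sum_mono pot[of C r E]) auto
    also have "(\<Sum>x\<in>X. m x * (C * K * \<rho> powr s)) = C * K * \<rho> powr s"
      using m by (simp add: sum_distrib_right[symmetric])
    finally show "(\<integral>\<xi>. exp (- \<tau> * (norm \<xi>)\<^sup>2) * (cmod (char_sum X m \<xi>))\<^sup>2 \<partial>lborel) \<le> ?q * (C * K * \<rho> powr s)" .
  qed
qed

text \<open>If s > d, the energy with \<tau> = r^2 is at most a constant times r^(s - d) and tends
  to 0. Yet it dominates the energy with \<tau> = 1, which boundedness of E keeps away from
  0.\<close>

lemma frostman_exponent_le_dim:
  fixes E :: "'a::euclidean_space set"
  assumes E: "bounded E" and s: "0 \<le> s" and C: "0 \<le> C"
    and fr: "\<And>n. \<exists>X m. frostman_at C s ((1/2) ^ n) E X m"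
  shows "s \<le> DIM('a)"
proof (rule ccontr)
  assume "\<not> s \<le> DIM('a)"
  define \<delta> where "\<delta> = s - DIM('a)"
  have \<delta>: "\<delta> > 0" using \<open>\<not> s \<le> DIM('a)\<close> by (simp add: \<delta>_def)
  obtain K where K: "K > 0" and
    en: "\<And>C r \<rho> \<tau> E X m. frostman_at C s r E X (m :: 'a \<Rightarrow> real) \<and> 0 \<le> C \<and> 0 < \<rho> \<and> r \<le> \<rho> \<and> 0 < \<tau> \<and> \<tau> \<le> \<rho>\<^sup>2 \<longrightarrow>
    (\<integral>\<xi>. exp (- \<tau> * (norm \<xi>)\<^sup>2) * (cmod (char_sum X m \<xi>))\<^sup>2 \<partial>lborel) \<le> sqrt (pi / \<tau>) ^ DIM('a) * (C * K * \<rho> powr s)"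
    using frostman_energy[OF s, where 'a='a] by blast
  obtain R where R: "\<And>x y. x \<in> E \<Longrightarrow> y \<in> E \<Longrightarrow> norm (x - y) \<le> R"
    using E unfolding bounded_two_points dist_norm by blast
  define c where "c = sqrt pi ^ DIM('a) * exp (- (pi\<^sup>2 * R\<^sup>2))"
  have c: "c > 0" by (simp add: c_def)
  have le: "c \<le> sqrt pi ^ DIM('a) * (C * K) * ((1/2) ^ n) powr \<delta>" for n
  proof -
    define r :: real where "r = (1/2) ^ n"
    have r: "0 < r" "r \<le> 1" by (auto simp: r_def power_le_one)
    obtain X and m :: "'a \<Rightarrow> real" where f: "frostman_at C s r E X m" using fr r_def by blast
    then have X: "finite X" "X \<subseteq> E" and m: "\<And>x. 0 \<le> m x" "sum m X = 1" by (auto simp: frostman_at_def)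
    have "c = (\<Sum>x\<in>X. \<Sum>y\<in>X. m x * m y * c)"
      using m by (simp add: sum_distrib_left[symmetric] sum_distrib_right[symmetric])
    also have "\<dots> \<le> (\<Sum>x\<in>X. \<Sum>y\<in>X. m x * m y * (sqrt (pi / 1) ^ DIM('a) * exp (- (pi\<^sup>2 * (norm (x - y))\<^sup>2 / 1))))"
    proof (intro sum_mono mult_left_mono)
      fix x y assume "x \<in> X" "y \<in> X"
      then have "(norm (x - y))\<^sup>2 \<le> R\<^sup>2" using R X by (intro power_mono) auto
      then show "c \<le> sqrt (pi / 1) ^ DIM('a) * exp (- (pi\<^sup>2 * (norm (x - y))\<^sup>2 / 1))"
        by (simp add: c_def)
    qed (use m in auto)
    also have "\<dots> = (\<integral>\<xi>. exp (- 1 * (norm \<xi>)\<^sup>2) * (cmod (char_sum X m \<xi>))\<^sup>2 \<partial>lborel)"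
      by (rule char_sum_energy(2)[OF X(1), symmetric]) simp
    also have "\<dots> \<le> (\<integral>\<xi>. exp (- r\<^sup>2 * (norm \<xi>)\<^sup>2) * (cmod (char_sum X m \<xi>))\<^sup>2 \<partial>lborel)"
    proof (intro integral_mono char_sum_energy X mult_right_mono)
      fix \<xi> :: 'a
      have "r\<^sup>2 * (norm \<xi>)\<^sup>2 \<le> 1 * (norm \<xi>)\<^sup>2"
        using r by (intro mult_right_mono) (auto simp: power_le_one)
      then show "exp (- 1 * (norm \<xi>)\<^sup>2) \<le> exp (- r\<^sup>2 * (norm \<xi>)\<^sup>2)" by simp
    qed (use r in auto)
    also have "\<dots> \<le> sqrt (pi / r\<^sup>2) ^ DIM('a) * (C * K * r powr s)"
      by (rule en[rule_format]) (use f C r in auto)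
    also have "sqrt (pi / r\<^sup>2) ^ DIM('a) = sqrt pi ^ DIM('a) * r powr (- real (DIM('a)))"
    proof -
      have e: "sqrt (pi / r\<^sup>2) = sqrt pi / r" using r by (simp add: real_sqrt_divide)
      show ?thesis unfolding e power_divide using r by (simp add: powr_minus powr_realpow divide_inverse)
    qed
    also have "sqrt pi ^ DIM('a) * r powr (- real (DIM('a))) * (C * K * r powr s)
        = sqrt pi ^ DIM('a) * (C * K) * r powr \<delta>"
    proof -
      have "r powr \<delta> = r powr (- real (DIM('a))) * r powr s" by (simp add: \<delta>_def powr_add[symmetric])
      then show ?thesis by (simp only: mult_ac)
    qed
    finally show ?thesis by (simp add: r_def)
  qed
  have "((1/2) ^ n) powr \<delta> = ((1/2::real) powr \<delta>) ^ n" for n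
    by (simp add: powr_realpow[symmetric] powr_powr mult.commute)
  moreover have "(\<lambda>n. ((1/2::real) powr \<delta>) ^ n) \<longlonglongrightarrow> 0"
    using \<delta> powr_less_mono2[of \<delta> "1/2" "1::real"] by (intro LIMSEQ_power_zero) simp
  ultimately have "(\<lambda>n. sqrt pi ^ DIM('a) * (C * K) * ((1/2) ^ n) powr \<delta>) \<longlonglongrightarrow> sqrt pi ^ DIM('a) * (C * K) * 0"
    by (intro tendsto_mult_left) simp
  then have "c \<le> sqrt pi ^ DIM('a) * (C * K) * 0"
    by (rule LIMSEQ_le_const) (use le in auto)
  with c show False by simp
qed

text \<open>With 4^k \<le> t < 4^(k+1) the power is at most 4^(-\<sigma> k), and the last exponent
  is at least -4, which exp 4 pays for. The shift t - 1 anticipates t = 1 + |\<xi>|^2.\<close>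

lemma powr_le_dyadic_exp:
  fixes t \<sigma> :: real
  assumes "1 \<le> t" "0 \<le> \<sigma>"
  shows "\<exists>k::nat. t powr (- \<sigma>) \<le> exp 4 * 4 powr (- \<sigma> * k) * exp (- (4 powr (- real k)) * (t - 1))"
proof
  define k where "k = nat \<lfloor>log 4 t\<rfloor>"
  have "0 \<le> log 4 t" using assms by simp
  then have k: "real k \<le> log 4 t" "log 4 t < real k + 1" unfolding k_def by linarith+
  then have k1: "4 powr k \<le> t" and k2: "t < 4 powr (real k + 1)"
    using assms by (simp_all add: le_log_iff log_less_iff)
  have "t powr (- \<sigma>) \<le> (4 powr k) powr (- \<sigma>)"
    using k1 assms by (intro powr_mono2') auto
  also have "\<dots> = 4 powr (- \<sigma> * k) * 1"
    by (simp add: powr_powr mult.commute)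
  also have "\<dots> \<le> 4 powr (- \<sigma> * k) * (exp 4 * exp (- (4 powr (- real k)) * (t - 1)))"
  proof (rule mult_left_mono)
    have "4 powr (- real k) * (t - 1) \<le> 4 powr (- real k) * 4 powr (real k + 1)"
      using k2 by (intro mult_left_mono) auto
    also have "\<dots> = 4" by (simp add: powr_add[symmetric])
    finally have "0 \<le> 4 + - (4 powr (- real k)) * (t - 1)" by simp
    then show "1 \<le> exp 4 * exp (- (4 powr (- real k)) * (t - 1))"
      unfolding exp_add[symmetric] by simp
  qed simp
  finally show "t powr (- \<sigma>) \<le> exp 4 * 4 powr (- \<sigma> * k) * exp (- (4 powr (- real k)) * (t - 1))"
    by (simp add: mult_ac)
qed

lemma ennreal_le_suminf: "f i \<le> (\<Sum>i. f i :: ennreal)"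
  using sum_le_suminf[of f "{i}"] by simp

text \<open>
  The weights \<open>(1 + |\<xi>|\<^sup>2)\<^sup>-\<^sup>\<sigma>\<close> and \<open>(1 + |r \<xi>|\<^sup>2)\<^sup>-\<^sup>M\<close> are both dominated by dyadic superpositions of
  Gaussians, which reduces the estimate to the Gaussian energies.
\<close>

lemma frostman_sobolev_bound:
  fixes s \<sigma> M :: real
  assumes s: "0 \<le> s" "s \<le> DIM('a::euclidean_space)" and \<sigma>: "(DIM('a) - s) / 2 < \<sigma>" and M: "s / 2 < M"
  shows "\<exists>A>0. \<forall>C r E X m B (H :: 'a \<Rightarrow> complex). frostman_at C s r E X m \<and> 0 \<le> C \<and> 0 < r \<and> 0 \<le> B \<and>
      H \<in> borel_measurable borel \<and>
      (\<forall>\<xi>. (cmod (H \<xi>))\<^sup>2 \<le> (cmod (char_sum X m \<xi>))\<^sup>2 * (B * (1 + (norm (r *\<^sub>R \<xi>))\<^sup>2) powr (- M))) \<longrightarrow>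
      integrable lborel (sobolev_weight (- \<sigma>) H) \<and> (\<integral>\<xi>. sobolev_weight (- \<sigma>) H \<xi> \<partial>lborel) \<le> A * C * B"
proof -
  obtain K where K: "K > 0" and
    en: "\<And>C r E X m \<rho> \<tau>. frostman_at C s r E X (m :: 'a \<Rightarrow> real) \<and> 0 \<le> C \<and> 0 < \<rho> \<and> r \<le> \<rho> \<and> 0 < \<tau> \<and> \<tau> \<le> \<rho>\<^sup>2 \<longrightarrow>
    (\<integral>\<xi>. exp (- \<tau> * (norm \<xi>)\<^sup>2) * (cmod (char_sum X m \<xi>))\<^sup>2 \<partial>lborel) \<le> sqrt (pi / \<tau>) ^ DIM('a) * (C * K * \<rho> powr s)"
    using frostman_energy[OF s(1), where 'a='a] by blast
  \<comment> \<open>The ratios of the two geometric series, below 1 by the strict hypotheses on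
    \<sigma> and M.\<close>
  define a where "a = 4 powr ((DIM('a) - s) / 2 - \<sigma>)"
  define b where "b = 4 powr (s / 2 - M)"
  have a: "0 < a" "a < 1" and b: "0 < b" "b < 1"
    using \<sigma> M by (simp_all add: a_def b_def powr_less_one)
  define Q where "Q = exp 8 * sqrt pi ^ DIM('a) * K"
  have Q: "Q > 0" using K by (simp add: Q_def)
  have "0 \<le> (DIM('a) - s) / 2" "0 \<le> s / 2" using s by simp_all
  then have \<sigma>0: "0 \<le> \<sigma>" and M0: "0 \<le> M"
    using order_trans[OF _ less_imp_le[OF \<sigma>]] order_trans[OF _ less_imp_le[OF M]] by blast+
  define A where "A = Q * (1 / (1 - a)) * (1 / (1 - b))"
  show ?thesis
  proof (intro exI[of _ A] conjI impI allI)
    show "0 < A" using Q a b by (simp add: A_def)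
    fix C r E X m B and H :: "'a \<Rightarrow> complex"
    assume *: "frostman_at C s r E X m \<and> 0 \<le> C \<and> 0 < r \<and> 0 \<le> B \<and>
      H \<in> borel_measurable borel \<and>
      (\<forall>\<xi>. (cmod (H \<xi>))\<^sup>2 \<le> (cmod (char_sum X m \<xi>))\<^sup>2 * (B * (1 + (norm (r *\<^sub>R \<xi>))\<^sup>2) powr (- M)))"
    then have X: "finite X" and C: "0 \<le> C" and r: "0 < r" and B: "0 \<le> B" and [measurable]: "H \<in> borel_measurable borel"
      and H: "\<And>\<xi>. (cmod (H \<xi>))\<^sup>2 \<le> (cmod (char_sum X m \<xi>))\<^sup>2 * (B * (1 + (norm (r *\<^sub>R \<xi>))\<^sup>2) powr (- M))"
      by (auto simp: frostman_at_def)
    \<comment> \<open>The exponent in the product of the k-th Gaussian for the first weight and the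
      j-th for the second.\<close>
    define \<tau> where "\<tau> k j = 4 powr (- real k) + 4 powr (- real j) * r\<^sup>2" for k j :: nat
    have \<tau>: "0 < \<tau> k j" "4 powr (- real k) \<le> \<tau> k j" "r\<^sup>2 \<le> 4 powr j * \<tau> k j" for k j
    proof -
      show "0 < \<tau> k j" "4 powr (- real k) \<le> \<tau> k j" by (auto simp: \<tau>_def add_pos_nonneg)
      have "r\<^sup>2 = 4 powr j * (4 powr (- real j) * r\<^sup>2)" by (simp add: mult.assoc[symmetric] powr_add[symmetric])
      also have "\<dots> \<le> 4 powr j * \<tau> k j" unfolding \<tau>_def by (intro mult_left_mono) auto
      finally show "r\<^sup>2 \<le> 4 powr j * \<tau> k j" .
    qed
    define c where "c k j = exp 8 * B * 4 powr (- \<sigma> * k) * 4 powr (- M * j)" for k j :: nat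
    have c: "0 \<le> c k j" for k j using B by (simp add: c_def)
    define u where "u k j \<xi> = c k j * (exp (- \<tau> k j * (norm \<xi>)\<^sup>2) * (cmod (char_sum X m \<xi>))\<^sup>2)" for k j \<xi>
    have u0: "0 \<le> u k j \<xi>" for k j \<xi> using c by (simp add: u_def)
    have uint: "integrable lborel (u k j)" for k j
      unfolding u_def by (intro integrable_mult_right char_sum_energy X \<tau>)
    have [measurable]: "u k j \<in> borel_measurable borel" for k j
      using borel_measurable_integrable[OF uint] by simp
    have uI: "(\<integral>\<xi>. u k j \<xi> \<partial>lborel) \<le> B * C * Q * a ^ k * b ^ j" for k j
    proof -
      \<comment> \<open>\<tau> may come close to r^2 / 4^j, where the Frostman condition says
        nothing about width sqrt \<tau>; the factor 2^j lifts the width to at least r. The loss 4^(j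
        s / 2) is absorbed by 4^(-M j), since M > s / 2.\<close>
      define \<rho> where "\<rho> = 2 powr j * sqrt (\<tau> k j)"
      have \<rho>: "0 < \<rho>" using \<tau>(1) by (simp add: \<rho>_def)
      have \<rho>2: "\<rho>\<^sup>2 = 4 powr j * \<tau> k j"
        using \<tau>(1)[of k j] by (simp add: \<rho>_def power_mult_distrib powr_realpow power2_eq_square[of "2 ^ j"] power_mult_distrib[symmetric])
      have "r \<le> \<rho>" using \<tau>(3)[where k=k and j=j] \<rho>2 \<rho> by (metis less_imp_le power2_le_imp_le)
      moreover have "\<tau> k j \<le> \<rho>\<^sup>2"
        using mult_right_mono[of 1 "4 powr j" "\<tau> k j"] \<tau>(1)[of k j] \<rho>2 by (simp add: ge_one_powr_ge_zero)
      ultimately have "(\<integral>\<xi>. exp (- \<tau> k j * (norm \<xi>)\<^sup>2) * (cmod (char_sum X m \<xi>))\<^sup>2 \<partial>lborel)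
          \<le> sqrt (pi / \<tau> k j) ^ DIM('a) * (C * K * \<rho> powr s)"
        by (intro en[rule_format]) (use * \<rho> \<tau>(1) in auto)
      also have "sqrt (pi / \<tau> k j) ^ DIM('a) = sqrt pi ^ DIM('a) * \<tau> k j powr (- (real (DIM('a)) / 2))"
      proof -
        have "\<tau> k j powr (- (1 / 2)) = 1 / sqrt (\<tau> k j)"
          using \<tau>(1)[of k j] by (simp add: powr_minus_divide powr_half_sqrt)
        then have "sqrt (pi / \<tau> k j) = sqrt pi * \<tau> k j powr (- (1 / 2))"
          by (simp add: real_sqrt_divide)
        then have "sqrt (pi / \<tau> k j) ^ DIM('a) = sqrt pi ^ DIM('a) * (\<tau> k j powr (- (1 / 2))) ^ DIM('a)"
          by (simp only: power_mult_distrib)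
        also have "(\<tau> k j powr (- (1 / 2))) ^ DIM('a) = (\<tau> k j powr (- (1 / 2))) powr DIM('a)"
          using \<tau>(1)[of k j] by (intro powr_realpow[symmetric]) simp
        also have "\<dots> = \<tau> k j powr (- (real (DIM('a)) / 2))"
          by (simp add: powr_powr)
        finally show ?thesis .
      qed
      also have "\<rho> powr s = 4 powr (j * s / 2) * \<tau> k j powr (s / 2)"
      proof -
        have "\<rho>\<^sup>2 = \<rho> powr 2" using \<rho> by simp
        then have "(\<rho>\<^sup>2) powr (s / 2) = \<rho> powr (2 * (s / 2))" by (simp only: powr_powr)
        moreover have "(\<rho>\<^sup>2) powr (s / 2) = (4 powr j) powr (s / 2) * \<tau> k j powr (s / 2)"
          using \<tau>(1)[of k j] by (simp only: \<rho>2 powr_mult)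
        moreover have "(4 powr j) powr (s / 2) = 4 powr (j * s / 2)"
          by (simp add: powr_powr)
        ultimately show ?thesis by simp
      qed
      also have "sqrt pi ^ DIM('a) * \<tau> k j powr (- (real (DIM('a)) / 2)) * (C * K * (4 powr (j * s / 2) * \<tau> k j powr (s / 2)))
          = sqrt pi ^ DIM('a) * K * C * 4 powr (j * s / 2) * \<tau> k j powr (- ((DIM('a) - s) / 2))"
      proof -
        have "\<tau> k j powr (- ((DIM('a) - s) / 2)) = \<tau> k j powr (- (real (DIM('a)) / 2)) * \<tau> k j powr (s / 2)"
          unfolding powr_add[symmetric] by (rule arg_cong[where f="(powr) _"]) (simp add: field_simps)
        then show ?thesis by (simp only: mult_ac)
      qed
      \<comment> \<open>As s \<le> d the exponent of \<tau> is not positive, so the lower bound 4^-k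
        for \<tau> bounds the power from above.\<close>
      also have "\<dots> \<le> sqrt pi ^ DIM('a) * K * C * 4 powr (j * s / 2) * (4 powr (- real k)) powr (- ((DIM('a) - s) / 2))"
        using s K C \<tau>(2)[of k j] by (intro mult_left_mono powr_mono2') auto
      finally have "(\<integral>\<xi>. u k j \<xi> \<partial>lborel) \<le> c k j * (sqrt pi ^ DIM('a) * K * C * 4 powr (j * s / 2) * (4 powr (- real k)) powr (- ((DIM('a) - s) / 2)))"
        unfolding u_def using c by (simp add: mult_left_mono)
      also have "\<dots> = B * C * Q * (4 powr (- \<sigma> * k) * (4 powr (- real k)) powr (- ((DIM('a) - s) / 2))) * (4 powr (- M * j) * 4 powr (j * s / 2))"
        by (simp add: c_def Q_def mult_ac)
      also have "4 powr (- \<sigma> * k) * (4 powr (- real k)) powr (- ((DIM('a) - s) / 2)) = a ^ k"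
      proof -
        have "a ^ k = a powr k" using a(1) by (simp add: powr_realpow)
        also have "\<dots> = 4 powr (- \<sigma> * k + (- real k) * (- ((DIM('a) - s) / 2)))"
          unfolding a_def powr_powr by (rule arg_cong[where f="(powr) 4"]) (simp add: field_simps)
        finally show ?thesis by (simp only: powr_add powr_powr)
      qed
      also have "4 powr (- M * j) * 4 powr (j * s / 2) = b ^ j"
      proof -
        have "b ^ j = b powr j" using b(1) by (simp add: powr_realpow)
        also have "\<dots> = 4 powr (- M * j + j * s / 2)"
          unfolding b_def powr_powr by (rule arg_cong[where f="(powr) 4"]) (simp add: algebra_simps)
        finally show ?thesis by (simp only: powr_add)
      qed
      finally show ?thesis .
    qed
    have pt: "ennreal (sobolev_weight (- \<sigma>) H \<xi>) \<le> (\<Sum>k. \<Sum>j. ennreal (u k j \<xi>))" for \<xi>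
    proof -
      obtain k :: nat where k: "(1 + (norm \<xi>)\<^sup>2) powr (- \<sigma>) \<le> exp 4 * 4 powr (- \<sigma> * k) * exp (- (4 powr (- real k)) * ((1 + (norm \<xi>)\<^sup>2) - 1))"
        using powr_le_dyadic_exp[of "1 + (norm \<xi>)\<^sup>2" \<sigma>] \<sigma>0 by auto
      obtain j :: nat where j: "(1 + (norm (r *\<^sub>R \<xi>))\<^sup>2) powr (- M) \<le> exp 4 * 4 powr (- M * j) * exp (- (4 powr (- real j)) * ((1 + (norm (r *\<^sub>R \<xi>))\<^sup>2) - 1))"
        using powr_le_dyadic_exp[of "1 + (norm (r *\<^sub>R \<xi>))\<^sup>2" M] M0 by auto
      have "sobolev_weight (- \<sigma>) H \<xi> \<le> (1 + (norm \<xi>)\<^sup>2) powr (- \<sigma>) * ((cmod (char_sum X m \<xi>))\<^sup>2 * (B * (1 + (norm (r *\<^sub>R \<xi>))\<^sup>2) powr (- M)))"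
        unfolding sobolev_weight_def by (intro mult_left_mono H) auto
      also have "\<dots> \<le> (exp 4 * 4 powr (- \<sigma> * k) * exp (- (4 powr (- real k)) * ((1 + (norm \<xi>)\<^sup>2) - 1)))
          * ((cmod (char_sum X m \<xi>))\<^sup>2 * (B * (exp 4 * 4 powr (- M * j) * exp (- (4 powr (- real j)) * ((1 + (norm (r *\<^sub>R \<xi>))\<^sup>2) - 1)))))"
        using B by (intro mult_mono k j mult_left_mono) auto
      also have "\<dots> = u k j \<xi>"
      proof -
        have e1: "exp (- (4 powr (- real k)) * ((1 + (norm \<xi>)\<^sup>2) - 1)) * exp (- (4 powr (- real j)) * ((1 + (norm (r *\<^sub>R \<xi>))\<^sup>2) - 1))
            = exp (- \<tau> k j * (norm \<xi>)\<^sup>2)"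
          unfolding exp_add[symmetric] by (simp add: \<tau>_def power_mult_distrib algebra_simps)
        have e2: "exp 4 * exp 4 = (exp 8 :: real)" unfolding exp_add[symmetric] by simp
        show ?thesis
          unfolding u_def c_def e1[symmetric] e2[symmetric] by (simp only: mult_ac)
      qed
      finally have "ennreal (sobolev_weight (- \<sigma>) H \<xi>) \<le> ennreal (u k j \<xi>)" by (rule ennreal_leI)
      also have "\<dots> \<le> (\<Sum>j. ennreal (u k j \<xi>))" by (rule ennreal_le_suminf)
      also have "\<dots> \<le> (\<Sum>k. \<Sum>j. ennreal (u k j \<xi>))" by (rule ennreal_le_suminf)
      finally show ?thesis .
    qed
    have "(\<integral>\<^sup>+\<xi>. ennreal (sobolev_weight (- \<sigma>) H \<xi>) \<partial>lborel) \<le> (\<integral>\<^sup>+\<xi>. (\<Sum>k. \<Sum>j. ennreal (u k j \<xi>)) \<partial>lborel)"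
      by (intro nn_integral_mono pt)
    also have "\<dots> = (\<Sum>k. \<Sum>j. \<integral>\<^sup>+\<xi>. ennreal (u k j \<xi>) \<partial>lborel)"
      by (simp add: nn_integral_suminf)
    also have "\<dots> \<le> (\<Sum>k. \<Sum>j. ennreal (B * C * Q * a ^ k * b ^ j))"
      using uI by (intro suminf_le summableI) (simp add: nn_integral_eq_integral[OF uint] u0 ennreal_leI)
    also have "\<dots> = (\<Sum>k. ennreal (B * C * Q * a ^ k * (1 / (1 - b))))"
    proof -
      have "(\<Sum>j. ennreal (B * C * Q * a ^ k * b ^ j)) = ennreal (B * C * Q * a ^ k * (1 / (1 - b)))" for k
        using B C Q a b by (intro suminf_ennreal_eq sums_mult geometric_sums) auto
      then show ?thesis by simp
    qed
    also have "\<dots> = ennreal (B * C * Q * (1 / (1 - a)) * (1 / (1 - b)))"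
      using B C Q a b by (intro suminf_ennreal_eq sums_mult sums_mult2 geometric_sums) auto
    finally have nn: "(\<integral>\<^sup>+\<xi>. ennreal (sobolev_weight (- \<sigma>) H \<xi>) \<partial>lborel) \<le> ennreal (A * C * B)"
      by (simp add: A_def mult_ac)
    have sw0: "0 \<le> sobolev_weight (- \<sigma>) H \<xi>" for \<xi> by (simp add: sobolev_weight_def)
    have [measurable]: "sobolev_weight (- \<sigma>) H \<in> borel_measurable lborel"
      unfolding sobolev_weight_def by measurable
    show int: "integrable lborel (sobolev_weight (- \<sigma>) H)"
      using nn sw0 by (intro integrableI_nonneg) (auto intro: le_less_trans)
    show "(\<integral>\<xi>. sobolev_weight (- \<sigma>) H \<xi> \<partial>lborel) \<le> A * C * B"
      using nn nn_integral_eq_integral[OF int] sw0 \<open>0 < A\<close> C B by simp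
  qed
qed

section \<open>Sobolev norms and pairings\<close>

definition box_bump :: "nat \<Rightarrow> 'a \<Rightarrow> 'a \<Rightarrow> 'a::euclidean_space \<Rightarrow> real" where
  "box_bump n a c x = (\<Prod>b\<in>Basis. bump1 (real n * (x \<bullet> b) + - (n * (a \<bullet> b))) * bump1 (- real n * (x \<bullet> b) + n * (c \<bullet> b)))"

lemma smooth_box_bump: "smooth (box_bump n a c)"
  unfolding box_bump_def[abs_def] by (intro smooth_prod smooth_mult smooth_bump1 smooth_inner_affine)

lemma bump1_bounds: "0 \<le> bump1 x" "bump1 x \<le> 1"
  by (auto simp: bump1_eq)

lemma box_bump_bounds: "0 \<le> box_bump n a c x" "box_bump n a c x \<le> 1"
  unfolding box_bump_def
  by (auto intro!: prod_nonneg prod_le_1 mult_nonneg_nonneg mult_le_one simp: bump1_bounds)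

text \<open>For t > 0 the value is exp (-1/(n t)), so rescaling flattens the bump to 1. Products of
  such bumps are smooth approximations of the indicator of an open box.\<close>

lemma bump1_tendsto: "(\<lambda>n. bump1 (real n * t)) \<longlonglongrightarrow> (if 0 < t then 1 else 0)"
proof (cases "0 < t")
  case True
  have "(\<lambda>n. exp (- (inverse (real n) * inverse t))) \<longlonglongrightarrow> exp (- (0 * inverse t))"
    by (intro tendsto_intros lim_inverse_n)
  moreover have "\<forall>\<^sub>F n in sequentially. exp (- (inverse (real n) * inverse t)) = bump1 (real n * t)"
    using eventually_gt_at_top[of 0] by eventually_elim (use True in \<open>simp add: bump1_eq\<close>)
  ultimately have "(\<lambda>n. bump1 (real n * t)) \<longlonglongrightarrow> exp (- (0 * inverse t))"
    by (rule Lim_transform_eventually)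
  then show ?thesis using True by simp
next
  case False
  then have "bump1 (real n * t) = 0" for n
    by (auto simp: bump1_eq not_less zero_less_mult_iff)
  with False show ?thesis by simp
qed

lemma box_bump_tendsto: "(\<lambda>n. box_bump n a c x) \<longlonglongrightarrow> indicat_real (box a c) x"
proof -
  have "(\<lambda>n. bump1 (real n * (x \<bullet> b - a \<bullet> b)) * bump1 (real n * (c \<bullet> b - x \<bullet> b)))
      \<longlonglongrightarrow> (if 0 < x \<bullet> b - a \<bullet> b then 1 else 0) * (if 0 < c \<bullet> b - x \<bullet> b then 1 else 0)" for b
    by (intro tendsto_mult bump1_tendsto)
  then have "(\<lambda>n. \<Prod>b\<in>Basis. bump1 (real n * (x \<bullet> b - a \<bullet> b)) * bump1 (real n * (c \<bullet> b - x \<bullet> b)))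
      \<longlonglongrightarrow> (\<Prod>b\<in>Basis. (if 0 < x \<bullet> b - a \<bullet> b then 1 else 0) * (if 0 < c \<bullet> b - x \<bullet> b then 1 else 0))"
    by (intro tendsto_prod)
  moreover have "(\<Prod>b\<in>Basis. (if 0 < x \<bullet> b - a \<bullet> b then 1 else 0) * (if 0 < c \<bullet> b - x \<bullet> b then 1 else 0)) = indicat_real (box a c) x"
  proof (cases "x \<in> box a c")
    case True
    then show ?thesis by (auto simp: mem_box intro!: prod.neutral)
  next
    case False
    then obtain b where "b \<in> Basis" "\<not> (a \<bullet> b < x \<bullet> b \<and> x \<bullet> b < c \<bullet> b)" by (auto simp: mem_box)
    then show ?thesis using False by (auto intro!: prod_zero)
  qed
  ultimately show ?thesis by (simp add: box_bump_def algebra_simps)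
qed

lemma box_bump_support: "box_bump n a c x \<noteq> 0 \<Longrightarrow> x \<in> cbox a c"
proof -
  assume nz: "box_bump n a c x \<noteq> 0"
  have "a \<bullet> b \<le> x \<bullet> b \<and> x \<bullet> b \<le> c \<bullet> b" if b: "b \<in> Basis" for b
  proof -
    have "bump1 (real n * (x \<bullet> b) + - (n * (a \<bullet> b))) * bump1 (- real n * (x \<bullet> b) + n * (c \<bullet> b)) \<noteq> 0"
      using nz b unfolding box_bump_def by (metis (no_types, lifting) finite_Basis prod_zero)
    then have "0 < real n * (x \<bullet> b - a \<bullet> b)" "0 < real n * (c \<bullet> b - x \<bullet> b)"
      by (auto simp: bump1_eq algebra_simps split: if_splits)
    then show ?thesis by (auto simp: zero_less_mult_iff)
  qed
  then show "x \<in> cbox a c" by (simp add: mem_box)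
qed

lemma test_functionsI:
  assumes "smooth f" "compact K" "\<And>x. f x \<noteq> 0 \<Longrightarrow> x \<in> K"
  shows "f \<in> test_functions"
proof -
  have "closure {x. f x \<noteq> 0} \<subseteq> K"
    using assms by (intro closure_minimal compact_imp_closed) auto
  then have "compact (closure {x. f x \<noteq> 0})"
    using compact_Int_closed[OF assms(2) closed_closure] by (metis inf.absorb_iff2)
  with assms(1) show ?thesis by (simp add: test_functions_def compactly_supported_def)
qed

text \<open>Open boxes form a generator stable under intersection, and the sets on which
  \<open>w\<close> integrates to 0 are closed under countable disjoint unions; complements reduce to
  the whole space, a limit of boxes.\<close>

lemma integrable_zero_on_boxes_imp_zero_on_borel:
  fixes w :: "'a::euclidean_space \<Rightarrow> complex"
  assumes w: "integrable lborel w"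
    and box: "\<And>a c. (\<integral>x. indicat_real (box a c) x *\<^sub>R w x \<partial>lborel) = 0"
    and A: "A \<in> sets borel"
  shows "(\<integral>x. indicat_real A x *\<^sub>R w x \<partial>lborel) = 0"
proof -
  have [measurable]: "w \<in> borel_measurable borel" using borel_measurable_integrable[OF w] by simp
  have si: "set_integrable lborel S w" if "S \<in> sets borel" for S
    using that w by (simp add: set_integrable_def integrable_mult_indicator)
  have whole: "(\<integral>x. w x \<partial>lborel) = 0"
  proof -
    have "(\<lambda>n. \<integral>x. indicat_real (box (- real n *\<^sub>R One) (real n *\<^sub>R One)) x *\<^sub>R w x \<partial>lborel) \<longlonglongrightarrow> (\<integral>x. w x \<partial>lborel)"
    proof (rule integral_dominated_convergence)
      show "integrable lborel (\<lambda>x. cmod (w x))" using w by simp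
      show "AE x in lborel. (\<lambda>n. indicat_real (box (- real n *\<^sub>R One) (real n *\<^sub>R One)) x *\<^sub>R w x) \<longlonglongrightarrow> w x"
      proof (intro AE_I2)
        fix x :: 'a
        obtain N :: nat where N: "norm x < real N" using reals_Archimedean2 by blast
        have "\<forall>\<^sub>F n in sequentially. w x = indicat_real (box (- real n *\<^sub>R One) (real n *\<^sub>R One)) x *\<^sub>R w x"
          using eventually_ge_at_top[of N]
        proof eventually_elim
          case (elim n)
          have "x \<in> box (- real n *\<^sub>R One) (real n *\<^sub>R One)"
            unfolding mem_box
          proof
            fix b :: 'a assume "b \<in> Basis"
            then have "\<bar>x \<bullet> b\<bar> < real n" using Basis_le_norm[of b x] N elim by simp
            with \<open>b \<in> Basis\<close> show "(- real n *\<^sub>R One) \<bullet> b < x \<bullet> b \<and> x \<bullet> b < (real n *\<^sub>R One) \<bullet> b"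
              by (auto simp: abs_less_iff)
          qed
          then show ?case by simp
        qed
        then show "(\<lambda>n. indicat_real (box (- real n *\<^sub>R One) (real n *\<^sub>R One)) x *\<^sub>R w x) \<longlonglongrightarrow> w x"
          by (rule Lim_transform_eventually[OF tendsto_const])
      qed
    qed (auto simp: indicator_def)
    then show ?thesis by (simp add: box LIMSEQ_const_iff)
  qed
  have sets: "sets borel = sigma_sets UNIV (range (\<lambda>(a, c). box a c :: 'a set))"
    by (subst borel_eq_box) simp
  have "Int_stable (range (\<lambda>(a, c). box a c :: 'a set))"
    by (auto simp: Int_stable_def box_Int_box)
  moreover have "range (\<lambda>(a, c). box a c :: 'a set) \<subseteq> Pow UNIV" by simp
  ultimately show ?thesis
    using A[unfolded sets]
  proof (induction rule: sigma_sets_induct_disjoint)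
    case (basic A)
    then show ?case using box by auto
  next
    case (compl A)
    then have [measurable]: "A \<in> sets borel" by (simp add: sets)
    have "(\<integral>x. indicat_real (UNIV - A) x *\<^sub>R w x \<partial>lborel) = (\<integral>x. w x - indicat_real A x *\<^sub>R w x \<partial>lborel)"
      by (intro Bochner_Integration.integral_cong) (auto simp: indicator_def)
    also have "\<dots> = 0"
      using w compl whole by (subst Bochner_Integration.integral_diff) (auto intro: integrable_mult_indicator)
    finally show ?case .
  next
    case (union A)
    have "(LINT x:(\<Union>i. A i)|lborel. w x) = (\<Sum>i. (LINT x:(A i)|lborel. w x))"
      using union.hyps by (intro lebesgue_integral_countable_add si)
        (auto simp: sets[symmetric] disjoint_family_on_def intro!: sets.countable_UN)
    then show ?case using union.IH by (simp add: set_lebesgue_integral_def)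
  qed auto
qed

lemma integrable_zero_on_borel_imp_AE_zero:
  fixes w :: "'a::euclidean_space \<Rightarrow> real"
  assumes w: "integrable lborel w"
    and zero: "\<And>A. A \<in> sets borel \<Longrightarrow> (\<integral>x. indicat_real A x * w x \<partial>lborel) = 0"
  shows "AE x in lborel. w x = 0"
proof -
  have [measurable]: "w \<in> borel_measurable borel" using borel_measurable_integrable[OF w] by simp
  have pos: "AE x in lborel. indicat_real {x. 0 < f x} x * f x = 0"
    if f: "integrable lborel f" and [measurable]: "f \<in> borel_measurable borel"
      and "(\<integral>x. indicat_real {x. 0 < f x} x * f x \<partial>lborel) = 0" for f :: "'a \<Rightarrow> real"
  proof -
    have "integrable lborel (\<lambda>x. indicat_real {x. 0 < f x} x *\<^sub>R f x)"
      by (intro integrable_mult_indicator f) measurable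
    then show ?thesis
      using that(3) by (subst integral_nonneg_eq_0_iff_AE[symmetric]) (auto simp: indicator_def)
  qed
  have "AE x in lborel. indicat_real {x. 0 < w x} x * w x = 0"
    by (intro pos w zero) measurable
  moreover have "AE x in lborel. indicat_real {x. 0 < - w x} x * - w x = 0"
  proof (rule pos)
    have "(\<integral>x. indicat_real {x. w x < 0} x * w x \<partial>lborel) = 0" by (intro zero) measurable
    then show "(\<integral>x. indicat_real {x. 0 < - w x} x * - w x \<partial>lborel) = 0" by simp
  qed (use w in auto)
  ultimately show ?thesis
    by eventually_elim (auto simp: indicator_def split: if_splits)
qed

text \<open>
  \<^const>\<open>sobolev_norm\<close> evaluates a representative chosen by \<open>SOME\<close>, so it can be bounded only through
  uniqueness of the representative.
\<close>

lemma has_fourier_unique: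
  fixes u :: "'a::euclidean_space distrib"
  assumes g: "has_fourier u g" and h: "has_fourier u h"
  shows "AE \<xi> in lborel. g \<xi> = h \<xi>"
proof -
  \<comment> \<open>\<open>has_fourier\<close> gives integrability of g and h only against Schwartz
    functions. The Gaussian makes the difference integrable, and as it never vanishes it can be
    cancelled at the end.\<close>
  define G where "G = (\<lambda>x::'a. complex_of_real (exp (- 1 * (norm x)\<^sup>2)))"
  define w where "w = (\<lambda>x. (g x - h x) * G x)"
  have G: "G \<in> schwartz" unfolding G_def by (rule gaussian_schwartz) simp
  have [measurable]: "g \<in> borel_measurable borel" "h \<in> borel_measurable borel"
    using g h by (simp_all add: has_fourier_def)
  have [measurable]: "G \<in> borel_measurable borel" by (rule schwartz_measurable[OF G])
  have int: "integrable lborel (\<lambda>x. (g x - h x) * \<phi> x)" and zero: "(\<integral>x. (g x - h x) * \<phi> x \<partial>lborel) = 0"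
    if "\<phi> \<in> schwartz" for \<phi>
  proof -
    have i: "integrable lborel (\<lambda>x. g x * \<phi> x)" "integrable lborel (\<lambda>x. h x * \<phi> x)"
      and e: "(\<integral>x. g x * \<phi> x \<partial>lborel) = (\<integral>x. h x * \<phi> x \<partial>lborel)"
      using g h that unfolding has_fourier_def by metis+
    show "integrable lborel (\<lambda>x. (g x - h x) * \<phi> x)" using i by (simp add: left_diff_distrib)
    show "(\<integral>x. (g x - h x) * \<phi> x \<partial>lborel) = 0" using i e by (simp add: left_diff_distrib)
  qed
  have w: "integrable lborel w" unfolding w_def by (rule int[OF G])
  have box: "(\<integral>x. indicat_real (box a c) x *\<^sub>R w x \<partial>lborel) = 0" for a c
  proof -
    have "(\<integral>x. box_bump n a c x *\<^sub>R w x \<partial>lborel) = 0" for n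
    proof -
      have "(\<lambda>x. complex_of_real (box_bump n a c x) * G x) \<in> test_functions"
      proof (rule test_functionsI)
        show "smooth (\<lambda>x. complex_of_real (box_bump n a c x) * G x)"
          using G by (intro smooth_mult smooth_of_real smooth_box_bump) (simp add: schwartz_def)
        show "x \<in> cbox a c" if "complex_of_real (box_bump n a c x) * G x \<noteq> 0" for x
          using that by (intro box_bump_support[of n]) auto
      qed (rule compact_cbox)
      then have "(\<lambda>x. complex_of_real (box_bump n a c x) * G x) \<in> schwartz"
        using test_functions_subset_schwartz by blast
      from zero[OF this] show ?thesis by (simp add: w_def scaleR_conv_of_real mult_ac)
    qed
    moreover have "(\<lambda>n. \<integral>x. box_bump n a c x *\<^sub>R w x \<partial>lborel) \<longlonglongrightarrow> (\<integral>x. indicat_real (box a c) x *\<^sub>R w x \<partial>lborel)"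
    proof (rule integral_dominated_convergence)
      have [measurable]: "box_bump n a c \<in> borel_measurable borel" for n
        by (intro borel_measurable_continuous_onI smooth_continuous_on smooth_box_bump)
      show "(\<lambda>x. box_bump n a c x *\<^sub>R w x) \<in> borel_measurable lborel" for n
        unfolding w_def by measurable
      show "(\<lambda>x. indicat_real (box a c) x *\<^sub>R w x) \<in> borel_measurable lborel"
        unfolding w_def by measurable
      show "integrable lborel (\<lambda>x. cmod (w x))" using w by simp
      show "AE x in lborel. (\<lambda>n. box_bump n a c x *\<^sub>R w x) \<longlonglongrightarrow> indicat_real (box a c) x *\<^sub>R w x"
        by (intro AE_I2 tendsto_scaleR box_bump_tendsto tendsto_const)
      show "AE x in lborel. norm (box_bump n a c x *\<^sub>R w x) \<le> cmod (w x)" for n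
        by (intro AE_I2) (simp add: box_bump_bounds mult_left_le_one_le)
    qed
    ultimately show ?thesis by (simp add: LIMSEQ_const_iff)
  qed
  have A: "(\<integral>x. indicat_real A x *\<^sub>R w x \<partial>lborel) = 0" if "A \<in> sets borel" for A
    by (rule integrable_zero_on_boxes_imp_zero_on_borel[OF w box that])
  have iA: "integrable lborel (\<lambda>x. indicat_real A x *\<^sub>R w x)" if "A \<in> sets borel" for A
    using that w by (intro integrable_mult_indicator) auto
  have "AE x in lborel. Re (w x) = 0"
  proof (rule integrable_zero_on_borel_imp_AE_zero)
    show "(\<integral>x. indicat_real A x * Re (w x) \<partial>lborel) = 0" if "A \<in> sets borel" for A
      using A[OF that] integral_Re[OF iA[OF that]] by simp
  qed (use w in auto)
  moreover have "AE x in lborel. Im (w x) = 0"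
  proof (rule integrable_zero_on_borel_imp_AE_zero)
    show "(\<integral>x. indicat_real A x * Im (w x) \<partial>lborel) = 0" if "A \<in> sets borel" for A
      using A[OF that] integral_Im[OF iA[OF that]] by simp
  qed (use w in auto)
  ultimately show ?thesis
  proof eventually_elim
    case (elim x)
    then have "w x = 0" by (simp add: complex_eq_iff)
    then show ?case by (simp add: w_def G_def)
  qed
qed

lemma sobolev_norm_eq:
  assumes "has_fourier u g"
  shows "sobolev_norm s u = sqrt (\<integral>\<xi>. sobolev_weight s g \<xi> \<partial>lborel)"
proof -
  define h where "h = (SOME g. has_fourier u g)"
  have h: "has_fourier u h" unfolding h_def using someI[of "has_fourier u" g, OF assms] .
  have [measurable]: "g \<in> borel_measurable borel" "h \<in> borel_measurable borel"
    using assms h by (simp_all add: has_fourier_def)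
  have "(\<integral>\<xi>. sobolev_weight s h \<xi> \<partial>lborel) = (\<integral>\<xi>. sobolev_weight s g \<xi> \<partial>lborel)"
  proof (rule integral_cong_AE)
    show "AE \<xi> in lborel. sobolev_weight s h \<xi> = sobolev_weight s g \<xi>"
      using has_fourier_unique[OF h assms] by eventually_elim (simp add: sobolev_weight_def)
  qed (simp_all add: sobolev_weight_def)
  then show ?thesis by (simp add: sobolev_norm_def h_def[symmetric] Let_def)
qed

section \<open>Test functions as distributions, and duality of Sobolev spaces\<close>

lemma has_fourier_distrib_of:
  assumes f: "f \<in> test_functions"
  shows "has_fourier (distrib_of f) (fourier f)"
proof -
  have fs: "f \<in> schwartz" using f test_functions_subset_schwartz by blast
  have ff: "fourier f \<in> schwartz" by (rule fourier_schwartz[OF fs])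
  have "integrable lborel (\<lambda>\<xi>. fourier f \<xi> * \<phi> \<xi>)" if "\<phi> \<in> schwartz" for \<phi>
  proof -
    have "integrable lborel (\<lambda>\<xi>. (\<integral>x. cmod (f x) \<partial>lborel) * cmod (\<phi> \<xi>))"
      by (intro integrable_mult_right integrable_norm schwartz_integrable that)
    then show ?thesis
    proof (rule Bochner_Integration.integrable_bound)
      show "AE \<xi> in lborel. norm (fourier f \<xi> * \<phi> \<xi>) \<le> norm ((\<integral>x. cmod (f x) \<partial>lborel) * cmod (\<phi> \<xi>))"
        using fourier_bound[OF schwartz_integrable[OF fs]]
        by (intro AE_I2) (simp add: norm_mult mult_right_mono)
    qed (use schwartz_measurable[OF ff] schwartz_measurable[OF that] in measurable)
  qed
  then show ?thesis
    unfolding has_fourier_def distrib_of_def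
    using schwartz_measurable[OF ff] fourier_multiplication[OF schwartz_integrable[OF fs] schwartz_integrable]
    by (auto simp: fourier_schwartz)
qed

lemma sobolev_weight_schwartz_integrable:
  assumes f: "f \<in> schwartz"
  shows "integrable lborel (sobolev_weight s f)"
proof -
  obtain M :: nat where M: "s \<le> real M" using real_arch_simple by blast
  obtain C where C: "\<And>x. (1 + norm x) ^ (2 * M) * cmod (f x) \<le> C"
    using schwartz_bound[OF f] by blast
  have "sobolev_weight s f x \<le> C * cmod (f x)" for x
  proof -
    have "(1 + (norm x)\<^sup>2) powr s \<le> (1 + (norm x)\<^sup>2) powr (real M)"
      using M by (intro powr_mono) auto
    also have "\<dots> = (1 + (norm x)\<^sup>2) ^ M" by (intro powr_realpow) (simp add: add_pos_nonneg)
    also have "\<dots> \<le> ((1 + norm x)\<^sup>2) ^ M"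
      by (intro power_mono) (auto simp: power2_sum)
    finally have "(1 + (norm x)\<^sup>2) powr s \<le> (1 + norm x) ^ (2 * M)" by (simp add: power_mult)
    then have "sobolev_weight s f x \<le> (1 + norm x) ^ (2 * M) * (cmod (f x))\<^sup>2"
      unfolding sobolev_weight_def by (rule mult_right_mono) simp
    also have "\<dots> = ((1 + norm x) ^ (2 * M) * cmod (f x)) * cmod (f x)"
      by (simp add: power2_eq_square)
    also have "\<dots> \<le> C * cmod (f x)" by (intro mult_right_mono C) simp
    finally show ?thesis .
  qed
  moreover have "0 \<le> sobolev_weight s f x" for x by (simp add: sobolev_weight_def)
  moreover have "sobolev_weight s f \<in> borel_measurable lborel"
    unfolding sobolev_weight_def using schwartz_measurable[OF f] by measurable
  moreover have "integrable lborel (\<lambda>x. C * cmod (f x))"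
    by (intro integrable_mult_right integrable_norm schwartz_integrable f)
  ultimately show ?thesis
    by (metis (no_types, lifting) AE_I2 Bochner_Integration.integrable_bound abs_ge_self abs_of_nonneg
        order_trans real_norm_def)
qed

lemma Cauchy_Schwarz_integral_sqrt:
  fixes f g :: "'a \<Rightarrow> real"
  assumes f: "integrable M (\<lambda>x. (f x)\<^sup>2)" and g: "integrable M (\<lambda>x. (g x)\<^sup>2)"
    and [measurable]: "f \<in> borel_measurable M" "g \<in> borel_measurable M"
    and nn: "\<And>x. 0 \<le> f x" "\<And>x. 0 \<le> g x"
  shows "(\<integral>x. f x * g x \<partial>M) \<le> sqrt (\<integral>x. (f x)\<^sup>2 \<partial>M) * sqrt (\<integral>x. (g x)\<^sup>2 \<partial>M)"
proof -
  let ?I = "\<integral>\<^sup>+x. ennreal (f x) * ennreal (g x) \<partial>M"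
  have "?I\<^sup>2 \<le> (\<integral>\<^sup>+x. (ennreal (f x))\<^sup>2 \<partial>M) * (\<integral>\<^sup>+x. (ennreal (g x))\<^sup>2 \<partial>M)"
    by (rule Cauchy_Schwarz_nn_integral) auto
  also have "\<dots> = ennreal ((\<integral>x. (f x)\<^sup>2 \<partial>M) * (\<integral>x. (g x)\<^sup>2 \<partial>M))"
    using nn f g by (simp add: ennreal_power nn_integral_eq_integral ennreal_mult integral_nonneg_AE)
  finally have le: "?I\<^sup>2 \<le> ennreal ((\<integral>x. (f x)\<^sup>2 \<partial>M) * (\<integral>x. (g x)\<^sup>2 \<partial>M))" .
  have eq: "(\<integral>x. f x * g x \<partial>M) = enn2real ?I"
    using nn by (subst integral_eq_nn_integral) (auto simp: ennreal_mult)
  \<comment> \<open>Needed before the return to real integrals, as \<open>enn2real\<close> sends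
    infinity to 0.\<close>
  have fin: "?I < \<top>"
  proof (rule ccontr)
    assume "\<not> ?I < \<top>"
    then have "?I = \<top>" using less_top by blast
    with le show False by (simp add: power2_eq_square top_unique)
  qed
  then have "?I = ennreal (enn2real ?I)" by simp
  with le have "ennreal ((enn2real ?I)\<^sup>2) \<le> ennreal ((\<integral>x. (f x)\<^sup>2 \<partial>M) * (\<integral>x. (g x)\<^sup>2 \<partial>M))"
    by (metis ennreal_power enn2real_nonneg)
  then have "(enn2real ?I)\<^sup>2 \<le> (\<integral>x. (f x)\<^sup>2 \<partial>M) * (\<integral>x. (g x)\<^sup>2 \<partial>M)"
    by (subst (asm) ennreal_le_iff) (auto intro!: mult_nonneg_nonneg)
  then show ?thesis unfolding eq real_sqrt_mult[symmetric] by (rule real_le_rsqrt)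
qed

text \<open>\<open>T f\<close> lies in order r, so it acts on transforms as integration against a
  function g; Cauchy-Schwarz gives the weight of order r to g and that of order -r to \<phi>. The
  test argument is \<open>fourier \<phi>\<close> because this is where \<open>has_fourier\<close>
  evaluates a distribution. The modulus of C is taken because the sign of C is not
  prescribed.\<close>

lemma sobolev_pairing:
  fixes T :: "('a::euclidean_space \<Rightarrow> complex) \<Rightarrow> 'a distrib"
  assumes T: "sobolev_bounded s r C T" and f: "f \<in> test_functions" and \<phi>: "\<phi> \<in> schwartz"
  shows "cmod (T f (fourier \<phi>)) \<le> \<bar>C\<bar> * sqrt (\<integral>\<xi>. sobolev_weight s (fourier f) \<xi> \<partial>lborel)
    * sqrt (\<integral>\<xi>. sobolev_weight (- r) \<phi> \<xi> \<partial>lborel)"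
proof -
  have fs: "f \<in> schwartz" using f test_functions_subset_schwartz by blast
  obtain S where S: "\<And>f. f \<in> test_functions \<Longrightarrow> S (distrib_of f) = T f"
    and Sb: "\<And>u. u \<in> sobolev_space s \<Longrightarrow> S u \<in> sobolev_space r \<and> sobolev_norm r (S u) \<le> C * sobolev_norm s u"
    using T unfolding sobolev_bounded_def by blast
  have hf: "has_fourier (distrib_of f) (fourier f)" by (rule has_fourier_distrib_of[OF f])
  have "distrib_of f \<in> sobolev_space s"
    unfolding sobolev_space_def using hf sobolev_weight_schwartz_integrable[OF fourier_schwartz[OF fs]] by blast
  from Sb[OF this] have sp: "T f \<in> sobolev_space r" and nm: "sobolev_norm r (T f) \<le> C * sobolev_norm s (distrib_of f)"
    by (simp_all add: S[OF f])
  from sp obtain g where g: "has_fourier (T f) g" and gi: "integrable lborel (sobolev_weight r g)"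
    unfolding sobolev_space_def by blast
  have [measurable]: "g \<in> borel_measurable borel" "\<phi> \<in> borel_measurable borel"
    using g schwartz_measurable[OF \<phi>] by (simp_all add: has_fourier_def)
  define p where "p \<xi> = (1 + (norm \<xi>)\<^sup>2) powr (r / 2) * cmod (g \<xi>)" for \<xi>
  define q where "q \<xi> = (1 + (norm \<xi>)\<^sup>2) powr (- r / 2) * cmod (\<phi> \<xi>)" for \<xi>
  have pos: "0 < 1 + (norm \<xi>)\<^sup>2" for \<xi> :: 'a by (simp add: add_pos_nonneg)
  have sq: "(y powr (z / 2))\<^sup>2 = y powr z" if "0 < y" for y z :: real
    using that by (simp add: power2_eq_square powr_add[symmetric])
  have p: "(\<lambda>\<xi>. (p \<xi>)\<^sup>2) = sobolev_weight r g"
    by (auto simp: p_def sobolev_weight_def power_mult_distrib sq[OF pos])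
  have q: "(\<lambda>\<xi>. (q \<xi>)\<^sup>2) = sobolev_weight (- r) \<phi>"
    by (intro ext) (simp only: q_def sobolev_weight_def power_mult_distrib sq[OF pos])
  have pq: "p \<xi> * q \<xi> = cmod (g \<xi> * \<phi> \<xi>)" for \<xi>
  proof -
    have "(1 + (norm \<xi>)\<^sup>2) powr (r / 2) * (1 + (norm \<xi>)\<^sup>2) powr (- r / 2) = 1"
      using pos[of \<xi>] unfolding powr_add[symmetric] by simp
    then show ?thesis unfolding p_def q_def by (simp add: norm_mult algebra_simps)
  qed
  have "T f (fourier \<phi>) = (\<integral>\<xi>. g \<xi> * \<phi> \<xi> \<partial>lborel)"
    using g \<phi> unfolding has_fourier_def by blast
  then have "cmod (T f (fourier \<phi>)) \<le> (\<integral>\<xi>. cmod (g \<xi> * \<phi> \<xi>) \<partial>lborel)"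
    by (simp only: integral_norm_bound)
  also have "\<dots> = (\<integral>\<xi>. p \<xi> * q \<xi> \<partial>lborel)" by (simp only: pq)
  also have "\<dots> \<le> sqrt (\<integral>\<xi>. (p \<xi>)\<^sup>2 \<partial>lborel) * sqrt (\<integral>\<xi>. (q \<xi>)\<^sup>2 \<partial>lborel)"
  proof (rule Cauchy_Schwarz_integral_sqrt)
    show "integrable lborel (\<lambda>\<xi>. (p \<xi>)\<^sup>2)" unfolding p by (rule gi)
    show "integrable lborel (\<lambda>\<xi>. (q \<xi>)\<^sup>2)" unfolding q by (rule sobolev_weight_schwartz_integrable[OF \<phi>])
    show "p \<in> borel_measurable lborel" unfolding p_def by measurable
    show "q \<in> borel_measurable lborel" unfolding q_def by measurable
  qed (simp_all add: p_def q_def)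
  also have "sqrt (\<integral>\<xi>. (p \<xi>)\<^sup>2 \<partial>lborel) = sobolev_norm r (T f)"
    unfolding p by (rule sobolev_norm_eq[OF g, symmetric])
  also have "sobolev_norm r (T f) * sqrt (\<integral>\<xi>. (q \<xi>)\<^sup>2 \<partial>lborel)
      \<le> (\<bar>C\<bar> * sobolev_norm s (distrib_of f)) * sqrt (\<integral>\<xi>. (q \<xi>)\<^sup>2 \<partial>lborel)"
  proof (rule mult_right_mono)
    have "0 \<le> sobolev_norm s (distrib_of f)"
      unfolding sobolev_norm_eq[OF hf] by (simp add: sobolev_weight_def)
    then show "sobolev_norm r (T f) \<le> \<bar>C\<bar> * sobolev_norm s (distrib_of f)"
      using nm mult_right_mono[OF abs_ge_self[of C]] order_trans by blast
  qed simp
  finally show ?thesis unfolding q sobolev_norm_eq[OF hf] .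
qed

section \<open>Compactness\<close>

lemma cmod_diff_squared_le: "(cmod (a - b))\<^sup>2 \<le> 2 * (cmod a)\<^sup>2 + 2 * (cmod b)\<^sup>2"
proof -
  have "(cmod (a - b))\<^sup>2 \<le> (cmod a + cmod b)\<^sup>2"
    by (intro power_mono norm_triangle_ineq4) auto
  also have "\<dots> \<le> 2 * (cmod a)\<^sup>2 + 2 * (cmod b)\<^sup>2"
    using zero_le_power2[of "cmod a - cmod b"] by (simp add: power2_sum power2_diff)
  finally show ?thesis .
qed

text \<open>Pointwise convergence under a common bound gives L2 convergence on a ball. Outside the
  ball of radius t the weight of order -\<sigma> is at most t^(\<sigma>' - \<sigma>) times that of
  order -\<sigma>', whose integrals are bounded. The gap between the two orders thus excludes escape
  to high frequency.\<close>

lemma weighted_L2_Cauchy: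
  fixes H :: "nat \<Rightarrow> 'a::euclidean_space \<Rightarrow> complex"
  assumes meas[measurable]: "\<And>n. H n \<in> borel_measurable borel"
    and bd: "\<And>n \<xi>. cmod (H n \<xi>) \<le> B"
    and conv: "\<And>\<xi>. convergent (\<lambda>n. H n \<xi>)"
    and int: "\<And>n. integrable lborel (sobolev_weight (- \<sigma>') (H n))"
    and le: "\<And>n. (\<integral>\<xi>. sobolev_weight (- \<sigma>') (H n) \<xi> \<partial>lborel) \<le> A"
    and \<sigma>: "0 \<le> \<sigma>" "\<sigma>' < \<sigma>" and \<epsilon>: "0 < \<epsilon>"
  shows "\<exists>N. \<forall>n\<ge>N. \<forall>m\<ge>N. (\<integral>\<xi>. sobolev_weight (- \<sigma>) (\<lambda>\<xi>. H n \<xi> - H m \<xi>) \<xi> \<partial>lborel) \<le> \<epsilon>"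
proof -
  define \<delta> where "\<delta> = \<sigma> - \<sigma>'"
  have \<delta>: "\<delta> > 0" using \<sigma> by (simp add: \<delta>_def)
  define L where "L \<xi> = lim (\<lambda>n. H n \<xi>)" for \<xi>
  have L: "(\<lambda>n. H n \<xi>) \<longlonglongrightarrow> L \<xi>" for \<xi>
    unfolding L_def using conv by (simp add: convergent_LIMSEQ_iff)
  have [measurable]: "L \<in> borel_measurable borel"
    by (rule borel_measurable_LIMSEQ_metric[OF meas L])
  have LB: "cmod (L \<xi>) \<le> B" for \<xi>
    using L[of \<xi>] bd by (intro LIMSEQ_le_const2[OF tendsto_norm]) auto
  \<comment> \<open>4 A bounds the outer part: each of the two terms of the squared difference
    brings a factor 2 and an integral of at most A.\<close>
  have "((\<lambda>t. 4 * A * t powr (- \<delta>)) \<longlongrightarrow> 4 * A * 0) at_top"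
    using \<delta> by (intro tendsto_mult_left tendsto_neg_powr filterlim_ident) auto
  then have "\<forall>\<^sub>F t in at_top. 4 * A * t powr (- \<delta>) < \<epsilon> / 2"
    using \<epsilon> by (intro order_tendstoD) auto
  with eventually_ge_at_top[of 1] have "\<forall>\<^sub>F t::real in at_top. 4 * A * t powr (- \<delta>) < \<epsilon> / 2 \<and> 1 \<le> t"
    by eventually_elim simp
  then obtain t :: real where t: "4 * A * t powr (- \<delta>) < \<epsilon> / 2" "1 \<le> t"
    by (auto simp: eventually_at_top_linorder)
  define I where "I = indicat_real (ball (0::'a) t)"
  have [measurable]: "I \<in> borel_measurable borel" unfolding I_def by (intro borel_measurable_indicator) simp
  have I: "0 \<le> I \<xi>" "I \<xi> \<le> 1" for \<xi> by (auto simp: I_def indicator_def)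
  define B2 where "B2 = (2 * B)\<^sup>2"
  have Iint: "integrable lborel (\<lambda>\<xi>. B2 * I \<xi>)"
    unfolding I_def using emeasure_bounded_finite[OF bounded_ball, of "0::'a" t]
    by (intro integrable_mult_right integrable_real_indicator) auto
  have diff: "(cmod (H n \<xi> - L \<xi>))\<^sup>2 \<le> B2" for n \<xi>
    using norm_triangle_ineq4[of "H n \<xi>" "L \<xi>"] bd[of n \<xi>] LB[of \<xi>] unfolding B2_def by (intro power_mono) auto
  have B2: "\<bar>B2\<bar> = B2" by (simp add: B2_def)
  define d where "d n = (\<integral>\<xi>. (cmod (H n \<xi> - L \<xi>))\<^sup>2 * I \<xi> \<partial>lborel)" for n
  have dint: "integrable lborel (\<lambda>\<xi>. (cmod (H n \<xi> - L \<xi>))\<^sup>2 * I \<xi>)" for n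
    using Iint by (rule Bochner_Integration.integrable_bound)
      (auto intro!: AE_I2 mult_right_mono diff simp: I abs_mult abs_of_nonneg B2)
  have "d \<longlonglongrightarrow> (\<integral>\<xi>. (0::real) \<partial>(lborel::'a measure))"
    unfolding d_def
  proof (rule integral_dominated_convergence[OF _ _ Iint])
    show "AE \<xi> in lborel. (\<lambda>n. (cmod (H n \<xi> - L \<xi>))\<^sup>2 * I \<xi>) \<longlonglongrightarrow> 0"
    proof (intro AE_I2)
      fix \<xi>
      have "(\<lambda>n. (cmod (H n \<xi> - L \<xi>))\<^sup>2 * I \<xi>) \<longlonglongrightarrow> (cmod (L \<xi> - L \<xi>))\<^sup>2 * I \<xi>"
        by (intro tendsto_intros L)
      then show "(\<lambda>n. (cmod (H n \<xi> - L \<xi>))\<^sup>2 * I \<xi>) \<longlonglongrightarrow> 0" by simp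
    qed
    show "AE \<xi> in lborel. norm ((cmod (H n \<xi> - L \<xi>))\<^sup>2 * I \<xi>) \<le> B2 * I \<xi>" for n
      by (intro AE_I2) (auto intro!: mult_right_mono diff simp: I abs_mult abs_of_nonneg)
  qed auto
  \<comment> \<open>The inner terms 2 d n and 2 d m then add up to less than \<epsilon> / 2.\<close>
  then have "\<forall>\<^sub>F n in sequentially. d n < \<epsilon> / 8"
    using \<epsilon> by (intro order_tendstoD) auto
  then obtain N where N: "\<And>n. n \<ge> N \<Longrightarrow> d n < \<epsilon> / 8" by (auto simp: eventually_sequentially)
  have sw0: "0 \<le> sobolev_weight s g \<xi>" for s and g :: "'a \<Rightarrow> complex" and \<xi> by (simp add: sobolev_weight_def)
  have "(\<integral>\<xi>. sobolev_weight (- \<sigma>) (\<lambda>\<xi>. H n \<xi> - H m \<xi>) \<xi> \<partial>lborel) \<le> \<epsilon>" if "n \<ge> N" "m \<ge> N" for n m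
  proof -
    define R where "R \<xi> = 2 * ((cmod (H n \<xi> - L \<xi>))\<^sup>2 * I \<xi>) + 2 * ((cmod (H m \<xi> - L \<xi>))\<^sup>2 * I \<xi>)
      + t powr (- \<delta>) * (2 * sobolev_weight (- \<sigma>') (H n) \<xi> + 2 * sobolev_weight (- \<sigma>') (H m) \<xi>)" for \<xi>
    have Rint: "integrable lborel R"
      unfolding R_def by (intro Bochner_Integration.integrable_add integrable_mult_right dint int)
    have R0: "0 \<le> R \<xi>" for \<xi>
      unfolding R_def using I sw0 by (intro add_nonneg_nonneg mult_nonneg_nonneg) auto
    have "sobolev_weight (- \<sigma>) (\<lambda>\<xi>. H n \<xi> - H m \<xi>) \<xi> \<le> R \<xi>" for \<xi>
    proof (cases "\<xi> \<in> ball 0 t")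
      case True
      have "sobolev_weight (- \<sigma>) (\<lambda>\<xi>. H n \<xi> - H m \<xi>) \<xi> \<le> 1 * (cmod (H n \<xi> - H m \<xi>))\<^sup>2"
        unfolding sobolev_weight_def
      proof (rule mult_right_mono)
        have "(1 + (norm \<xi>)\<^sup>2) powr (- \<sigma>) \<le> (1 + (norm \<xi>)\<^sup>2) powr 0"
          using \<sigma> by (intro powr_mono) auto
        then show "(1 + (norm \<xi>)\<^sup>2) powr (- \<sigma>) \<le> 1" by (simp add: add_pos_nonneg less_imp_neq[symmetric] split: if_splits)
      qed simp
      also have "\<dots> \<le> 2 * (cmod (H n \<xi> - L \<xi>))\<^sup>2 + 2 * (cmod (H m \<xi> - L \<xi>))\<^sup>2"
        using cmod_diff_squared_le[of "H n \<xi> - L \<xi>" "H m \<xi> - L \<xi>"] by simp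
      also have "\<dots> \<le> R \<xi>"
        unfolding R_def I_def using True sw0 by (simp add: mult_nonneg_nonneg)
      finally show ?thesis .
    next
      case False
      then have "t \<le> norm \<xi>" by simp
      then have "t \<le> norm \<xi> * norm \<xi>" using t(2) mult_mono[of 1 "norm \<xi>" t "norm \<xi>"] by simp
      then have tt: "t \<le> 1 + (norm \<xi>)\<^sup>2" by (simp add: power2_eq_square)
      have "(1 + (norm \<xi>)\<^sup>2) powr (- \<sigma>) = (1 + (norm \<xi>)\<^sup>2) powr (- \<delta>) * (1 + (norm \<xi>)\<^sup>2) powr (- \<sigma>')"
        by (simp add: \<delta>_def powr_add[symmetric])
      also have "\<dots> \<le> t powr (- \<delta>) * (1 + (norm \<xi>)\<^sup>2) powr (- \<sigma>')"
        using t(2) tt \<delta> by (intro mult_right_mono powr_mono2') auto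
      finally have "sobolev_weight (- \<sigma>) (\<lambda>\<xi>. H n \<xi> - H m \<xi>) \<xi>
          \<le> (t powr (- \<delta>) * (1 + (norm \<xi>)\<^sup>2) powr (- \<sigma>')) * (2 * (cmod (H n \<xi>))\<^sup>2 + 2 * (cmod (H m \<xi>))\<^sup>2)"
        unfolding sobolev_weight_def by (intro mult_mono cmod_diff_squared_le) auto
      also have "\<dots> = t powr (- \<delta>) * (2 * sobolev_weight (- \<sigma>') (H n) \<xi> + 2 * sobolev_weight (- \<sigma>') (H m) \<xi>)"
        by (simp add: sobolev_weight_def algebra_simps)
      also have "\<dots> \<le> R \<xi>" unfolding R_def using I by (simp add: mult_nonneg_nonneg)
      finally show ?thesis .
    qed
    then have "(\<integral>\<xi>. sobolev_weight (- \<sigma>) (\<lambda>\<xi>. H n \<xi> - H m \<xi>) \<xi> \<partial>lborel) \<le> (\<integral>\<xi>. R \<xi> \<partial>lborel)"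
      using Rint R0 by (intro integral_mono')
    also have "\<dots> = 2 * d n + 2 * d m + t powr (- \<delta>) * (2 * (\<integral>\<xi>. sobolev_weight (- \<sigma>') (H n) \<xi> \<partial>lborel) + 2 * (\<integral>\<xi>. sobolev_weight (- \<sigma>') (H m) \<xi> \<partial>lborel))"
      unfolding R_def d_def using dint int by simp
    also have "\<dots> \<le> 2 * d n + 2 * d m + t powr (- \<delta>) * (2 * A + 2 * A)"
      by (intro add_left_mono mult_left_mono add_mono le) auto
    also have "\<dots> \<le> \<epsilon>" using N[OF that(1)] N[OF that(2)] t(1) by (simp add: algebra_simps)
    finally show ?thesis .
  qed
  then show ?thesis by blast
qed

section \<open>Pointwise convergence of exponential sums along a subsequence\<close>

lemma cmod_cis_diff_le: "cmod (cis a - cis b) \<le> \<bar>a - b\<bar>"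
proof -
  have "iexp (a - b) = cis (a - b)" by (simp only: cis_conv_exp)
  then have "cis a - cis b = cis b * (iexp (a - b) - (\<Sum>k\<le>0. (\<i> * complex_of_real (a - b)) ^ k / fact k))"
    by (simp only:) (simp add: right_diff_distrib cis_mult)
  then show ?thesis using iexp_approx1[of "a - b" 0] by (simp add: norm_mult)
qed

lemma char_sum_lipschitz:
  assumes m: "\<And>x. 0 \<le> m x" "sum m X = 1" and R: "\<And>x. x \<in> X \<Longrightarrow> norm x \<le> R"
  shows "cmod (char_sum X m \<xi> - char_sum X m \<eta>) \<le> 2 * pi * R * norm (\<xi> - \<eta>)"
proof -
  have "cmod (char_sum X m \<xi> - char_sum X m \<eta>)
      \<le> (\<Sum>x\<in>X. cmod (complex_of_real (m x) * (cis (2 * pi * (\<xi> \<bullet> x)) - cis (2 * pi * (\<eta> \<bullet> x)))))"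
    unfolding char_sum_def sum_subtractf[symmetric] right_diff_distrib[symmetric] by (rule norm_sum)
  also have "\<dots> \<le> (\<Sum>x\<in>X. m x * (2 * pi * R * norm (\<xi> - \<eta>)))"
  proof (rule sum_mono)
    fix x assume x: "x \<in> X"
    have "cmod (cis (2 * pi * (\<xi> \<bullet> x)) - cis (2 * pi * (\<eta> \<bullet> x))) \<le> \<bar>2 * pi * (\<xi> \<bullet> x) - 2 * pi * (\<eta> \<bullet> x)\<bar>"
      by (rule cmod_cis_diff_le)
    also have "\<dots> = 2 * pi * \<bar>(\<xi> - \<eta>) \<bullet> x\<bar>"
      by (simp add: right_diff_distrib[symmetric] inner_diff_left[symmetric] abs_mult)
    also have "\<dots> \<le> 2 * pi * (norm (\<xi> - \<eta>) * norm x)"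
      by (intro mult_left_mono Cauchy_Schwarz_ineq2) auto
    also have "\<dots> \<le> 2 * pi * (norm (\<xi> - \<eta>) * R)"
      by (intro mult_left_mono R x) auto
    finally have "m x * cmod (cis (2 * pi * (\<xi> \<bullet> x)) - cis (2 * pi * (\<eta> \<bullet> x))) \<le> m x * (2 * pi * (norm (\<xi> - \<eta>) * R))"
      by (rule mult_left_mono) (rule m)
    then show "cmod (complex_of_real (m x) * (cis (2 * pi * (\<xi> \<bullet> x)) - cis (2 * pi * (\<eta> \<bullet> x)))) \<le> m x * (2 * pi * R * norm (\<xi> - \<eta>))"
      using m by (simp add: norm_mult mult_ac)
  qed
  also have "\<dots> = 2 * pi * R * norm (\<xi> - \<eta>)"
    using m by (simp add: sum_distrib_right[symmetric])
  finally show ?thesis .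
qed

text \<open>Supports in one bounded set make the exponential sums Lipschitz with a common constant,
  so convergence along a subsequence on a countable dense set spreads to every frequency.\<close>

lemma char_sum_convergent_subsequence:
  fixes E :: "'a::euclidean_space set"
  assumes E: "bounded E" and fr: "\<And>n. frostman_at C s (r n) E (X n) (m n)"
  obtains k where "strict_mono (k :: nat \<Rightarrow> nat)" "\<And>\<xi>. convergent (\<lambda>n. char_sum (X (k n)) (m (k n)) \<xi>)"
proof -
  have m: "\<And>n x. 0 \<le> m n x" "\<And>n. sum (m n) (X n) = 1" and XE: "\<And>n. X n \<subseteq> E"
    using fr by (auto simp: frostman_at_def)
  obtain R where R: "R > 0" "\<And>x. x \<in> E \<Longrightarrow> norm x \<le> R"
    using E by (metis bounded_pos)
  have lip: "cmod (char_sum (X n) (m n) \<xi> - char_sum (X n) (m n) \<eta>) \<le> 2 * pi * R * norm (\<xi> - \<eta>)" for n \<xi> \<eta>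
    using XE R m by (intro char_sum_lipschitz) auto
  obtain D :: "'a set" where D: "countable D" "\<And>U. open U \<Longrightarrow> U \<noteq> {} \<Longrightarrow> \<exists>d\<in>D. d \<in> U"
    using countable_dense_exists by blast
  obtain k where k: "strict_mono (k :: nat \<Rightarrow> nat)"
    and kc: "\<And>d. d \<in> D \<Longrightarrow> \<exists>l. (\<lambda>n. char_sum (X (k n)) (m (k n)) d) \<longlonglongrightarrow> l"
    using function_convergent_subsequence[OF D(1), of "\<lambda>n. char_sum (X n) (m n)" 1] char_sum_norm_le m by metis
  have "convergent (\<lambda>n. char_sum (X (k n)) (m (k n)) \<xi>)" for \<xi>
    unfolding Cauchy_convergent_iff[symmetric]
  proof (rule metric_CauchyI)
    fix e :: real assume e: "e > 0"
    define \<rho> where "\<rho> = e / (3 * (2 * pi * R))"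
    have \<rho>: "\<rho> > 0" using e R by (simp add: \<rho>_def)
    obtain d where d: "d \<in> D" "d \<in> ball \<xi> \<rho>" using D(2)[of "ball \<xi> \<rho>"] \<rho> by auto
    have close: "dist (char_sum (X (k n)) (m (k n)) \<xi>) (char_sum (X (k n)) (m (k n)) d) < e / 3" for n
    proof -
      have "dist (char_sum (X (k n)) (m (k n)) \<xi>) (char_sum (X (k n)) (m (k n)) d) \<le> 2 * pi * R * norm (\<xi> - d)"
        unfolding dist_norm by (rule lip)
      also have "\<dots> < 2 * pi * R * \<rho>" using d(2) R(1) by (intro mult_strict_left_mono) (auto simp: dist_norm)
      also have "\<dots> = e / 3" using R(1) by (simp add: \<rho>_def)
      finally show ?thesis .
    qed
    have "Cauchy (\<lambda>n. char_sum (X (k n)) (m (k n)) d)" using kc[OF d(1)] by (auto simp: LIMSEQ_imp_Cauchy)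
    moreover have "0 < e / 3" using e by simp
    ultimately obtain N where N: "\<forall>i\<ge>N. \<forall>j\<ge>N. dist (char_sum (X (k i)) (m (k i)) d) (char_sum (X (k j)) (m (k j)) d) < e / 3"
      using metric_CauchyD by blast
    show "\<exists>M. \<forall>i\<ge>M. \<forall>j\<ge>M. dist (char_sum (X (k i)) (m (k i)) \<xi>) (char_sum (X (k j)) (m (k j)) \<xi>) < e"
    proof (intro exI[of _ N] allI impI)
      fix i j assume "N \<le> i" "N \<le> j"
      then have "dist (char_sum (X (k i)) (m (k i)) d) (char_sum (X (k j)) (m (k j)) d) < e / 3"
        using N by blast
      from dist_triangle_third[OF close this close[of j, THEN dist_commute_lessI]]
      show "dist (char_sum (X (k i)) (m (k i)) \<xi>) (char_sum (X (k j)) (m (k j)) \<xi>) < e" .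
    qed
  qed
  with k that show ?thesis by blast
qed

section \<open>Mollified discrete measures\<close>

text \<open>The bump is left unnormalised: what matters is that the total mass is positive and
  independent of r.\<close>

definition mollified :: "'a::euclidean_space set \<Rightarrow> ('a \<Rightarrow> real) \<Rightarrow> real \<Rightarrow> 'a \<Rightarrow> real" where
  "mollified X m r y = (\<Sum>a\<in>X. m a * (inverse (r ^ DIM('a)) * bump1 (1 - (norm ((y - a) /\<^sub>R r))\<^sup>2)))"

text \<open>Width and height are those of the transform of exp (-pi |r \<xi>|^2), which makes this
  function \<open>fourier (gauss_hat X m r)\<close>.\<close>

definition gauss_mollified :: "'a::euclidean_space set \<Rightarrow> ('a \<Rightarrow> real) \<Rightarrow> real \<Rightarrow> 'a \<Rightarrow> real" where
  "gauss_mollified X m r x = (\<Sum>a\<in>X. m a * (inverse (r ^ DIM('a)) * exp (- (pi * (norm (x - a))\<^sup>2 / r\<^sup>2))))"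

definition gauss_hat :: "'a::euclidean_space set \<Rightarrow> ('a \<Rightarrow> real) \<Rightarrow> real \<Rightarrow> 'a \<Rightarrow> complex" where
  "gauss_hat X m r \<xi> = char_sum X m \<xi> * complex_of_real (exp (- pi * (norm (r *\<^sub>R \<xi>))\<^sup>2))"

definition unit_bump :: "'a::euclidean_space \<Rightarrow> complex" where
  "unit_bump v = complex_of_real (bump1 (1 - (norm v)\<^sup>2))"

lemma smooth_rescaled_bump: "smooth (\<lambda>y. bump1 (1 - (norm ((y - a) /\<^sub>R r))\<^sup>2))"
proof -
  have "smooth (\<lambda>y. bump1 (1 + (- inverse (r\<^sup>2)) * (norm (y - a))\<^sup>2))"
    by (intro smooth_bump1 smooth_add smooth_mult smooth_const smooth_norm_sq)
  moreover have "1 + (- inverse (r\<^sup>2)) * (norm (y - a))\<^sup>2 = 1 - (norm ((y - a) /\<^sub>R r))\<^sup>2" for y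
    by (simp add: power_mult_distrib power_inverse)
  ultimately show ?thesis by simp
qed

lemma rescaled_bump_support:
  assumes "bump1 (1 - (norm ((y - a) /\<^sub>R r))\<^sup>2) \<noteq> 0" "r > 0"
  shows "dist y a < r"
proof -
  have "(norm ((y - a) /\<^sub>R r))\<^sup>2 < 1\<^sup>2" using assms(1) by (auto simp: bump1_eq split: if_splits)
  then have "norm ((y - a) /\<^sub>R r) < 1" by (rule power_less_imp_less_base) simp
  moreover have "norm ((y - a) /\<^sub>R r) = dist y a / r"
    using assms(2) by (simp add: dist_norm divide_inverse mult.commute)
  ultimately show ?thesis using assms(2) by (simp add: pos_divide_less_eq)
qed

lemma unit_bump_test: "unit_bump \<in> test_functions"
proof (rule test_functionsI)
  show "smooth (unit_bump :: 'a \<Rightarrow> complex)"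
    unfolding unit_bump_def using smooth_rescaled_bump[where a="0::'a" and r=1] by (intro smooth_of_real) simp
  show "v \<in> cball 0 1" if "unit_bump v \<noteq> 0" for v :: 'a
    using that rescaled_bump_support[where y=v and a=0 and r=1] by (auto simp: unit_bump_def dist_norm)
qed (rule compact_cball)

lemma unit_bump_schwartz: "unit_bump \<in> schwartz"
  using unit_bump_test test_functions_subset_schwartz by blast

lemma mollified_complex:
  fixes X :: "'a::euclidean_space set"
  shows "complex_of_real (mollified X m r y)
    = (\<Sum>a\<in>X. complex_of_real (m a * inverse (r ^ DIM('a))) * unit_bump ((y - a) /\<^sub>R r))"
  by (simp add: mollified_def unit_bump_def mult.assoc)

lemma mollified_support:
  assumes "mollified X m r y \<noteq> 0" "r > 0"
  shows "\<exists>a\<in>X. dist y a < r"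
proof -
  obtain a where "a \<in> X" "bump1 (1 - (norm ((y - a) /\<^sub>R r))\<^sup>2) \<noteq> 0"
    using assms(1) unfolding mollified_def by (metis (no_types, lifting) mult_zero_right sum.not_neutral_contains_not_neutral)
  with rescaled_bump_support assms(2) show ?thesis by blast
qed

lemma smooth_mollified: "smooth (mollified X m r)"
  unfolding mollified_def[abs_def]
  by (intro smooth_sum smooth_mult smooth_const smooth_rescaled_bump)

lemma mollified_test:
  assumes X: "finite X" and r: "r > 0"
  shows "(\<lambda>y. complex_of_real (mollified X m r y)) \<in> test_functions"
proof (rule test_functionsI)
  show "smooth (\<lambda>y. complex_of_real (mollified X m r y))"
    by (intro smooth_of_real smooth_mollified)
  show "compact (\<Union>a\<in>X. cball a r)" using X by (intro compact_UN) auto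
  show "y \<in> (\<Union>a\<in>X. cball a r)" if "complex_of_real (mollified X m r y) \<noteq> 0" for y
  proof -
    from that have "mollified X m r y \<noteq> 0" by simp
    from mollified_support[OF this r] obtain a where "a \<in> X" "dist y a < r" by blast
    then show ?thesis by (intro UN_I[of a]) (auto simp: dist_commute)
  qed
qed

lemma mollified_bounds:
  fixes y :: "'a::euclidean_space"
  assumes m: "\<And>x. 0 \<le> m x" "sum m X = 1" and r: "r > 0"
  shows "0 \<le> mollified X m r y" "mollified X m r y \<le> inverse (r ^ DIM('a))"
proof -
  show "0 \<le> mollified X m r y"
    unfolding mollified_def using m r bump1_bounds by (intro sum_nonneg mult_nonneg_nonneg) auto
  have "mollified X m r y \<le> (\<Sum>a\<in>X. m a * (inverse (r ^ DIM('a)) * 1))"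
    unfolding mollified_def using m r bump1_bounds by (intro sum_mono mult_left_mono) auto
  then show "mollified X m r y \<le> inverse (r ^ DIM('a))"
    using m by (simp add: sum_distrib_right[symmetric])
qed

lemma fourier_mollified:
  fixes X :: "'a::euclidean_space set"
  assumes r: "r > 0"
  shows "fourier (\<lambda>y. complex_of_real (mollified X m r y)) \<xi> = cnj (char_sum X m \<xi>) * fourier unit_bump (r *\<^sub>R \<xi>)"
proof -
  have ub: "unit_bump \<in> borel_measurable borel" by (rule schwartz_measurable[OF unit_bump_schwartz])
  \<comment> \<open>One point of weight r^d cancels the normalising factor, so the rescaled bump is
    a special case of \<open>mollified\<close>.\<close>
  have "(\<lambda>y. unit_bump ((y - a) /\<^sub>R r)) \<in> test_functions" for a :: 'a
    using mollified_test[of "{a}" r "\<lambda>_. r ^ DIM('a)"] r by (simp add: mollified_complex)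
  then have int: "integrable lborel (\<lambda>y. unit_bump ((y - a) /\<^sub>R r))" for a :: 'a
    using test_functions_subset_schwartz schwartz_integrable by blast
  have "fourier (\<lambda>y. complex_of_real (mollified X m r y)) \<xi>
      = (\<Sum>a\<in>X. complex_of_real (m a * inverse (r ^ DIM('a))) * fourier (\<lambda>y. unit_bump ((y - a) /\<^sub>R r)) \<xi>)"
    unfolding mollified_complex by (simp only: fourier_sum fourier_cmult integrable_mult_right int)
  also have "\<dots> = (\<Sum>a\<in>X. (complex_of_real (m a) * cis (- (2 * pi * (a \<bullet> \<xi>)))) * fourier unit_bump (r *\<^sub>R \<xi>))"
    using r by (intro sum.cong refl) (simp add: fourier_rescale[OF ub r])
  also have "\<dots> = cnj (char_sum X m \<xi>) * fourier unit_bump (r *\<^sub>R \<xi>)"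
    by (simp add: char_sum_def cis_cnj sum_distrib_right inner_commute)
  finally show ?thesis .
qed

lemma integral_unit_bump_pos: "0 < (\<integral>v. bump1 (1 - (norm v)\<^sup>2) \<partial>(lborel :: 'a::euclidean_space measure))"
proof -
  let ?f = "\<lambda>v::'a. bump1 (1 - (norm v)\<^sup>2)"
  have "continuous_on UNIV ?f"
    using smooth_continuous_on[OF smooth_rescaled_bump[where a="0::'a" and r=1]] by simp
  then have [measurable]: "?f \<in> borel_measurable borel" by (rule borel_measurable_continuous_onI)
  have int: "integrable lborel ?f"
    using schwartz_integrable[OF unit_bump_schwartz, where 'a='a] unfolding unit_bump_def[abs_def] complex_of_real_integrable_eq .
  have "0 < exp (- inverse (1 - 1/4)) * measure lborel (ball (0::'a) (1/2))"
    by (intro mult_pos_pos) (auto simp: content_ball_pos)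
  also have "\<dots> = (\<integral>v. exp (- inverse (1 - 1/4)) * indicat_real (ball (0::'a) (1/2)) v \<partial>lborel)" by simp
  also have "\<dots> \<le> (\<integral>v. ?f v \<partial>lborel)"
  proof (rule integral_mono'[OF int])
    fix v :: 'a
    show "exp (- inverse (1 - 1/4)) * indicat_real (ball 0 (1/2)) v \<le> ?f v"
    proof (cases "v \<in> ball 0 (1/2)")
      case True
      then have "(norm v)\<^sup>2 \<le> (1/2)\<^sup>2" by (intro power_mono) auto
      then have "1 - 1/4 \<le> 1 - (norm v)\<^sup>2" by (simp add: power2_eq_square)
      then show ?thesis using True le_imp_inverse_le[of "1 - 1/4" "1 - (norm v)\<^sup>2"] by (simp add: bump1_eq)
    qed (simp add: bump1_bounds)
  qed (rule bump1_bounds)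
  finally show ?thesis .
qed

text \<open>Read off from the transform at frequency 0, where \<open>char_sum\<close> equals the
  total mass 1.\<close>

lemma mollified_integral:
  fixes X :: "'a::euclidean_space set"
  assumes X: "finite X" and m: "sum m X = 1" and r: "r > 0"
  shows "integrable lborel (mollified X m r)"
    and "(\<integral>y. mollified X m r y \<partial>lborel) = (\<integral>v. bump1 (1 - (norm v)\<^sup>2) \<partial>(lborel :: 'a measure))"
proof -
  have "(\<lambda>y. complex_of_real (mollified X m r y)) \<in> schwartz"
    using mollified_test[OF X r] test_functions_subset_schwartz by blast
  from schwartz_integrable[OF this] show "integrable lborel (mollified X m r)"
    by (simp only: complex_of_real_integrable_eq)
  have "complex_of_real (\<integral>y. mollified X m r y \<partial>lborel) = fourier (\<lambda>y. complex_of_real (mollified X m r y)) 0"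
    by (simp add: fourier_def)
  also have "\<dots> = fourier unit_bump (0 :: 'a)"
    unfolding fourier_mollified[OF r] using m by (simp add: char_sum_def of_real_sum[symmetric] del: of_real_sum)
  also have "\<dots> = complex_of_real (\<integral>v. bump1 (1 - (norm v)\<^sup>2) \<partial>(lborel :: 'a measure))"
    by (simp add: fourier_def unit_bump_def)
  finally show "(\<integral>y. mollified X m r y \<partial>lborel) = (\<integral>v. bump1 (1 - (norm v)\<^sup>2) \<partial>(lborel :: 'a measure))"
    by (simp only: of_real_eq_iff)
qed

section \<open>Gaussian smoothing and a minorant of small support\<close>

lemma gauss_hat_eq_sum:
  "gauss_hat X m r \<xi> = (\<Sum>a\<in>X. complex_of_real (m a) * (cis (2 * pi * (\<xi> \<bullet> a)) * complex_of_real (exp (- (pi * r\<^sup>2) * (norm \<xi>)\<^sup>2))))"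
  by (simp add: gauss_hat_def char_sum_def sum_distrib_right mult_ac power_mult_distrib)

lemma modulated_gaussian_schwartz:
  assumes "\<tau> > 0"
  shows "(\<lambda>\<xi>::'a::euclidean_space. cis (2 * pi * (\<xi> \<bullet> a)) * complex_of_real (exp (- \<tau> * (norm \<xi>)\<^sup>2))) \<in> schwartz"
  using schwartz_tempered_mult[OF hered_tempered_character[of _ 1 "(2 * pi) *\<^sub>R a"] gaussian_schwartz[OF assms]]
  by simp

lemma gauss_hat_schwartz:
  assumes "r > 0"
  shows "gauss_hat X m r \<in> schwartz"
proof -
  have "pi * r\<^sup>2 > 0" using assms by simp
  then show ?thesis
    unfolding gauss_hat_eq_sum[abs_def] by (intro schwartz_sum schwartz_cmult modulated_gaussian_schwartz)
qed

lemma fourier_gauss_hat: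
  fixes X :: "'a::euclidean_space set"
  assumes r: "r > 0"
  shows "fourier (gauss_hat X m r) x = complex_of_real (gauss_mollified X m r x)"
proof -
  have \<tau>: "pi * r\<^sup>2 > 0" using r by simp
  have sq: "sqrt (pi / (pi * r\<^sup>2)) = inverse r" using r by (simp add: real_sqrt_inverse inverse_eq_divide real_sqrt_divide)
  have "fourier (gauss_hat X m r) x = (\<Sum>a\<in>X. complex_of_real (m a) * fourier (\<lambda>\<xi>. complex_of_real (exp (- (pi * r\<^sup>2) * (norm \<xi>)\<^sup>2))) (x - a))"
    unfolding gauss_hat_eq_sum[abs_def]
    by (simp only: fourier_sum fourier_cmult fourier_modulate integrable_mult_right schwartz_integrable modulated_gaussian_schwartz[OF \<tau>])
  also have "\<dots> = complex_of_real (gauss_mollified X m r x)"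
    unfolding fourier_gaussian[OF \<tau>] sq gauss_mollified_def
    using r by (simp add: power_inverse power2_eq_square)
  finally show ?thesis .
qed

lemma gauss_mollified_nonneg:
  assumes "\<And>x. 0 \<le> m x" "r > 0"
  shows "0 \<le> gauss_mollified X m r x"
  unfolding gauss_mollified_def using assms by (intro sum_nonneg mult_nonneg_nonneg) auto

lemma gauss_mollified_far:
  fixes x :: "'a::euclidean_space"
  assumes m: "\<And>x. 0 \<le> m x" "sum m X = 1" and r: "r > 0" and \<delta>: "\<delta> \<ge> 0" "\<And>a. a \<in> X \<Longrightarrow> \<delta> \<le> dist x a"
  shows "gauss_mollified X m r x \<le> inverse (r ^ DIM('a)) * exp (- (pi * \<delta>\<^sup>2 / r\<^sup>2))"
proof -
  have "gauss_mollified X m r x \<le> (\<Sum>a\<in>X. m a * (inverse (r ^ DIM('a)) * exp (- (pi * \<delta>\<^sup>2 / r\<^sup>2))))"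
    unfolding gauss_mollified_def
  proof (intro sum_mono mult_left_mono)
    fix a assume "a \<in> X"
    then have "\<delta>\<^sup>2 \<le> (norm (x - a))\<^sup>2" using \<delta> by (intro power_mono) (auto simp: dist_norm)
    then have "pi * \<delta>\<^sup>2 / r\<^sup>2 \<le> pi * (norm (x - a))\<^sup>2 / r\<^sup>2"
      by (intro divide_right_mono mult_left_mono) auto
    then show "exp (- (pi * (norm (x - a))\<^sup>2 / r\<^sup>2)) \<le> exp (- (pi * \<delta>\<^sup>2 / r\<^sup>2))" by simp
  qed (use m r in auto)
  then show ?thesis using m by (simp add: sum_distrib_right[symmetric])
qed

text \<open>A minorant of the Gaussian smoothing that is supported within r of \<open>X\<close> and
  has mass independent of r. Lower bounds need it because the Gaussian tails leave the region where
  b is under control. The constant \<open>exp (- pi)\<close> is the value of the Gaussian profile at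
  distance r.\<close>

definition ball_average :: "'a::euclidean_space set \<Rightarrow> ('a \<Rightarrow> real) \<Rightarrow> real \<Rightarrow> 'a \<Rightarrow> real" where
  "ball_average X m r x = (\<Sum>a\<in>X. m a * (inverse (r ^ DIM('a)) * exp (- pi) * indicat_real (ball a r) x))"

lemma ball_average_le_gauss:
  assumes m: "\<And>x. 0 \<le> m x" and r: "r > 0"
  shows "ball_average X m r x \<le> gauss_mollified X m r x"
  unfolding ball_average_def gauss_mollified_def
proof (intro sum_mono mult_left_mono m)
  fix a
  show "inverse (r ^ DIM('a)) * exp (- pi) * indicat_real (ball a r) x
      \<le> inverse (r ^ DIM('a)) * exp (- (pi * (norm (x - a))\<^sup>2 / r\<^sup>2))"
  proof (cases "x \<in> ball a r")
    case True
    then have "(norm (x - a))\<^sup>2 \<le> r\<^sup>2" by (intro power_mono) (auto simp: dist_norm norm_minus_commute)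
    then have "pi * (norm (x - a))\<^sup>2 / r\<^sup>2 \<le> pi"
      using r by (simp add: pos_divide_le_eq)
    then show ?thesis using True r by simp
  qed (use r in simp)
qed

lemma ball_average_integral:
  fixes X :: "'a::euclidean_space set"
  assumes m: "sum m X = 1" and r: "r > 0"
  shows "integrable lborel (ball_average X m r)"
    and "(\<integral>x. ball_average X m r x \<partial>lborel) = exp (- pi) * measure lborel (ball (0::'a) 1)"
proof -
  have ind: "integrable lborel (indicat_real (ball a r))" for a :: 'a
    using emeasure_bounded_finite[OF bounded_ball, of a r] by (intro integrable_real_indicator) auto
  show "integrable lborel (ball_average X m r)"
    unfolding ball_average_def[abs_def] by (intro Bochner_Integration.integrable_sum integrable_mult_right ind)
  have vol: "measure lborel (ball a r) = r ^ DIM('a) * measure lborel (ball (0::'a) 1)" for a :: 'a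
    using r by (simp add: content_ball)
  have "(\<integral>x. ball_average X m r x \<partial>lborel) = (\<Sum>a\<in>X. m a * (inverse (r ^ DIM('a)) * exp (- pi) * measure lborel (ball a r)))"
    unfolding ball_average_def[abs_def] using ind by (simp add: Bochner_Integration.integral_sum)
  also have "\<dots> = exp (- pi) * measure lborel (ball (0::'a) 1)"
    unfolding vol using r m by (simp add: sum_distrib_right[symmetric])
  finally show "(\<integral>x. ball_average X m r x \<partial>lborel) = exp (- pi) * measure lborel (ball (0::'a) 1)" .
qed

lemma ball_average_nonneg: "(\<And>x. 0 \<le> m x) \<Longrightarrow> r > 0 \<Longrightarrow> 0 \<le> ball_average X m r x"
  unfolding ball_average_def by (intro sum_nonneg mult_nonneg_nonneg) auto

lemma ball_average_support: "ball_average X m r x \<noteq> 0 \<Longrightarrow> \<exists>a\<in>X. dist x a < r"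
  unfolding ball_average_def
  by (metis (no_types, lifting) dist_commute indicator_simps(2) mem_ball mult_zero_right sum.not_neutral_contains_not_neutral)

lemma schwartz_sq_decay:
  assumes "g \<in> schwartz"
  shows "\<exists>B\<ge>0. \<forall>\<eta>. (cmod (g \<eta>))\<^sup>2 \<le> B * (1 + (norm \<eta>)\<^sup>2) powr (- real M)"
proof -
  obtain C where C: "\<And>x. (1 + norm x) ^ M * cmod (g x) \<le> C" using schwartz_bound[OF assms] by blast
  have "(cmod (g \<eta>))\<^sup>2 \<le> C\<^sup>2 * (1 + (norm \<eta>)\<^sup>2) powr (- real M)" for \<eta>
  proof -
    have pos: "0 < 1 + (norm \<eta>)\<^sup>2" by (simp add: add_pos_nonneg)
    have "(1 + (norm \<eta>)\<^sup>2) ^ M \<le> ((1 + norm \<eta>)\<^sup>2) ^ M" by (intro power_mono) (auto simp: power2_sum)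
    then have "(1 + (norm \<eta>)\<^sup>2) ^ M * (cmod (g \<eta>))\<^sup>2 \<le> ((1 + norm \<eta>)\<^sup>2) ^ M * (cmod (g \<eta>))\<^sup>2"
      by (rule mult_right_mono) simp
    also have "\<dots> = ((1 + norm \<eta>) ^ M * cmod (g \<eta>))\<^sup>2"
      by (simp add: power_mult_distrib power_mult[symmetric] mult.commute)
    also have "\<dots> \<le> C\<^sup>2" by (intro power_mono C) auto
    finally show ?thesis using pos
      by (simp add: powr_minus powr_realpow inverse_eq_divide pos_le_divide_eq mult.commute)
  qed
  then show ?thesis by (intro exI[of _ "C\<^sup>2"]) auto
qed

text \<open>
  Here \<open>g\<close> is the transform of the bump for the measure on \<open>F\<close>, and a Gaussian for the measure on \<open>E\<close>.
\<close>

lemma smoothed_frostman_sobolev_bound: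
  fixes s \<sigma> :: real and g :: "'a::euclidean_space \<Rightarrow> complex"
  assumes s: "0 \<le> s" "s \<le> DIM('a)" and \<sigma>: "(DIM('a) - s) / 2 < \<sigma>" and g: "g \<in> schwartz" and C: "0 \<le> C"
  shows "\<exists>A. \<forall>r E X m H. frostman_at C s r E X m \<and> 0 < r \<and> H \<in> borel_measurable borel \<and>
      (\<forall>\<xi>. cmod (H \<xi>) = cmod (char_sum X m \<xi>) * cmod (g (r *\<^sub>R \<xi>))) \<longrightarrow>
      integrable lborel (sobolev_weight (- \<sigma>) H) \<and> (\<integral>\<xi>. sobolev_weight (- \<sigma>) H \<xi> \<partial>lborel) \<le> A"
proof -
  \<comment> \<open>An integer exponent that exceeds s / 2 for every s \<le> d, so that Schwartz
    decay supplies it.\<close>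
  have M: "s / 2 < real (DIM('a) + 1)" using s by simp
  obtain B where B: "B \<ge> 0" "\<And>\<eta>. (cmod (g \<eta>))\<^sup>2 \<le> B * (1 + (norm \<eta>)\<^sup>2) powr (- real (DIM('a) + 1))"
    using schwartz_sq_decay[OF g] by blast
  obtain A where A: "\<And>C r E X m B (H :: 'a \<Rightarrow> complex). frostman_at C s r E X m \<and> 0 \<le> C \<and> 0 < r \<and> 0 \<le> B \<and>
      H \<in> borel_measurable borel \<and>
      (\<forall>\<xi>. (cmod (H \<xi>))\<^sup>2 \<le> (cmod (char_sum X m \<xi>))\<^sup>2 * (B * (1 + (norm (r *\<^sub>R \<xi>))\<^sup>2) powr (- real (DIM('a) + 1)))) \<longrightarrow>
      integrable lborel (sobolev_weight (- \<sigma>) H) \<and> (\<integral>\<xi>. sobolev_weight (- \<sigma>) H \<xi> \<partial>lborel) \<le> A * C * B"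
    using frostman_sobolev_bound[OF s \<sigma> M] by blast
  show ?thesis
  proof (intro exI[of _ "A * C * B"] allI impI)
    fix r E X m and H :: "'a \<Rightarrow> complex"
    assume *: "frostman_at C s r E X m \<and> 0 < r \<and> H \<in> borel_measurable borel \<and>
      (\<forall>\<xi>. cmod (H \<xi>) = cmod (char_sum X m \<xi>) * cmod (g (r *\<^sub>R \<xi>)))"
    have "(cmod (H \<xi>))\<^sup>2 \<le> (cmod (char_sum X m \<xi>))\<^sup>2 * (B * (1 + (norm (r *\<^sub>R \<xi>))\<^sup>2) powr (- real (DIM('a) + 1)))" for \<xi>
      using * B(2)[of "r *\<^sub>R \<xi>"] by (simp only: power_mult_distrib) (intro mult_left_mono, auto)
    with * B(1) C show "integrable lborel (sobolev_weight (- \<sigma>) H) \<and> (\<integral>\<xi>. sobolev_weight (- \<sigma>) H \<xi> \<partial>lborel) \<le> A * C * B"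
      by (intro A[rule_format] conjI allI) auto
  qed
qed

section \<open>Leray densities\<close>

lemma hausdorff_outer_measure_empty: "hausdorff_outer_measure s {} = 0"
proof -
  have "hausdorff_content \<delta> s ({} :: 'a set) \<le> 0" if "\<delta> > 0" for \<delta>
  proof -
    have "hausdorff_content \<delta> s ({} :: 'a set) \<le> (\<Sum>i::nat. hausdorff_gauge s ({} :: 'a set))"
      unfolding hausdorff_content_def using that by (intro INF_lower2[of "\<lambda>_. {}"]) auto
    then show ?thesis by (simp add: hausdorff_gauge_def)
  qed
  then show ?thesis unfolding hausdorff_outer_measure_def by (simp add: SUP_eq_const)
qed

lemma sets_hausdorff_measure_on [simp]: "sets (hausdorff_measure_on s Z) = sets borel"
  unfolding hausdorff_measure_on_def
  using sets.sigma_sets_eq[of "borel :: 'a measure"] by (simp add: sets_measure_of)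

text \<open>On the complement of Z, \<open>emeasure_measure_of_conv\<close> yields either the outer
  measure of the empty set or the default value 0, and both vanish.\<close>

lemma AE_hausdorff_measure_on:
  assumes "Z \<in> sets borel"
  shows "AE z in hausdorff_measure_on s Z. z \<in> Z"
proof (rule AE_I)
  show "emeasure (hausdorff_measure_on s Z) (- Z) = 0"
    unfolding hausdorff_measure_on_def emeasure_measure_of_conv
    by (simp add: hausdorff_outer_measure_empty)
  show "- Z \<in> sets (hausdorff_measure_on s Z)" using borel_comp[OF assms] by simp
qed auto

context
  fixes \<Phi> :: "(real^'d) \<times> (real^'d) \<Rightarrow> real^'k" and \<Lambda>
  assumes leray: "leray_density \<Phi> \<Lambda>" and cont: "continuous_on UNIV \<Phi>"
begin

lemma sets_leray: "sets (\<Lambda> t) = sets borel"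
  using leray unfolding leray_density_def smooth_density_on_def
  by (metis sets_density sets_hausdorff_measure_on)

text \<open>This comes from the Hausdorff form of the densities: each measure lives on its own level
  set, for every t and not merely for almost every t.\<close>

lemma AE_leray: "AE z in \<Lambda> t. \<Phi> z = t"
proof -
  let ?Z = "level_set \<Phi> t"
  obtain w :: "_ \<Rightarrow> real" and s where w: "smooth w" "\<Lambda> t = density (hausdorff_measure_on s ?Z) (\<lambda>z. ennreal (w z))"
    using leray unfolding leray_density_def smooth_density_on_def by metis
  have "?Z = \<Phi> -` {t}" by (auto simp: level_set_def)
  then have "closed ?Z" using closed_vimage[OF closed_singleton cont] by simp
  then have Z: "?Z \<in> sets borel" by simp
  have "w \<in> borel_measurable borel" by (intro borel_measurable_continuous_onI smooth_continuous_on w)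
  then have "w \<in> borel_measurable (hausdorff_measure_on s ?Z)"
    by (simp cong: measurable_cong_sets)
  then have "(\<lambda>z. ennreal (w z)) \<in> borel_measurable (hausdorff_measure_on s ?Z)" by measurable
  then show ?thesis
    unfolding w(2) using AE_hausdorff_measure_on[OF Z, of s]
    by (subst AE_density) (auto simp: level_set_def elim: eventually_mono)
qed

lemma leray_finite: "compact K \<Longrightarrow> emeasure (\<Lambda> t) K < \<infinity>"
  using leray unfolding leray_density_def by blast

end

lemma integrable_compactly_supported:
  fixes h :: "'a::euclidean_space \<Rightarrow> complex"
  assumes sets: "sets M = sets borel" and fin: "\<And>K. compact K \<Longrightarrow> emeasure M K < \<infinity>"
    and cont: "continuous_on UNIV h" and cs: "compactly_supported h"
  shows "integrable M h"
proof -
  define K where "K = closure {x. h x \<noteq> 0}"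
  have K: "compact K" using cs by (simp add: K_def compactly_supported_def)
  have hK: "h x = 0" if "x \<notin> K" for x using that closure_subset[of "{x. h x \<noteq> 0}"] by (auto simp: K_def)
  have "bounded (h ` K)" by (intro compact_imp_bounded compact_continuous_image continuous_on_subset[OF cont] K) auto
  then obtain B where B: "B > 0" "\<And>x. x \<in> K \<Longrightarrow> cmod (h x) \<le> B" by (auto simp: bounded_pos)
  have "K \<in> sets M" using K by (simp add: sets compact_imp_closed)
  then have "integrable M (\<lambda>x. B * indicat_real K x)"
    using fin[OF K] by (intro integrable_mult_right integrable_real_indicator)
  then show ?thesis
  proof (rule Bochner_Integration.integrable_bound)
    have "h \<in> borel_measurable borel" by (rule borel_measurable_continuous_onI[OF cont])
    then show "h \<in> borel_measurable M" by (simp add: measurable_cong_sets[OF sets refl])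
    show "AE x in M. norm (h x) \<le> norm (B * indicat_real K x)"
      using B hK by (intro AE_I2) (auto simp: indicator_def)
  qed
qed

lemma compactly_supported_mult_right:
  fixes b :: "'a::euclidean_space \<Rightarrow> complex"
  assumes "compactly_supported b"
  shows "compactly_supported (\<lambda>z. h z * b z)"
proof -
  have "closure {z. h z * b z \<noteq> 0} \<subseteq> closure {z. b z \<noteq> 0}" by (intro closure_mono) auto
  then have "closure {z. b z \<noteq> 0} \<inter> closure {z. h z * b z \<noteq> 0} = closure {z. h z * b z \<noteq> 0}" by blast
  moreover have "compact (closure {z. b z \<noteq> 0} \<inter> closure {z. h z * b z \<noteq> 0})"
    using assms by (intro compact_Int_closed closed_closure) (simp add: compactly_supported_def)
  ultimately show ?thesis by (simp only: compactly_supported_def)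
qed

lemma integrable_lborel_Times:
  fixes f :: "'a::euclidean_space \<Rightarrow> real" and g :: "'b::euclidean_space \<Rightarrow> real"
  assumes f: "integrable lborel f" and g: "integrable lborel g"
  shows "integrable lborel (\<lambda>z. f (fst z) * g (snd z))"
    and "(\<integral>z. f (fst z) * g (snd z) \<partial>lborel) = (\<integral>x. f x \<partial>lborel) * (\<integral>y. g y \<partial>lborel)"
proof -
  have [measurable]: "f \<in> borel_measurable borel" "g \<in> borel_measurable borel"
    using borel_measurable_integrable[OF f] borel_measurable_integrable[OF g] by simp_all
  have int: "integrable (lborel \<Otimes>\<^sub>M lborel) (\<lambda>z. f (fst z) * g (snd z))"
  proof (rule lborel_pair.Fubini_integrable)
    show "(\<lambda>z. f (fst z) * g (snd z)) \<in> borel_measurable (lborel \<Otimes>\<^sub>M lborel)" by measurable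
    show "integrable lborel (\<lambda>x. \<integral>y. norm (f (fst (x, y)) * g (snd (x, y))) \<partial>lborel)"
      using f by (simp add: abs_mult)
    show "AE x in lborel. integrable lborel (\<lambda>y. f (fst (x, y)) * g (snd (x, y)))"
      using g by simp
  qed
  then show "integrable lborel (\<lambda>z. f (fst z) * g (snd z))" by (simp add: lborel_prod)
  have "(\<integral>z. f (fst z) * g (snd z) \<partial>(lborel \<Otimes>\<^sub>M lborel)) = (\<integral>x. \<integral>y. f x * g y \<partial>lborel \<partial>lborel)"
    using lborel_pair.integral_fst'[OF int] by simp
  then show "(\<integral>z. f (fst z) * g (snd z) \<partial>lborel) = (\<integral>x. f x \<partial>lborel) * (\<integral>y. g y \<partial>lborel)"
    by (simp add: lborel_prod)
qed

section \<open>Approximation of the density of the image measure\<close>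

text \<open>One scale \<open>r n\<close> is to smooth both measures and to enter both Frostman
  bounds, so the second subsequence is extracted along the first.\<close>

lemma frostman_pair_sequence:
  fixes E F :: "'a::euclidean_space set"
  assumes E: "bounded E" "\<And>n. \<exists>X m. frostman_at CE sE ((1/2) ^ n) E X m"
    and F: "bounded F" "\<And>n. \<exists>X m. frostman_at CF sF ((1/2) ^ n) F X m"
  obtains r X m Y \<nu> where "\<And>n. 0 < r n" "r \<longlonglongrightarrow> 0"
    "\<And>n. frostman_at CE sE (r n) E (X n) (m n)" "\<And>n. frostman_at CF sF (r n) F (Y n) (\<nu> n)"
    "\<And>\<xi>. convergent (\<lambda>n. char_sum (X n) (m n) \<xi>)" "\<And>\<xi>. convergent (\<lambda>n. char_sum (Y n) (\<nu> n) \<xi>)"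
proof -
  obtain X m where X: "\<And>n. frostman_at CE sE ((1/2) ^ n) E (X n) (m n)" using E(2) by metis
  obtain Y \<nu> where Y: "\<And>n. frostman_at CF sF ((1/2) ^ n) F (Y n) (\<nu> n)" using F(2) by metis
  obtain k where k: "strict_mono (k :: nat \<Rightarrow> nat)" "\<And>\<xi>. convergent (\<lambda>n. char_sum (X (k n)) (m (k n)) \<xi>)"
    by (rule char_sum_convergent_subsequence[OF E(1) X]) (rule that)
  obtain l where l: "strict_mono (l :: nat \<Rightarrow> nat)" "\<And>\<xi>. convergent (\<lambda>n. char_sum (Y (k (l n))) (\<nu> (k (l n))) \<xi>)"
    by (rule char_sum_convergent_subsequence[OF F(1), of CF sF "\<lambda>n. (1/2) ^ k n" "\<lambda>n. Y (k n)" "\<lambda>n. \<nu> (k n)"])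
      (rule Y, rule that)
  have kl: "strict_mono (k \<circ> l)" by (rule strict_mono_o[OF k(1) l(1)])
  show ?thesis
  proof (rule that[of "\<lambda>n. (1/2) ^ k (l n)" "\<lambda>n. X (k (l n))" "\<lambda>n. m (k (l n))" "\<lambda>n. Y (k (l n))" "\<lambda>n. \<nu> (k (l n))"])
    have "(\<lambda>n. (1/2::real) ^ n) \<longlonglongrightarrow> 0" by (rule LIMSEQ_power_zero) simp
    from LIMSEQ_subseq_LIMSEQ[OF this kl] show "(\<lambda>n. (1/2::real) ^ k (l n)) \<longlonglongrightarrow> 0" by (simp add: o_def)
    show "convergent (\<lambda>n. char_sum (X (k (l n))) (m (k (l n))) \<xi>)" for \<xi>
      using convergent_subseq_convergent[OF k(2) l(1), of \<xi>] by (simp add: o_def)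
  qed (use X Y l in auto)
qed

text \<open>\<open>H n\<close> enters the bound through its modulus, so that the lemma applies to
  \<open>char_sum\<close> for the measure on E and to its conjugate for the measure on F.\<close>

lemma smoothed_weighted_Cauchy:
  fixes H :: "nat \<Rightarrow> 'a::euclidean_space \<Rightarrow> complex" and s \<sigma> :: real
  assumes s: "0 \<le> s" "s \<le> DIM('a)" and \<sigma>: "(DIM('a) - s) / 2 < \<sigma>" and g: "g \<in> schwartz" and C: "0 \<le> C"
    and fr: "\<And>n. frostman_at C s (r n) E (X n) (m n)" and r: "\<And>n. 0 < r n"
    and meas: "\<And>n. H n \<in> borel_measurable borel"
    and nrm: "\<And>n \<xi>. cmod (H n \<xi>) = cmod (char_sum (X n) (m n) \<xi>) * cmod (g (r n *\<^sub>R \<xi>))"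
    and conv: "\<And>\<xi>. convergent (\<lambda>n. H n \<xi>)"
  shows "\<exists>A. \<forall>n. (\<integral>\<xi>. sobolev_weight (- \<sigma>) (H n) \<xi> \<partial>lborel) \<le> A"
    and "0 < \<epsilon> \<Longrightarrow> \<exists>N. \<forall>n\<ge>N. \<forall>m\<ge>N. (\<integral>\<xi>. sobolev_weight (- \<sigma>) (\<lambda>\<xi>. H n \<xi> - H m \<xi>) \<xi> \<partial>lborel) \<le> \<epsilon>"
proof -
  \<comment> \<open>Room between the critical order and \<sigma>: boundedness at \<sigma>' becomes
    the Cauchy property at \<sigma>.\<close>
  obtain \<sigma>' where \<sigma>': "(DIM('a) - s) / 2 < \<sigma>'" "\<sigma>' < \<sigma>" using dense[OF \<sigma>] by blast
  have "0 \<le> (DIM('a) - s) / 2" using s by simp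
  with \<sigma> have \<sigma>0: "0 \<le> \<sigma>" by (rule order_trans[OF _ less_imp_le, rotated])
  have hyp: "frostman_at C s (r n) E (X n) (m n) \<and> 0 < r n \<and> H n \<in> borel_measurable borel \<and>
      (\<forall>\<xi>. cmod (H n \<xi>) = cmod (char_sum (X n) (m n) \<xi>) * cmod (g (r n *\<^sub>R \<xi>)))" for n
    using fr r meas nrm by blast
  show "\<exists>A. \<forall>n. (\<integral>\<xi>. sobolev_weight (- \<sigma>) (H n) \<xi> \<partial>lborel) \<le> A"
    using smoothed_frostman_sobolev_bound[OF s \<sigma> g C] hyp by blast
  obtain A where A: "\<And>n. integrable lborel (sobolev_weight (- \<sigma>') (H n))"
    "\<And>n. (\<integral>\<xi>. sobolev_weight (- \<sigma>') (H n) \<xi> \<partial>lborel) \<le> A"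
    using smoothed_frostman_sobolev_bound[OF s \<sigma>'(1) g C] hyp by blast
  obtain B where B: "\<And>x. cmod (g x) \<le> B" using schwartz_bound[OF g, of 0] by auto
  have bd: "cmod (H n \<xi>) \<le> B" for n \<xi>
  proof -
    have "cmod (char_sum (X n) (m n) \<xi>) \<le> 1" using fr[of n] by (intro char_sum_norm_le) (auto simp: frostman_at_def)
    then have "cmod (H n \<xi>) \<le> 1 * B" unfolding nrm by (intro mult_mono B) auto
    then show ?thesis by simp
  qed
  show "\<exists>N. \<forall>n\<ge>N. \<forall>m\<ge>N. (\<integral>\<xi>. sobolev_weight (- \<sigma>) (\<lambda>\<xi>. H n \<xi> - H m \<xi>) \<xi> \<partial>lborel) \<le> \<epsilon>" if "0 < \<epsilon>"
    by (rule weighted_L2_Cauchy[OF meas bd conv A \<sigma>0 \<sigma>'(2) that])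
qed

text \<open>Bilinearity splits a difference of pairings into f m - f n against \<phi> m and f n
  against \<phi> m - \<phi> n; in each part one factor is small and the other bounded. The constant
  C is common to all t in W, which gives uniformity.\<close>

lemma uniformly_Cauchy_pairing:
  fixes T :: "'t \<Rightarrow> ('a::euclidean_space \<Rightarrow> complex) \<Rightarrow> 'a distrib"
  assumes T: "\<And>t. t \<in> W \<Longrightarrow> sobolev_bounded s r C (T t)"
    and lin1: "\<And>t n m h. t \<in> W \<Longrightarrow> h \<in> schwartz \<Longrightarrow> T t (\<lambda>x. f n x - f m x) h = T t (f n) h - T t (f m) h"
    and lin2: "\<And>t n h k. t \<in> W \<Longrightarrow> h \<in> schwartz \<Longrightarrow> k \<in> schwartz \<Longrightarrow> T t (f n) (\<lambda>x. h x - k x) = T t (f n) h - T t (f n) k"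
    and f: "\<And>n. f n \<in> test_functions" "\<And>n m. (\<lambda>x. f n x - f m x) \<in> test_functions" and \<phi>: "\<And>n. \<phi> n \<in> schwartz"
    and Af: "\<exists>A. \<forall>n. (\<integral>\<xi>. sobolev_weight s (fourier (f n)) \<xi> \<partial>lborel) \<le> A"
    and A\<phi>: "\<exists>A. \<forall>n. (\<integral>\<xi>. sobolev_weight (- r) (\<phi> n) \<xi> \<partial>lborel) \<le> A"
    and Cf: "\<And>\<epsilon>. 0 < \<epsilon> \<Longrightarrow> \<exists>N. \<forall>n\<ge>N. \<forall>m\<ge>N. (\<integral>\<xi>. sobolev_weight s (\<lambda>\<xi>. fourier (f n) \<xi> - fourier (f m) \<xi>) \<xi> \<partial>lborel) \<le> \<epsilon>"
    and C\<phi>: "\<And>\<epsilon>. 0 < \<epsilon> \<Longrightarrow> \<exists>N. \<forall>n\<ge>N. \<forall>m\<ge>N. (\<integral>\<xi>. sobolev_weight (- r) (\<lambda>\<xi>. \<phi> n \<xi> - \<phi> m \<xi>) \<xi> \<partial>lborel) \<le> \<epsilon>"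
  shows "uniformly_Cauchy_on W (\<lambda>n t. T t (f n) (fourier (\<phi> n)))"
  unfolding uniformly_Cauchy_on_def
proof (intro allI impI)
  fix e :: real assume e: "e > 0"
  obtain A1 where A1: "\<And>n. (\<integral>\<xi>. sobolev_weight s (fourier (f n)) \<xi> \<partial>lborel) \<le> A1" using Af by blast
  obtain A2 where A2: "\<And>n. (\<integral>\<xi>. sobolev_weight (- r) (\<phi> n) \<xi> \<partial>lborel) \<le> A2" using A\<phi> by blast
  have nn: "0 \<le> (\<integral>\<xi>. sobolev_weight s' g \<xi> \<partial>lborel)" for s' and g :: "'a \<Rightarrow> complex"
    by (simp add: sobolev_weight_def)
  have A0: "0 \<le> A1" "0 \<le> A2" using nn A1 A2 order_trans by blast+
  \<comment> \<open>The summand 1 keeps the divisor in \<eta> positive.\<close>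
  define K where "K = \<bar>C\<bar> * (sqrt A1 + sqrt A2) + 1"
  have K: "K > 0" using A0 by (simp add: K_def add_nonneg_pos)
  define \<eta> where "\<eta> = e / (2 * K)"
  have \<eta>: "\<eta> > 0" using e K by (simp add: \<eta>_def)
  obtain N1 where N1: "\<And>n m. n \<ge> N1 \<Longrightarrow> m \<ge> N1 \<Longrightarrow> (\<integral>\<xi>. sobolev_weight s (\<lambda>\<xi>. fourier (f n) \<xi> - fourier (f m) \<xi>) \<xi> \<partial>lborel) \<le> \<eta>\<^sup>2"
    using Cf[of "\<eta>\<^sup>2"] \<eta> by auto
  obtain N2 where N2: "\<And>n m. n \<ge> N2 \<Longrightarrow> m \<ge> N2 \<Longrightarrow> (\<integral>\<xi>. sobolev_weight (- r) (\<lambda>\<xi>. \<phi> n \<xi> - \<phi> m \<xi>) \<xi> \<partial>lborel) \<le> \<eta>\<^sup>2"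
    using C\<phi>[of "\<eta>\<^sup>2"] \<eta> by auto
  have fs: "f n \<in> schwartz" for n using f test_functions_subset_schwartz by blast
  show "\<exists>M. \<forall>t\<in>W. \<forall>m\<ge>M. \<forall>n\<ge>M. dist (T t (f m) (fourier (\<phi> m))) (T t (f n) (fourier (\<phi> n))) < e"
  proof (intro exI[of _ "max N1 N2"] ballI allI impI)
    fix t m n assume t: "t \<in> W" and "max N1 N2 \<le> m" "max N1 N2 \<le> n"
    then have mn: "m \<ge> N1" "n \<ge> N1" "m \<ge> N2" "n \<ge> N2" by auto
    have ff: "fourier (\<lambda>x. f m x - f n x) = (\<lambda>\<xi>. fourier (f m) \<xi> - fourier (f n) \<xi>)"
      by (intro ext fourier_diff schwartz_integrable fs)
    have f\<phi>: "fourier (\<lambda>\<xi>. \<phi> m \<xi> - \<phi> n \<xi>) = (\<lambda>x. fourier (\<phi> m) x - fourier (\<phi> n) x)"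
      by (intro ext fourier_diff schwartz_integrable \<phi>)
    have "T t (f m) (fourier (\<phi> m)) - T t (f n) (fourier (\<phi> n))
        = T t (\<lambda>x. f m x - f n x) (fourier (\<phi> m)) + T t (f n) (fourier (\<lambda>\<xi>. \<phi> m \<xi> - \<phi> n \<xi>))"
      unfolding f\<phi> lin1[OF t fourier_schwartz[OF \<phi>]] lin2[OF t fourier_schwartz[OF \<phi>] fourier_schwartz[OF \<phi>]] by simp
    then have "dist (T t (f m) (fourier (\<phi> m))) (T t (f n) (fourier (\<phi> n)))
        \<le> cmod (T t (\<lambda>x. f m x - f n x) (fourier (\<phi> m))) + cmod (T t (f n) (fourier (\<lambda>\<xi>. \<phi> m \<xi> - \<phi> n \<xi>)))"
      unfolding dist_norm by (simp only: norm_triangle_ineq)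
    also have "\<dots> \<le> \<bar>C\<bar> * \<eta> * sqrt A2 + \<bar>C\<bar> * sqrt A1 * \<eta>"
    proof (rule add_mono)
      have "cmod (T t (\<lambda>x. f m x - f n x) (fourier (\<phi> m)))
          \<le> \<bar>C\<bar> * sqrt (\<integral>\<xi>. sobolev_weight s (\<lambda>\<xi>. fourier (f m) \<xi> - fourier (f n) \<xi>) \<xi> \<partial>lborel) * sqrt (\<integral>\<xi>. sobolev_weight (- r) (\<phi> m) \<xi> \<partial>lborel)"
        by (rule sobolev_pairing[OF T[OF t] f(2) \<phi>, of m n m, unfolded ff])
      also have "\<dots> \<le> \<bar>C\<bar> * sqrt (\<eta>\<^sup>2) * sqrt A2"
        using nn A0 by (intro mult_mono mult_left_mono real_sqrt_le_mono N1 mn A2) auto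
      finally show "cmod (T t (\<lambda>x. f m x - f n x) (fourier (\<phi> m))) \<le> \<bar>C\<bar> * \<eta> * sqrt A2" using \<eta> by simp
      have "cmod (T t (f n) (fourier (\<lambda>\<xi>. \<phi> m \<xi> - \<phi> n \<xi>)))
          \<le> \<bar>C\<bar> * sqrt (\<integral>\<xi>. sobolev_weight s (fourier (f n)) \<xi> \<partial>lborel) * sqrt (\<integral>\<xi>. sobolev_weight (- r) (\<lambda>\<xi>. \<phi> m \<xi> - \<phi> n \<xi>) \<xi> \<partial>lborel)"
        by (rule sobolev_pairing[OF T[OF t] f(1) schwartz_diff[OF \<phi> \<phi>]])
      also have "\<dots> \<le> \<bar>C\<bar> * sqrt A1 * sqrt (\<eta>\<^sup>2)"
        using nn A0 by (intro mult_mono mult_left_mono real_sqrt_le_mono N2 mn A1) auto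
      finally show "cmod (T t (f n) (fourier (\<lambda>\<xi>. \<phi> m \<xi> - \<phi> n \<xi>))) \<le> \<bar>C\<bar> * sqrt A1 * \<eta>" using \<eta> by simp
    qed
    also have "\<dots> = \<bar>C\<bar> * (sqrt A1 + sqrt A2) * \<eta>" by (simp add: algebra_simps)
    also have "\<dots> \<le> K * \<eta>" using \<eta> by (intro mult_right_mono) (auto simp: K_def)
    also have "\<dots> = e / 2" using K by (simp add: \<eta>_def)
    also have "\<dots> < e" using e by simp
    finally show "dist (T t (f m) (fourier (\<phi> m))) (T t (f n) (fourier (\<phi> n))) < e" .
  qed
qed

section \<open>Vanishing of the limit off the image\<close>

lemma compact_Times_neighbourhood:
  fixes E :: "'a::metric_space set" and F :: "'b::metric_space set"
  assumes "compact E" "compact F" "open U" "E \<times> F \<subseteq> U"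
  obtains \<delta> where "\<delta> > 0" "\<And>x y e f. e \<in> E \<Longrightarrow> dist x e < \<delta> \<Longrightarrow> f \<in> F \<Longrightarrow> dist y f < \<delta> \<Longrightarrow> (x, y) \<in> U"
proof -
  obtain e where e: "e > 0" "(\<Union>p\<in>E \<times> F. ball p e) \<subseteq> U"
    using compact_subset_open_imp_ball_epsilon_subset[OF compact_Times[OF assms(1,2)] assms(3,4)] by blast
  show ?thesis
  proof (rule that[of "e / 2"])
    fix x y a c assume *: "a \<in> E" "dist x a < e / 2" "c \<in> F" "dist y c < e / 2"
    have "dist (a, c) (x, y) \<le> dist a x + dist c y"
      unfolding dist_Pair_Pair by (rule sqrt_sum_squares_le_sum) auto
    also have "\<dots> < e" using * by (simp add: dist_commute)
    finally have "(x, y) \<in> ball (a, c) e" by simp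
    with * e(2) show "(x, y) \<in> U" by blast
  qed (use e in simp)
qed

text \<open>The first factor bounds the compactly supported smoothing, the rest bounds the Gaussian
  smoothing at distance \<delta> from its points.\<close>

definition gauss_tail :: "nat \<Rightarrow> real \<Rightarrow> real \<Rightarrow> real" where
  "gauss_tail d \<delta> r = inverse (r ^ d) * (inverse (r ^ d) * exp (- (pi * \<delta>\<^sup>2 / r\<^sup>2)))"

text \<open>In terms of y = pi \<delta>^2 / r^2 the powers of r become y^d up to a constant, and y^d
  / exp y tends to 0.\<close>

lemma gauss_tail_tendsto:
  assumes r: "\<And>n. 0 < r n" "r \<longlonglongrightarrow> 0" and \<delta>: "\<delta> > 0"
  shows "(\<lambda>n. gauss_tail d \<delta> (r n)) \<longlonglongrightarrow> 0"
proof -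
  define y where "y n = pi * \<delta>\<^sup>2 * (inverse (r n))\<^sup>2" for n
  have "filterlim (\<lambda>n. inverse (r n)) at_top sequentially"
    using r by (intro filterlim_inverse_at_top) auto
  then have "filterlim y at_top sequentially"
    unfolding y_def using \<delta>
    by (intro filterlim_tendsto_pos_mult_at_top[OF tendsto_const] filterlim_pow_at_top) auto
  from filterlim_compose[OF tendsto_power_div_exp_0 this, of d]
  have "(\<lambda>n. (inverse (pi * \<delta>\<^sup>2)) ^ d * (y n ^ d / exp (y n))) \<longlonglongrightarrow> (inverse (pi * \<delta>\<^sup>2)) ^ d * 0"
    by (rule tendsto_mult_left)
  moreover have "(inverse (pi * \<delta>\<^sup>2)) ^ d * (y n ^ d / exp (y n)) = gauss_tail d \<delta> (r n)" for n
  proof -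
    have "inverse (pi * \<delta>\<^sup>2) * y n = (inverse (r n))\<^sup>2" using \<delta> by (simp add: y_def field_simps)
    then have "(inverse (pi * \<delta>\<^sup>2)) ^ d * y n ^ d = ((inverse (r n))\<^sup>2) ^ d"
      by (simp only: power_mult_distrib[symmetric])
    also have "\<dots> = inverse (r n ^ d) * inverse (r n ^ d)"
      by (simp add: power2_eq_square power_mult_distrib power_inverse)
    finally have P: "(inverse (pi * \<delta>\<^sup>2)) ^ d * y n ^ d = inverse (r n ^ d) * inverse (r n ^ d)" .
    have e: "pi * \<delta>\<^sup>2 / (r n)\<^sup>2 = y n" by (simp add: y_def divide_inverse power_inverse)
    have "(inverse (pi * \<delta>\<^sup>2)) ^ d * (y n ^ d / exp (y n)) = ((inverse (pi * \<delta>\<^sup>2)) ^ d * y n ^ d) * inverse (exp (y n))"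
      by (simp only: divide_inverse mult.assoc)
    also have "\<dots> = gauss_tail d \<delta> (r n)"
      by (simp only: P gauss_tail_def e exp_minus mult.assoc)
    finally show ?thesis .
  qed
  ultimately show ?thesis by simp
qed

lemma smoothed_product_tail:
  fixes X Y :: "'a::euclidean_space set"
  assumes m: "\<And>x. 0 \<le> m x" "sum m X = 1" and \<nu>: "\<And>x. 0 \<le> \<nu> x" "sum \<nu> Y = 1"
    and r: "0 < r" and \<delta>: "0 \<le> \<delta>" "\<And>a. a \<in> X \<Longrightarrow> \<delta> \<le> dist x a"
  shows "mollified Y \<nu> r y * gauss_mollified X m r x \<le> gauss_tail DIM('a) \<delta> r"
  unfolding gauss_tail_def
  using gauss_mollified_far[OF m r \<delta>] mollified_bounds[OF \<nu> r] gauss_mollified_nonneg[of m r X x] m r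
  by (intro mult_mono) auto

text \<open>By compactness no point of the level t lies within \<delta> of E and F in both
  coordinates. Where \<open>mollified\<close> is nonzero, y is close to F; hence x is at least
  \<delta> away from every point of \<open>X n\<close>, and the product is a Gaussian tail.\<close>

lemma level_off_image_tendsto_0:
  fixes \<Phi> :: "'a::euclidean_space \<times> 'a \<Rightarrow> 'k::euclidean_space" and b :: "'a \<times> 'a \<Rightarrow> complex"
  assumes sets: "sets M = sets borel" and fin: "\<And>K. compact K \<Longrightarrow> emeasure M K < \<infinity>"
    and AE: "AE z in M. \<Phi> z = t" and \<Phi>: "continuous_on UNIV \<Phi>"
    and b: "continuous_on UNIV b" "compactly_supported b"
    and E: "compact E" and F: "compact F" and t: "t \<notin> \<Phi> ` (E \<times> F)"
    and r: "\<And>n. 0 < r n" "r \<longlonglongrightarrow> 0"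
    and X: "\<And>n. frostman_at CE sE (r n) E (X n) (m n)" and Y: "\<And>n. frostman_at CF sF (r n) F (Y n) (\<nu> n)"
  shows "(\<lambda>n. \<integral>z. complex_of_real (mollified (Y n) (\<nu> n) (r n) (snd z))
      * complex_of_real (gauss_mollified (X n) (m n) (r n) (fst z)) * b z \<partial>M) \<longlonglongrightarrow> 0"
proof -
  have m: "0 \<le> m n x" "sum (m n) (X n) = 1" "X n \<subseteq> E" and \<nu>: "0 \<le> \<nu> n x" "sum (\<nu> n) (Y n) = 1" "Y n \<subseteq> F" for n x
    using X[of n] Y[of n] by (auto simp: frostman_at_def)
  have "open (\<Phi> -` (- {t}))" by (rule open_vimage[OF open_Compl[OF closed_singleton] \<Phi>])
  moreover have "E \<times> F \<subseteq> \<Phi> -` (- {t})" using t by auto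
  ultimately obtain \<delta> where \<delta>: "\<delta> > 0"
    and nb: "\<And>x y e f. e \<in> E \<Longrightarrow> dist x e < \<delta> \<Longrightarrow> f \<in> F \<Longrightarrow> dist y f < \<delta> \<Longrightarrow> \<Phi> (x, y) \<noteq> t"
    using compact_Times_neighbourhood[OF E F] by (metis ComplD singletonI vimageD)
  define I where "I = (\<integral>z. cmod (b z) \<partial>M)"
  have bint: "integrable M b" by (rule integrable_compactly_supported[OF sets fin b])
  have "\<forall>\<^sub>F n in sequentially. r n < \<delta>" using order_tendstoD(2)[OF r(2) \<delta>] .
  then have "\<forall>\<^sub>F n in sequentially. norm (\<integral>z. complex_of_real (mollified (Y n) (\<nu> n) (r n) (snd z))
      * complex_of_real (gauss_mollified (X n) (m n) (r n) (fst z)) * b z \<partial>M) \<le> gauss_tail DIM('a) \<delta> (r n) * I"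
  proof eventually_elim
    case (elim n)
    let ?h = "\<lambda>z. complex_of_real (mollified (Y n) (\<nu> n) (r n) (snd z))
      * complex_of_real (gauss_mollified (X n) (m n) (r n) (fst z)) * b z"
    have "norm (\<integral>z. ?h z \<partial>M) \<le> (\<integral>z. norm (?h z) \<partial>M)" by (rule integral_norm_bound)
    also have "\<dots> \<le> (\<integral>z. gauss_tail DIM('a) \<delta> (r n) * cmod (b z) \<partial>M)"
    proof (rule integral_mono_AE')
      show "integrable M (\<lambda>z. gauss_tail DIM('a) \<delta> (r n) * cmod (b z))" using bint by simp
      show "AE z in M. norm (?h z) \<le> gauss_tail DIM('a) \<delta> (r n) * cmod (b z)"
        using AE
      proof eventually_elim
        case (elim z)
        obtain x y where z: "z = (x, y)" by force
        have nn: "0 \<le> mollified (Y n) (\<nu> n) (r n) y" "0 \<le> gauss_mollified (X n) (m n) (r n) x"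
          using mollified_bounds(1)[OF \<nu>(1,2) r(1)] gauss_mollified_nonneg[OF m(1) r(1)] by auto
        have "mollified (Y n) (\<nu> n) (r n) y * gauss_mollified (X n) (m n) (r n) x \<le> gauss_tail DIM('a) \<delta> (r n)"
        proof (cases "mollified (Y n) (\<nu> n) (r n) y = 0")
          case True
          then show ?thesis using r(1)[of n] by (simp add: gauss_tail_def)
        next
          case False
          from mollified_support[OF this r(1)] obtain f where f: "f \<in> Y n" "dist y f < r n" by blast
          have "\<delta> \<le> dist x a" if "a \<in> X n" for a
            using nb[of a x f y] that f \<nu>(3) m(3) \<open>r n < \<delta>\<close> elim z by (meson less_trans not_less subsetD)
          then show ?thesis using \<delta> by (intro smoothed_product_tail m \<nu> r) auto
        qed
        then show ?case using nn by (simp add: z norm_mult mult_right_mono)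
      qed
      show "AE z in M. 0 \<le> gauss_tail DIM('a) \<delta> (r n) * cmod (b z)"
        using r(1)[of n] by (simp add: gauss_tail_def)
    qed
    also have "\<dots> = gauss_tail DIM('a) \<delta> (r n) * I" by (simp add: I_def)
    finally show ?case .
  qed
  moreover have "(\<lambda>n. gauss_tail DIM('a) \<delta> (r n) * I) \<longlonglongrightarrow> 0"
    using tendsto_mult_right[OF gauss_tail_tendsto[OF r \<delta>], of "DIM('a)" I] by simp
  ultimately show ?thesis by (rule Lim_null_comparison)
qed

text \<open>
  Testing against a cutoff that is \<open>1\<close> on \<open>\<Phi>(E \<times> F)\<close> bounds the total mass of the approximate densities
  from below.
\<close>

lemma densities_not_null:
  fixes \<Phi> :: "(real^'d) \<times> (real^'d) \<Rightarrow> real^'k" and b :: "(real^'d) \<times> (real^'d) \<Rightarrow> complex"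
  assumes leray: "leray_density \<Phi> \<Lambda>" and \<Phi>: "continuous_on UNIV \<Phi>"
    and b: "continuous_on UNIV b" "compactly_supported b"
    and E: "compact E" and F: "compact F" and W: "open W" "\<Phi> ` (E \<times> F) \<subseteq> W"
    and c: "c > 0" "\<And>z. z \<in> E \<times> F \<Longrightarrow> c \<le> Re (cnj b0 * b z)"
    and r: "\<And>n. 0 < r n" "r \<longlonglongrightarrow> 0"
    and X: "\<And>n. frostman_at CE sE (r n) E (X n) (m n)" and Y: "\<And>n. frostman_at CF sF (r n) F (Y n) (\<nu> n)"
    and A: "\<And>n t. A n t = (\<integral>z. complex_of_real (mollified (Y n) (\<nu> n) (r n) (snd z))
      * complex_of_real (gauss_mollified (X n) (m n) (r n) (fst z)) * b z \<partial>\<Lambda> t)"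
    and contg: "\<And>n. continuous_on UNIV (gauss_mollified (X n) (m n) (r n))"
  shows "\<not> uniform_limit W A (\<lambda>_. 0) sequentially"
proof
  assume lim: "uniform_limit W A (\<lambda>_. 0) sequentially"
  have m: "0 \<le> m n x" "sum (m n) (X n) = 1" "X n \<subseteq> E" "finite (X n)"
    and \<nu>: "0 \<le> \<nu> n x" "sum (\<nu> n) (Y n) = 1" "Y n \<subseteq> F" "finite (Y n)" for n x
    using X[of n] Y[of n] by (auto simp: frostman_at_def)
  define P where "P = \<Phi> ` (E \<times> F)"
  have "E \<noteq> {}" "F \<noteq> {}" using m(2,3)[of 0] \<nu>(2,3)[of 0] by auto
  then have P0: "P \<noteq> {}" by (auto simp: P_def)
  have Pc: "compact P" unfolding P_def
    by (intro compact_continuous_image compact_Times E F continuous_on_subset[OF \<Phi>]) auto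
  obtain \<eta> where \<eta>: "\<eta> > 0" "(\<Union>p\<in>P. ball p \<eta>) \<subseteq> W"
    using compact_subset_open_imp_ball_epsilon_subset[OF Pc W(1)] W(2) P_def by blast
  \<comment> \<open>1 on P and 0 from distance \<eta> / 2 on, so that its support is a compact
    subset of W, where the uniform limit is available.\<close>
  define g where "g t = max 0 (1 - infdist t P / (\<eta> / 2))" for t
  have g01: "0 \<le> g t" "g t \<le> 1" for t using \<eta> by (auto simp: g_def infdist_nonneg)
  have gP: "g t = 1" if "t \<in> P" for t using that by (simp add: g_def)
  have gsupp: "infdist t P \<le> \<eta> / 2" if "g t \<noteq> 0" for t
    using that \<eta> by (auto simp: g_def max_def field_simps split: if_splits)
  have gW: "t \<in> W" if "g t \<noteq> 0" for t
  proof -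
    obtain p where p: "p \<in> P" "infdist t P = dist t p"
      using infdist_attains_inf[OF compact_imp_closed[OF Pc] P0] by blast
    then have "t \<in> ball p \<eta>" using gsupp[OF that] \<eta> by (simp add: dist_commute)
    with p \<eta>(2) show ?thesis by blast
  qed
  have gcont: "continuous_on UNIV g" unfolding g_def by (intro continuous_intros continuous_on_infdist) (use \<eta> in auto)
  have gcs: "compactly_supported (\<lambda>t. complex_of_real (g t))"
  proof -
    have K: "compact {t. infdist t P \<le> \<eta> / 2}" by (rule compact_infdist_le[OF P0 Pc]) (use \<eta> in simp)
    have "closure {t. complex_of_real (g t) \<noteq> 0} \<subseteq> {t. infdist t P \<le> \<eta> / 2}"
      using gsupp by (intro closure_minimal compact_imp_closed K) auto
    then have "{t. infdist t P \<le> \<eta> / 2} \<inter> closure {t. complex_of_real (g t) \<noteq> 0} = closure {t. complex_of_real (g t) \<noteq> 0}" by blast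
    then show ?thesis using compact_Int_closed[OF K closed_closure] unfolding compactly_supported_def by metis
  qed
  have gint: "integrable lborel g"
  proof -
    have "integrable lborel (\<lambda>t. complex_of_real (g t))"
      using emeasure_bounded_finite[OF compact_imp_bounded]
      by (intro integrable_compactly_supported gcs continuous_intros gcont) auto
    then show ?thesis by (simp only: complex_of_real_integrable_eq)
  qed
  define h where "h n z = complex_of_real (mollified (Y n) (\<nu> n) (r n) (snd z))
      * complex_of_real (gauss_mollified (X n) (m n) (r n) (fst z)) * b z" for n z
  have hcont: "continuous_on UNIV (h n)" for n
  proof -
    have "continuous_on UNIV (\<lambda>z::(real^'d) \<times> (real^'d). mollified (Y n) (\<nu> n) (r n) (snd z))"
      by (intro continuous_on_compose2[OF smooth_continuous_on[OF smooth_mollified, of UNIV]] continuous_intros) auto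
    moreover have "continuous_on UNIV (\<lambda>z::(real^'d) \<times> (real^'d). gauss_mollified (X n) (m n) (r n) (fst z))"
      by (intro continuous_on_compose2[OF contg] continuous_intros) auto
    ultimately show ?thesis unfolding h_def by (intro continuous_intros b)
  qed
  have hcs: "compactly_supported (h n)" for n
    unfolding h_def by (rule compactly_supported_mult_right[OF b(2)])
  have disintegration: "(\<integral>z. p (\<Phi> z) * q z \<partial>lborel) = (\<integral>t. p t * (\<integral>z. q z \<partial>\<Lambda> t) \<partial>lborel)"
    if "continuous_on UNIV q" "compactly_supported q" "continuous_on UNIV p" "compactly_supported p"
    for p :: "real^'k \<Rightarrow> complex" and q :: "(real^'d) \<times> (real^'d) \<Rightarrow> complex"
    using leray that unfolding leray_density_def by blast
  have dis: "(\<integral>z. complex_of_real (g (\<Phi> z)) * h n z \<partial>lborel) = (\<integral>t. complex_of_real (g t) * A n t \<partial>lborel)" for n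
    unfolding A h_def[symmetric] by (rule disintegration[OF hcont hcs _ gcs]) (intro continuous_intros gcont)
  \<comment> \<open>Halves of the bounds c and 1 valid on E \<times> F, in order to have an open
    condition.\<close>
  define U where "U = {z. c / 2 < Re (cnj b0 * b z)} \<inter> {z. 1 / 2 < g (\<Phi> z)}"
  have "open U"
    unfolding U_def
    by (intro open_Int open_Collect_less continuous_intros b continuous_on_compose2[OF gcont \<Phi>]) auto
  moreover have "E \<times> F \<subseteq> U"
  proof
    fix z assume z: "z \<in> E \<times> F"
    then have "\<Phi> z \<in> P" by (auto simp: P_def)
    with c(2)[OF z] c(1) gP show "z \<in> U" by (auto simp: U_def)
  qed
  ultimately obtain \<delta> where \<delta>: "\<delta> > 0"
    and nb: "\<And>x y e f. e \<in> E \<Longrightarrow> dist x e < \<delta> \<Longrightarrow> f \<in> F \<Longrightarrow> dist y f < \<delta> \<Longrightarrow> (x, y) \<in> U"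
    using compact_Times_neighbourhood[OF E F] by metis
  \<comment> \<open>The mass of the product of the two smoothings, with the ball minorant in place
    of the Gaussian.\<close>
  define \<kappa> where "\<kappa> = exp (- pi) * measure lborel (ball (0::real^'d) 1) * (\<integral>v. bump1 (1 - (norm v)\<^sup>2) \<partial>(lborel :: (real^'d) measure))"
  have \<kappa>: "\<kappa> > 0" unfolding \<kappa>_def using integral_unit_bump_pos[where 'a="real^'d"]
    by (intro mult_pos_pos) (auto simp: content_ball_pos)
  define I where "I = (\<integral>z. cmod (b z) \<partial>lborel)"
  have bint: "integrable lborel b"
    using emeasure_bounded_finite[OF compact_imp_bounded] by (intro integrable_compactly_supported b) auto
  define \<tau> where "\<tau> n = gauss_tail CARD('d) \<delta> (r n)" for n
  have \<tau>0: "0 \<le> \<tau> n" for n using r(1)[of n] by (simp add: \<tau>_def gauss_tail_def)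
  \<comment> \<open>Multiplying by \<open>cnj b0\<close> gives the main term a positive real part; c
    / 4 is the product of the thresholds 1 / 2 and c / 2 of \<open>U\<close>.\<close>
  have lower: "c / 4 * \<kappa> - \<tau> n * cmod b0 * I \<le> cmod b0 * (\<integral>t. cmod (complex_of_real (g t) * A n t) \<partial>lborel)" if rn: "r n < \<delta>" for n
  proof -
    let ?f = "mollified (Y n) (\<nu> n) (r n)" and ?G = "gauss_mollified (X n) (m n) (r n)"
      and ?B = "ball_average (X n) (m n) (r n)"
    have f0: "0 \<le> ?f y" for y by (rule mollified_bounds(1)[OF \<nu>(1,2) r(1)])
    have G0: "0 \<le> ?G x" for x by (rule gauss_mollified_nonneg[OF m(1) r(1)])
    have B0: "0 \<le> ?B x" for x by (rule ball_average_nonneg[OF m(1) r(1)])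
    have BG: "?B x \<le> ?G x" for x by (rule ball_average_le_gauss[OF m(1) r(1)])
    define q where "q z = g (\<Phi> z) * (?f (snd z) * ?G (fst z)) * Re (cnj b0 * b z)" for z
    have gh: "integrable lborel (\<lambda>z. complex_of_real (g (\<Phi> z)) * h n z)"
      using emeasure_bounded_finite[OF compact_imp_bounded]
      by (intro integrable_compactly_supported compactly_supported_mult_right hcs continuous_intros hcont
          continuous_on_compose2[OF gcont \<Phi>]) auto
    have qeq: "q z = Re (cnj b0 * (complex_of_real (g (\<Phi> z)) * h n z))" for z
      by (simp add: q_def h_def algebra_simps)
    have qint: "integrable lborel q"
      unfolding qeq[abs_def] by (intro integrable_Re integrable_mult_right gh)
    \<comment> \<open>Three cases: \<open>mollified\<close> vanishes at y; x is near
      \<open>X n\<close>, where both thresholds hold; x is far from \<open>X n\<close>, where the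
      minorant vanishes and q is at most a Gaussian tail.\<close>
    have pt: "c / 4 * (?B (fst z) * ?f (snd z)) - \<tau> n * cmod b0 * cmod (b z) \<le> q z" for z
    proof -
      obtain x y where z: "z = (x, y)" by force
      have tail0: "0 \<le> \<tau> n * cmod b0 * cmod (b z)" using \<tau>0 by simp
      show ?thesis
      proof (cases "?f y = 0")
        case True
        then show ?thesis using tail0 by (simp add: z q_def)
      next
        case False
        from mollified_support[OF this r(1)] obtain f where f: "f \<in> Y n" "dist y f < r n" by blast
        then have f': "f \<in> F" "dist y f < \<delta>" using \<nu>(3) rn by auto
        show ?thesis
        proof (cases "\<exists>a\<in>X n. dist x a < \<delta>")
          case True
          then obtain a where "a \<in> E" "dist x a < \<delta>" using m(3) by blast
          from nb[OF this f'] have zU: "c / 2 < Re (cnj b0 * b z)" "1 / 2 < g (\<Phi> z)" by (simp_all add: U_def z)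
          have "c / 4 * (?B x * ?f y) = 1 / 2 * (?f y * ?B x) * (c / 2)" by simp
          also have "\<dots> \<le> g (\<Phi> z) * (?f y * ?G x) * Re (cnj b0 * b z)"
            using zU c(1) f0 G0 B0 BG g01 by (intro mult_mono mult_left_mono mult_nonneg_nonneg) auto
          finally show ?thesis using tail0 by (simp add: z q_def)
        next
          case False
          then have far: "\<And>a. a \<in> X n \<Longrightarrow> \<delta> \<le> dist x a" by force
          have "?B x = 0" using ball_average_support[of "X n" "m n" "r n" x] far rn by force
          moreover have "\<bar>q z\<bar> \<le> \<tau> n * cmod b0 * cmod (b z)"
          proof -
            have "?f y * ?G x \<le> \<tau> n"
              unfolding \<tau>_def using smoothed_product_tail[OF m(1,2) \<nu>(1,2) r(1) less_imp_le[OF \<delta>] far] by simp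
            then have "g (\<Phi> z) * (?f y * ?G x) \<le> 1 * \<tau> n"
              using g01 f0 G0 by (intro mult_mono mult_nonneg_nonneg) auto
            moreover have "\<bar>Re (cnj b0 * b z)\<bar> \<le> cmod b0 * cmod (b z)"
              using abs_Re_le_cmod[of "cnj b0 * b z"] by (simp add: norm_mult)
            ultimately have "g (\<Phi> z) * (?f y * ?G x) * \<bar>Re (cnj b0 * b z)\<bar> \<le> 1 * \<tau> n * (cmod b0 * cmod (b z))"
              by (rule mult_mono) (auto simp: \<tau>0)
            then show ?thesis using g01 f0 G0 by (simp add: q_def z abs_mult mult.assoc)
          qed
          ultimately show ?thesis by (simp add: z)
        qed
      qed
    qed
    have Bf: "integrable lborel (\<lambda>z. ?B (fst z) * ?f (snd z))" "(\<integral>z. ?B (fst z) * ?f (snd z) \<partial>lborel) = \<kappa>"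
      using integrable_lborel_Times[OF ball_average_integral(1)[OF m(2) r(1)] mollified_integral(1)[OF \<nu>(4,2) r(1)], of n n]
      by (simp_all add: \<kappa>_def ball_average_integral(2)[OF m(2) r(1)] mollified_integral(2)[OF \<nu>(4,2) r(1)])
    have "c / 4 * \<kappa> - \<tau> n * cmod b0 * I = (\<integral>z. c / 4 * (?B (fst z) * ?f (snd z)) - \<tau> n * cmod b0 * cmod (b z) \<partial>lborel)"
      using Bf bint by (simp add: I_def)
    also have "\<dots> \<le> (\<integral>z. q z \<partial>lborel)"
      using Bf bint qint pt by (intro integral_mono) auto
    also have "\<dots> = Re (cnj b0 * (\<integral>z. complex_of_real (g (\<Phi> z)) * h n z \<partial>lborel))"
      unfolding qeq using gh by (subst integral_Re) (auto intro!: integrable_mult_right)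
    also have "\<dots> \<le> cmod (cnj b0 * (\<integral>z. complex_of_real (g (\<Phi> z)) * h n z \<partial>lborel))" by (rule complex_Re_le_cmod)
    also have "\<dots> = cmod b0 * cmod (\<integral>t. complex_of_real (g t) * A n t \<partial>lborel)" by (simp add: norm_mult dis)
    also have "\<dots> \<le> cmod b0 * (\<integral>t. cmod (complex_of_real (g t) * A n t) \<partial>lborel)"
      by (intro mult_left_mono integral_norm_bound) simp
    finally show ?thesis .
  qed
  define J where "J = (\<integral>t. g t \<partial>lborel)"
  have J0: "0 \<le> J" unfolding J_def by (intro integral_nonneg_AE) (auto simp: g01)
  \<comment> \<open>Makes \<open>e * (cmod b0 * J)\<close> at most c \<kappa> / 16, with the 1
    guarding against a zero divisor. Then c \<kappa> / 4 minus a tail below c \<kappa> / 16 would be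
    at most c \<kappa> / 16, a contradiction.\<close>
  define e where "e = c * \<kappa> / (16 * (cmod b0 * J + 1))"
  have e: "e > 0" unfolding e_def using c \<kappa> J0 by (intro divide_pos_pos mult_pos_pos) (auto intro: add_nonneg_pos)
  have "\<forall>\<^sub>F n in sequentially. \<forall>t\<in>W. dist (A n t) 0 < e" using lim e by (rule uniform_limitD)
  moreover have "\<forall>\<^sub>F n in sequentially. r n < \<delta>" using order_tendstoD(2)[OF r(2) \<delta>] .
  moreover have "\<forall>\<^sub>F n in sequentially. \<tau> n * cmod b0 * I < c * \<kappa> / 16"
  proof (rule order_tendstoD(2))
    have "\<tau> \<longlonglongrightarrow> 0" unfolding \<tau>_def by (rule gauss_tail_tendsto[OF r \<delta>])
    then have "(\<lambda>n. \<tau> n * (cmod b0 * I)) \<longlonglongrightarrow> 0 * (cmod b0 * I)" by (rule tendsto_mult_right)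
    then show "(\<lambda>n. \<tau> n * cmod b0 * I) \<longlonglongrightarrow> 0" by (simp add: mult.assoc)
  qed (use c \<kappa> in simp)
  ultimately have "\<forall>\<^sub>F n in sequentially. False"
  proof eventually_elim
    case (elim n)
    have "(\<integral>t. cmod (complex_of_real (g t) * A n t) \<partial>lborel) \<le> (\<integral>t. e * g t \<partial>lborel)"
    proof (rule integral_mono')
      show "cmod (complex_of_real (g t) * A n t) \<le> e * g t" for t
      proof (cases "g t = 0")
        case False
        then have "cmod (A n t) \<le> e" using elim(1) gW by (force simp: less_imp_le)
        then have "g t * cmod (A n t) \<le> g t * e" using g01[of t] by (intro mult_left_mono)
        then show ?thesis using g01[of t] by (simp add: norm_mult mult.commute)
      qed simp
    qed (use gint g01 e in auto)
    also have "\<dots> = e * J" by (simp add: J_def)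
    finally have "cmod b0 * (\<integral>t. cmod (complex_of_real (g t) * A n t) \<partial>lborel) \<le> cmod b0 * (e * J)"
      by (rule mult_left_mono) simp
    with lower[OF elim(2)] have 1: "c / 4 * \<kappa> - \<tau> n * cmod b0 * I \<le> e * (cmod b0 * J)" by (simp add: mult_ac)
    have "e * (cmod b0 * J) \<le> e * (cmod b0 * J + 1)" using e by simp
    also have "\<dots> = c * \<kappa> / 16"
    proof -
      have "x / (16 * y) * y = x / 16" if "y > 0" for x y :: real using that by simp
      moreover have "cmod b0 * J + 1 > 0" using J0 by (intro add_nonneg_pos) auto
      ultimately show ?thesis unfolding e_def by blast
    qed
    finally have "e * (cmod b0 * J) \<le> c * \<kappa> / 16" .
    moreover have "c * \<kappa> / 4 - \<tau> n * cmod b0 * I \<le> e * (cmod b0 * J)" using 1 by simp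
    moreover have "0 < c * \<kappa>" using c \<kappa> by simp
    ultimately show False using elim(3) by linarith
  qed
  then show False by simp
qed

text \<open>Here E and F are already the small pieces: the bound with \<open>b0\<close> is the phase
  control there. Frostman weights of fixed exponents are taken as given, which separates the
  limiting argument from the choice of exponents.\<close>

lemma image_interior_nonempty:
  fixes \<Phi> :: "(real^'d) \<times> (real^'d) \<Rightarrow> real^'k" and b :: "(real^'d) \<times> (real^'d) \<Rightarrow> complex"
    and \<alpha> sE sF CE CF :: real
  assumes \<Phi>: "smooth \<Phi>" and leray: "leray_density \<Phi> \<Lambda>" and b: "b \<in> test_functions"
    and E: "compact E" and F: "compact F" and W: "open W" "\<Phi> ` (E \<times> F) \<subseteq> W"
    and c: "c > 0" "\<And>z. z \<in> E \<times> F \<Longrightarrow> c \<le> Re (cnj b0 * b z)"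
    and sob: "\<And>s. \<exists>C. \<forall>t\<in>W. sobolev_bounded s (s + \<alpha>) C (radon_transform b (\<Lambda> t))"
    and sE: "0 \<le> sE" "sE \<le> CARD('d)" and sF: "0 \<le> sF" "sF \<le> CARD('d)"
    and dims: "2 * real CARD('d) - 2 * \<alpha> < sE + sF"
    and frE: "0 \<le> CE" "\<And>n. \<exists>X m. frostman_at CE sE ((1/2) ^ n) E X m"
    and frF: "0 \<le> CF" "\<And>n. \<exists>X m. frostman_at CF sF ((1/2) ^ n) F X m"
  shows "interior (\<Phi> ` (E \<times> F)) \<noteq> {}"
proof -
  obtain r X m Y \<nu> where r: "\<And>n. 0 < r n" "r \<longlonglongrightarrow> 0"
    and X: "\<And>n. frostman_at CE sE (r n) E (X n) (m n)" and Y: "\<And>n. frostman_at CF sF (r n) F (Y n) (\<nu> n)"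
    and Xc: "\<And>\<xi>. convergent (\<lambda>n. char_sum (X n) (m n) \<xi>)" and Yc: "\<And>\<xi>. convergent (\<lambda>n. char_sum (Y n) (\<nu> n) \<xi>)"
    by (rule frostman_pair_sequence[OF compact_imp_bounded[OF E] frE(2) compact_imp_bounded[OF F] frF(2)]) (rule that)
  have finX: "finite (X n)" and finY: "finite (Y n)" for n using X[of n] Y[of n] by (auto simp: frostman_at_def)
  have \<Phi>c: "continuous_on UNIV \<Phi>" by (rule smooth_continuous_on[OF \<Phi>])
  have bc: "continuous_on UNIV b" "compactly_supported b"
    using b smooth_continuous_on by (auto simp: test_functions_def)
  \<comment> \<open>Half of the surplus of \<alpha> goes to each order, which puts \<sigma>E and
    \<sigma>F above their critical values and makes their sum equal to \<alpha>.\<close>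
  define \<epsilon> where "\<epsilon> = (\<alpha> - ((CARD('d) - sE) / 2 + (CARD('d) - sF) / 2)) / 2"
  define \<sigma>E where "\<sigma>E = (CARD('d) - sE) / 2 + \<epsilon>"
  define \<sigma>F where "\<sigma>F = (CARD('d) - sF) / 2 + \<epsilon>"
  have \<epsilon>: "\<epsilon> > 0" using dims by (simp add: \<epsilon>_def field_simps)
  have \<sigma>: "(CARD('d) - sE) / 2 < \<sigma>E" "(CARD('d) - sF) / 2 < \<sigma>F" using \<epsilon> by (simp_all add: \<sigma>E_def \<sigma>F_def)
  have \<sigma>sum: "- (- \<sigma>F + \<alpha>) = - \<sigma>E" by (simp add: \<sigma>E_def \<sigma>F_def \<epsilon>_def field_simps)
  define f where "f n = (\<lambda>y. complex_of_real (mollified (Y n) (\<nu> n) (r n) y))" for n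
  define \<phi> where "\<phi> n = gauss_hat (X n) (m n) (r n)" for n
  define T where "T t = radon_transform b (\<Lambda> t)" for t
  define A where "A n t = T t (f n) (fourier (\<phi> n))" for n t
  have ft: "f n \<in> test_functions" for n unfolding f_def by (rule mollified_test[OF finY r(1)])
  have fs: "f n \<in> schwartz" for n using ft test_functions_subset_schwartz by blast
  have \<phi>s: "\<phi> n \<in> schwartz" for n unfolding \<phi>_def by (rule gauss_hat_schwartz[OF r(1)])
  have fdt: "(\<lambda>y. f n y - f k y) \<in> test_functions" for n k
  proof (rule test_functionsI)
    have "(\<lambda>y. f n y - f k y) \<in> schwartz" by (intro schwartz_diff fs)
    then show "smooth (\<lambda>y. f n y - f k y)" by (simp add: schwartz_def)
    show "compact (closure {y. f n y \<noteq> 0} \<union> closure {y. f k y \<noteq> 0})"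
      using ft by (auto simp: test_functions_def compactly_supported_def)
    show "y \<in> closure {y. f n y \<noteq> 0} \<union> closure {y. f k y \<noteq> 0}" if "f n y - f k y \<noteq> 0" for y
      using that closure_subset[of "{y. f n y \<noteq> 0}"] closure_subset[of "{y. f k y \<noteq> 0}"] by fastforce
  qed
  have prod_cont: "continuous_on UNIV (\<lambda>z. p (snd z) * h (fst z) * b z)"
    if "continuous_on UNIV p" "continuous_on UNIV h" for p h :: "real^'d \<Rightarrow> complex"
    by (intro continuous_intros bc continuous_on_compose2[OF that(1)] continuous_on_compose2[OF that(2)]) auto
  have prod_int: "integrable (\<Lambda> t) (\<lambda>z. p (snd z) * h (fst z) * b z)"
    if "p \<in> schwartz" "h \<in> schwartz" for p h :: "real^'d \<Rightarrow> complex" and t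
    using leray_finite[OF leray \<Phi>c]
    by (intro integrable_compactly_supported prod_cont compactly_supported_mult_right bc schwartz_continuous that
        sets_leray[OF leray \<Phi>c])
  have Aeq: "A n t = (\<integral>z. complex_of_real (mollified (Y n) (\<nu> n) (r n) (snd z))
      * complex_of_real (gauss_mollified (X n) (m n) (r n) (fst z)) * b z \<partial>\<Lambda> t)" for n t
    unfolding A_def T_def radon_transform_def f_def
    using fourier_schwartz[OF \<phi>s[of n]] by (simp add: \<phi>_def fourier_gauss_hat[OF r(1)])
  \<comment> \<open>The Sobolev bound at one order: it lands in order \<sigma>E, dual to the order
    -\<sigma>E in which the functions \<phi> n are controlled.\<close>
  obtain C where C: "\<And>t. t \<in> W \<Longrightarrow> sobolev_bounded (- \<sigma>F) (- \<sigma>F + \<alpha>) C (T t)"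
    using sob[of "- \<sigma>F"] unfolding T_def by blast
  have r0: "(\<lambda>n. r n *\<^sub>R \<xi>) \<longlonglongrightarrow> 0" for \<xi> :: "real^'d"
    using tendsto_scaleR[OF r(2) tendsto_const[of \<xi>]] by simp
  \<comment> \<open>As r n tends to 0 the smoothing factors tend to their values at frequency 0, so
    pointwise convergence of the exponential sums passes to the smoothed transforms.\<close>
  have scale_conv: "(\<lambda>n. g (r n *\<^sub>R \<xi>)) \<longlonglongrightarrow> g 0" if "g \<in> schwartz" for g :: "real^'d \<Rightarrow> complex" and \<xi>
    using schwartz_continuous[OF that, of UNIV] r0[of \<xi>]
    by (intro isCont_tendsto_compose[of 0 g]) (auto simp: continuous_on_eq_continuous_at)
  let ?G = "\<lambda>\<eta>::real^'d. complex_of_real (exp (- pi * (norm \<eta>)\<^sup>2))"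
  have Gs: "?G \<in> schwartz" by (rule gaussian_schwartz) simp
  have Us: "fourier unit_bump \<in> (schwartz :: (real^'d \<Rightarrow> complex) set)" by (rule fourier_schwartz[OF unit_bump_schwartz])
  have fhat: "fourier (f n) \<xi> = cnj (char_sum (Y n) (\<nu> n) \<xi>) * fourier unit_bump (r n *\<^sub>R \<xi>)" for n \<xi>
    unfolding f_def by (rule fourier_mollified[OF r(1)])
  have fconv: "convergent (\<lambda>n. fourier (f n) \<xi>)" for \<xi>
  proof -
    obtain l where "(\<lambda>n. char_sum (Y n) (\<nu> n) \<xi>) \<longlonglongrightarrow> l" using Yc[of \<xi>] by (auto simp: convergent_def)
    then have "(\<lambda>n. fourier (f n) \<xi>) \<longlonglongrightarrow> cnj l * fourier unit_bump (0 :: real^'d)"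
      unfolding fhat by (intro tendsto_mult tendsto_cnj scale_conv[OF Us])
    then show ?thesis by (auto simp: convergent_def)
  qed
  have \<phi>conv: "convergent (\<lambda>n. \<phi> n \<xi>)" for \<xi>
  proof -
    obtain l where "(\<lambda>n. char_sum (X n) (m n) \<xi>) \<longlonglongrightarrow> l" using Xc[of \<xi>] by (auto simp: convergent_def)
    then have "(\<lambda>n. \<phi> n \<xi>) \<longlonglongrightarrow> l * ?G 0"
      unfolding \<phi>_def gauss_hat_def by (intro tendsto_mult scale_conv[OF Gs])
    then show ?thesis by (auto simp: convergent_def)
  qed
  have fnorm: "cmod (fourier (f n) \<xi>) = cmod (char_sum (Y n) (\<nu> n) \<xi>) * cmod (fourier unit_bump (r n *\<^sub>R \<xi>))" for n \<xi>
    by (simp add: fhat norm_mult)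
  have \<phi>norm: "cmod (\<phi> n \<xi>) = cmod (char_sum (X n) (m n) \<xi>) * cmod (?G (r n *\<^sub>R \<xi>))" for n \<xi>
    unfolding \<phi>_def gauss_hat_def by (rule norm_mult)
  have dimE: "sE \<le> DIM(real^'d)" "(DIM(real^'d) - sE) / 2 < \<sigma>E" and dimF: "sF \<le> DIM(real^'d)" "(DIM(real^'d) - sF) / 2 < \<sigma>F"
    using sE sF \<sigma> by simp_all
  note wf = smoothed_weighted_Cauchy[OF sF(1) dimF Us frF(1) Y r(1) schwartz_measurable[OF fourier_schwartz[OF fs]] fnorm fconv]
  note w\<phi> = smoothed_weighted_Cauchy[OF sE(1) dimE Gs frE(1) X r(1) schwartz_measurable[OF \<phi>s] \<phi>norm \<phi>conv]
  have "uniformly_Cauchy_on W (\<lambda>n t. T t (f n) (fourier (\<phi> n)))"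
  proof (rule uniformly_Cauchy_pairing[OF C])
    show "T t (\<lambda>x. f n x - f k x) h = T t (f n) h - T t (f k) h" if "t \<in> W" "h \<in> schwartz" for t n k h
      using prod_int[OF fs that(2), of t n] prod_int[OF fs that(2), of t k] that(2)
      by (simp add: T_def radon_transform_def left_diff_distrib)
    show "T t (f n) (\<lambda>x. h x - k x) = T t (f n) h - T t (f n) k" if "t \<in> W" "h \<in> schwartz" "k \<in> schwartz" for t n h k
      using prod_int[OF fs that(2), of t n] prod_int[OF fs that(3), of t n] that schwartz_diff[OF that(2,3)]
      by (simp add: T_def radon_transform_def left_diff_distrib right_diff_distrib)
    show "\<exists>B. \<forall>n. (\<integral>\<xi>. sobolev_weight (- \<sigma>F) (fourier (f n)) \<xi> \<partial>lborel) \<le> B"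
      by (rule wf(1))
    show "\<exists>N. \<forall>n\<ge>N. \<forall>k\<ge>N. (\<integral>\<xi>. sobolev_weight (- \<sigma>F) (\<lambda>\<xi>. fourier (f n) \<xi> - fourier (f k) \<xi>) \<xi> \<partial>lborel) \<le> e"
      if "0 < e" for e by (rule wf(2)[OF that])
    show "\<exists>B. \<forall>n. (\<integral>\<xi>. sobolev_weight (- (- \<sigma>F + \<alpha>)) (\<phi> n) \<xi> \<partial>lborel) \<le> B"
      unfolding \<sigma>sum by (rule w\<phi>(1))
    show "\<exists>N. \<forall>n\<ge>N. \<forall>k\<ge>N. (\<integral>\<xi>. sobolev_weight (- (- \<sigma>F + \<alpha>)) (\<lambda>\<xi>. \<phi> n \<xi> - \<phi> k \<xi>) \<xi> \<partial>lborel) \<le> e"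
      if "0 < e" for e unfolding \<sigma>sum by (rule w\<phi>(2)[OF that])
  qed (use ft fdt \<phi>s in auto)
  then have "uniformly_convergent_on W A"
    unfolding A_def[abs_def] by (rule Cauchy_uniformly_convergent)
  then obtain L where L: "uniform_limit W A L sequentially" unfolding uniformly_convergent_on_def by blast
  have Acont: "continuous_on W (A n)" for n
  proof -
    have G: "(\<lambda>x. complex_of_real (gauss_mollified (X n) (m n) (r n) x)) = fourier (\<phi> n)"
      by (simp add: \<phi>_def fourier_gauss_hat[OF r(1), abs_def])
    have "continuous_on UNIV (\<lambda>z. f n (snd z) * fourier (\<phi> n) (fst z) * b z)"
      by (intro prod_cont schwartz_continuous fs fourier_schwartz \<phi>s)
    moreover have "compactly_supported (\<lambda>z. f n (snd z) * fourier (\<phi> n) (fst z) * b z)"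
      by (rule compactly_supported_mult_right[OF bc(2)])
    ultimately have "continuous_on UNIV (\<lambda>t. \<integral>z. f n (snd z) * fourier (\<phi> n) (fst z) * b z \<partial>\<Lambda> t)"
      using leray unfolding leray_density_def by blast
    moreover have "A n = (\<lambda>t. \<integral>z. f n (snd z) * fourier (\<phi> n) (fst z) * b z \<partial>\<Lambda> t)"
      using fourier_schwartz[OF \<phi>s[of n]] by (intro ext) (simp add: A_def T_def radon_transform_def)
    ultimately show ?thesis by (metis continuous_on_subset subset_UNIV)
  qed
  have gcont: "continuous_on UNIV (gauss_mollified (X n) (m n) (r n))" for n
  proof -
    have "continuous_on UNIV (\<lambda>x. Re (fourier (\<phi> n) x))"
      by (intro continuous_on_Re schwartz_continuous fourier_schwartz \<phi>s)
    then show ?thesis by (simp add: \<phi>_def fourier_gauss_hat[OF r(1)])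
  qed
  have Lcont: "continuous_on W L"
    by (rule uniform_limit_theorem[OF _ L]) (use Acont in auto)
  have "\<not> uniform_limit W A (\<lambda>_. 0) sequentially"
    by (rule densities_not_null[OF leray \<Phi>c bc E F W c r X Y Aeq gcont])
  \<comment> \<open>If L vanished on all of W, then A would converge uniformly to 0.\<close>
  then obtain t0 where t0: "t0 \<in> W" "L t0 \<noteq> 0"
    using L by (metis (mono_tags, lifting) uniform_limit_cong')
  have op: "open (W \<inter> L -` (- {0}))"
    by (rule continuous_open_preimage[OF Lcont W(1) open_Compl[OF closed_singleton]])
  have "W \<inter> L -` (- {0}) \<subseteq> \<Phi> ` (E \<times> F)"
  proof (rule ccontr)
    assume "\<not> W \<inter> L -` (- {0}) \<subseteq> \<Phi> ` (E \<times> F)"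
    then obtain t where t: "t \<in> W" "L t \<noteq> 0" "t \<notin> \<Phi> ` (E \<times> F)" by auto
    have "(\<lambda>n. A n t) \<longlonglongrightarrow> 0"
      unfolding Aeq
      by (rule level_off_image_tendsto_0[OF sets_leray[OF leray \<Phi>c] leray_finite[OF leray \<Phi>c]
            AE_leray[OF leray \<Phi>c] \<Phi>c bc E F t(3) r X Y])
    moreover have "(\<lambda>n. A n t) \<longlonglongrightarrow> L t" by (rule tendsto_uniform_limitI[OF L t(1)])
    ultimately show False using t(2) LIMSEQ_unique by blast
  qed
  from interior_maximal[OF this op] t0 show ?thesis by blast
qed

section \<open>Dimension bounds and reduction to small pieces\<close>

lemma hausdorff_dim_nonneg: "0 \<le> hausdorff_dim A"
  unfolding hausdorff_dim_def by (intro Inf_greatest) auto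

text \<open>A larger dimension would produce, by the Frostman lemma, weights of an exponent above d
  at all scales, which the energy comparison excludes. The bound makes the dimensions real numbers
  in the final argument.\<close>

lemma hausdorff_dim_compact_le:
  fixes E :: "'a::euclidean_space set"
  assumes E: "compact E"
  shows "hausdorff_dim E \<le> ereal DIM('a)"
proof (rule ccontr)
  assume "\<not> hausdorff_dim E \<le> ereal DIM('a)"
  then obtain s where s: "ereal DIM('a) < ereal s" "ereal s < hausdorff_dim E"
    using ereal_dense2[of "ereal DIM('a)" "hausdorff_dim E"] by (auto simp: not_le)
  then have s0: "0 < s" by (metis ereal_less(2) ereal_less_eq(3) less_le_trans of_nat_0_le_iff order_le_less_trans zero_ereal_def)
  from frostman[OF E s0 not_null_cover[OF s0 s(2)]] obtain C where
    "C > 0" "\<And>n. \<exists>X m. frostman_at C s ((1/2) ^ n) E X m" by blast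
  from frostman_exponent_le_dim[OF compact_imp_bounded[OF E] less_imp_le[OF s0] less_imp_le[OF this(1)] this(2)] s
  show False by simp
qed

text \<open>Null sets are stable under finite unions, so some piece of a finite cover by small balls
  fails to be null. Non-nullity at the exponent s is what the Frostman lemma asks of the
  piece.\<close>

lemma compact_small_piece_not_null:
  fixes E :: "'a::euclidean_space set"
  assumes E: "compact E" and nn: "\<not> null_cover s E" and \<delta>: "\<delta> > 0"
  obtains x where "\<not> null_cover s (E \<inter> cball x \<delta>)"
proof -
  obtain I where I: "finite I" "E \<subseteq> (\<Union>x\<in>I. ball x \<delta>)"
    using compactE_image[OF E, of E "\<lambda>x. ball x \<delta>"] \<delta> by (metis UN_I centre_in_ball open_ball subsetI)
  have "\<exists>x\<in>I. \<not> null_cover s (E \<inter> cball x \<delta>)"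
  proof (rule ccontr)
    assume "\<not> (\<exists>x\<in>I. \<not> null_cover s (E \<inter> cball x \<delta>))"
    then have "null_cover s (\<Union>x\<in>I. E \<inter> cball x \<delta>)" using I(1) by (intro null_cover_UN) auto
    moreover have "(\<Union>x\<in>I. E \<inter> cball x \<delta>) = E" using I(2) by force
    ultimately show False using nn by simp
  qed
  then show ?thesis using that by blast
qed

theorem theorem1p5:
  fixes \<Phi> :: "(real^'d) \<times> (real^'d) \<Rightarrow> real^'k"
    and E F :: "(real^'d) set"
    and W :: "(real^'k) set"
    and \<Lambda> :: "real^'k \<Rightarrow> ((real^'d) \<times> (real^'d)) measure"
    and b :: "(real^'d) \<times> (real^'d) \<Rightarrow> complex"
    and \<alpha> \<beta> :: real
  assumes "CARD('k) \<le> CARD('d)"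
    and "smooth \<Phi>"
    and "\<And>x y. rank (jacobian (\<lambda>x'. \<Phi> (x', y)) (at x)) = CARD('k)"
    and "\<And>x y. rank (jacobian (\<lambda>y'. \<Phi> (x, y')) (at y)) = CARD('k)"
    and "compact E" and "compact F"
    and "open W" and "bounded W" and "\<Phi> ` (E \<times> F) \<subseteq> W"
    and "leray_density \<Phi> \<Lambda>"
    and "b \<in> test_functions"
    and "\<exists>U. open U \<and> E \<times> F \<subseteq> U \<and> (\<forall>z\<in>U. b z \<noteq> 0)"
    and "0 \<le> \<alpha>" and "\<alpha> \<le> (real CARD('d) - real CARD('k)) / 2"
    and "\<And>s. \<exists>C. \<forall>t\<in>W. sobolev_bounded s (s + \<alpha>) C (radon_transform b (\<Lambda> t))"
    and "\<beta> = (real CARD('d) - real CARD('k)) / 2 - \<alpha>"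
    and "hausdorff_dim E + hausdorff_dim F > ereal (2 * real CARD('d) - 2 * \<alpha>)"
  shows "2 * real CARD('d) - 2 * \<alpha> = real CARD('d) + real CARD('k) + 2 * \<beta> \<and>
         interior {\<Phi> (x, y) | x y. x \<in> E \<and> y \<in> F} \<noteq> {}"
proof
  show "2 * real CARD('d) - 2 * \<alpha> = real CARD('d) + real CARD('k) + 2 * \<beta>"
    using assms(16) by (simp add: field_simps)
  note E = assms(5) and F = assms(6)
  obtain e where e: "hausdorff_dim E = ereal e" "0 \<le> e" "e \<le> CARD('d)"
    using hausdorff_dim_nonneg[of E] hausdorff_dim_compact_le[OF E] by (cases "hausdorff_dim E") auto
  obtain f where f: "hausdorff_dim F = ereal f" "0 \<le> f" "f \<le> CARD('d)"
    using hausdorff_dim_nonneg[of F] hausdorff_dim_compact_le[OF F] by (cases "hausdorff_dim F") auto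
  \<comment> \<open>Lowering each dimension by a third of the surplus leaves a third of it for the
    strict inequality.\<close>
  define \<gamma> where "\<gamma> = (e + f - (2 * real CARD('d) - 2 * \<alpha>)) / 3"
  define sE where "sE = e - \<gamma>"
  define sF where "sF = f - \<gamma>"
  have \<gamma>: "\<gamma> > 0" using assms(17) by (simp add: \<gamma>_def e f)
  have sum: "2 * real CARD('d) - 2 * \<alpha> < sE + sF"
    using \<gamma> by (simp add: sE_def sF_def \<gamma>_def field_simps)
  have le: "sE \<le> CARD('d)" "sF \<le> CARD('d)" using \<gamma> e f by (simp_all add: sE_def sF_def)
  \<comment> \<open>The upper bound on \<alpha> makes the threshold at least d; as neither exponent
    exceeds d, both must be positive.\<close>
  have k: "2 * real CARD('d) - 2 * \<alpha> \<ge> real CARD('d)" using assms(14) by (simp add: field_simps)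
  have pos: "0 < sE" "0 < sF" using sum le k by simp_all
  have nnE: "\<not> null_cover sE E" using \<gamma> by (intro not_null_cover pos) (simp add: e sE_def)
  have nnF: "\<not> null_cover sF F" using \<gamma> by (intro not_null_cover pos) (simp add: f sF_def)
  have "E \<noteq> {}" "F \<noteq> {}" using nnE nnF null_cover_empty by metis+
  then have ne: "E \<times> F \<noteq> {}" by simp
  have EF: "compact (E \<times> F)" using E F by (rule compact_Times)
  have b0: "b z \<noteq> 0" if "z \<in> E \<times> F" for z using assms(12) that by blast
  have bc: "continuous_on (E \<times> F) b"
    using assms(11) smooth_continuous_on by (auto simp: test_functions_def)
  obtain w where w: "w \<in> E \<times> F" "\<And>z. z \<in> E \<times> F \<Longrightarrow> cmod (b w) \<le> cmod (b z)"
    using continuous_attains_inf[OF EF ne continuous_on_norm[OF bc]] by blast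
  define \<mu> where "\<mu> = cmod (b w)"
  have \<mu>: "\<mu> > 0" using b0[OF w(1)] by (simp add: \<mu>_def)
  from compact_uniformly_continuous[OF bc EF] \<mu>
  obtain \<delta> where \<delta>: "\<delta> > 0"
    and uc: "\<And>z z'. z \<in> E \<times> F \<Longrightarrow> z' \<in> E \<times> F \<Longrightarrow> dist z' z < \<delta> \<Longrightarrow> dist (b z') (b z) < \<mu> / 2"
    unfolding uniformly_continuous_on_def by (metis half_gt_zero)
  \<comment> \<open>Two points of a ball of radius \<delta> / 5 differ by at most 2 \<delta> / 5,
    hence two points of the product by at most 4 \<delta> / 5.\<close>
  have \<delta>5: "\<delta> / 5 > 0" using \<delta> by simp
  obtain x0 where x0: "\<not> null_cover sE (E \<inter> cball x0 (\<delta> / 5))"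
    by (rule compact_small_piece_not_null[OF E nnE \<delta>5])
  obtain y0 where y0: "\<not> null_cover sF (F \<inter> cball y0 (\<delta> / 5))"
    by (rule compact_small_piece_not_null[OF F nnF \<delta>5])
  let ?E = "E \<inter> cball x0 (\<delta> / 5)" and ?F = "F \<inter> cball y0 (\<delta> / 5)"
  have cE: "compact ?E" and cF: "compact ?F" using E F by (auto intro: compact_Int_closed)
  have "?E \<noteq> {}" "?F \<noteq> {}" using x0 y0 null_cover_empty by metis+
  then have "?E \<times> ?F \<noteq> {}" by simp
  then obtain z0 where z0: "z0 \<in> ?E \<times> ?F" by blast
  have close: "dist z z0 < \<delta>" if "z \<in> ?E \<times> ?F" for z
  proof -
    have "dist (fst z) (fst z0) \<le> \<delta> / 5 + \<delta> / 5" "dist (snd z) (snd z0) \<le> \<delta> / 5 + \<delta> / 5"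
      using that z0 dist_triangle3[of "fst z" "fst z0" x0] dist_triangle3[of "snd z" "snd z0" y0]
      by (auto simp: mem_Times_iff)
    moreover have "dist z z0 \<le> dist (fst z) (fst z0) + dist (snd z) (snd z0)"
      unfolding dist_prod_def by (rule sqrt_sum_squares_le_sum) auto
    ultimately show ?thesis using \<delta> by simp
  qed
  \<comment> \<open>With |b z0| \<ge> \<mu> and |b z - b z0| < \<mu> / 2 the real part is at least
    |b z0| (|b z0| - \<mu> / 2), hence at least \<mu>^2 / 2.\<close>
  have Re: "\<mu>\<^sup>2 / 2 \<le> Re (cnj (b z0) * b z)" if z: "z \<in> ?E \<times> ?F" for z
  proof -
    have "cmod (b z - b z0) < \<mu> / 2" using uc[of z0 z] z z0 close[OF z] by (auto simp: dist_norm)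
    have "\<mu> \<le> cmod (b z0)" using w(2)[of z0] z0 by (auto simp: \<mu>_def)
    have "Re (cnj (b z0) * b z) = (cmod (b z0))\<^sup>2 + Re (cnj (b z0) * (b z - b z0))"
    proof -
      have "(cmod (b z0))\<^sup>2 = Re (cnj (b z0) * b z0)"
        by (simp only: cmod_power2) (simp add: power2_eq_square)
      then show ?thesis by (simp add: algebra_simps)
    qed
    moreover have "\<bar>Re (cnj (b z0) * (b z - b z0))\<bar> \<le> cmod (b z0) * (\<mu> / 2)"
    proof -
      have "\<bar>Re (cnj (b z0) * (b z - b z0))\<bar> \<le> cmod (b z0) * cmod (b z - b z0)"
        using abs_Re_le_cmod[of "cnj (b z0) * (b z - b z0)"] by (simp add: norm_mult)
      also have "\<dots> \<le> cmod (b z0) * (\<mu> / 2)"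
        using \<open>cmod (b z - b z0) < \<mu> / 2\<close> by (intro mult_left_mono) auto
      finally show ?thesis .
    qed
    moreover have "\<mu> * (\<mu> / 2) \<le> cmod (b z0) * (cmod (b z0) - \<mu> / 2)"
      using \<open>\<mu> \<le> cmod (b z0)\<close> \<mu> by (intro mult_mono) auto
    moreover have "\<mu> * (\<mu> / 2) = \<mu>\<^sup>2 / 2" "cmod (b z0) * (cmod (b z0) - \<mu> / 2) = (cmod (b z0))\<^sup>2 - cmod (b z0) * (\<mu> / 2)"
      by (simp_all add: power2_eq_square right_diff_distrib)
    ultimately show ?thesis by linarith
  qed
  from frostman[OF cE pos(1) x0] obtain CE where CE: "CE > 0" "\<And>n. \<exists>X m. frostman_at CE sE ((1/2) ^ n) ?E X m" by blast
  from frostman[OF cF pos(2) y0] obtain CF where CF: "CF > 0" "\<And>n. \<exists>X m. frostman_at CF sF ((1/2) ^ n) ?F X m" by blast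
  have "interior (\<Phi> ` (?E \<times> ?F)) \<noteq> {}"
  proof (rule image_interior_nonempty[OF assms(2,10,11) cE cF assms(7) _ _ Re assms(15) _ le(1) _ le(2) sum _ CE(2) _ CF(2)])
    show "\<Phi> ` (?E \<times> ?F) \<subseteq> W" using assms(9) by blast
  qed (use \<mu> pos CE CF in auto)
  moreover have "\<Phi> ` (?E \<times> ?F) \<subseteq> {\<Phi> (x, y) | x y. x \<in> E \<and> y \<in> F}" by auto
  ultimately show "interior {\<Phi> (x, y) | x y. x \<in> E \<and> y \<in> F} \<noteq> {}"
    using interior_mono by blast
qed

end
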